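(* Assume that either $\mu=\alpha_1\alpha_2<1/4$, or $\alpha_1=\alpha_2\in[1/2,1)$. Then, for each choice of the sign $\pm$, almost surely $$\limsup_{t\to\infty}\pm\frac{V_t}{\sqrt{2t\log\log t}}=\begin{cases}\left(\dfrac{2\{1-\alpha_1-\alpha_2+(\alpha_1-\alpha_2)^2\}}{1-4\alpha_1\alpha_2}\right)^{1/2},&\mu<1/4,\\[4mm]\left(\dfrac{2}{1+2\alpha_1}\right)^{1/2},&\alpha_1=\alpha_2\in[1/2,1).\end{cases}$$
   Context: $\alpha_1,\alpha_2\in[-1,1]$, $\mu=\alpha_1\alpha_2$, $A=\begin{pmatrix}0&\alpha_1\\ \alpha_2&0\end{pmatrix}$, $x^A:=e^{(\log x)A}$ for $x>0$, $\mathbf e=(1,-1)^\top$. $V=\{V_t\}_{t\ge0}$ is the centered continuous real Gaussian process with $V_0=0$ given for $t>0$ by (a) $V_t=\int_0^t\mathbf e^\top(t/s)^A\,dB_s$ with $B$ a two-dimensional standard Brownian motion, if $\mu<1/4$; (b) $V_t=\sqrt2\int_0^t(t/s)^{-\alpha_1}\,dW_s$ with $W$ a standard Brownian motion, if $\alpha_1=\alpha_2\in[1/2,1)$. (Continuous modifications are taken.) *)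

theory Defs
  imports "HOL-Probability.Probability"
begin

definition matrix_exp :: "real^'n^'n \<Rightarrow> real^'n^'n" where
  "matrix_exp A = (\<Sum>k. (1 / fact k) *\<^sub>R (((**) A ^^ k) (mat 1)))"

text \<open>The power \<open>x\<^sup>A\<close>, meaningful for \<open>x > 0\<close> only.\<close>

definition matrix_powr :: "real \<Rightarrow> real^'n^'n \<Rightarrow> real^'n^'n" where
  "matrix_powr x A = matrix_exp (ln x *\<^sub>R A)"

text \<open>Degenerate (almost surely zero) variables count as Gaussian.\<close>

definition centered_gaussian_rv :: "'a measure \<Rightarrow> ('a \<Rightarrow> real) \<Rightarrow> bool" where
  "centered_gaussian_rv M X \<longleftrightarrow> X \<in> borel_measurable M \<and>
     ((AE \<omega> in M. X \<omega> = 0) \<or>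
      (\<exists>\<sigma>>0. distributed M lborel X (\<lambda>x. ennreal (normal_density 0 \<sigma> x))))"

definition centered_gaussian_process ::
    "'a measure \<Rightarrow> real set \<Rightarrow> (real \<Rightarrow> 'a \<Rightarrow> real) \<Rightarrow> bool" where
  "centered_gaussian_process M T V \<longleftrightarrow>
     (\<forall>J c. finite J \<and> J \<subseteq> T \<longrightarrow> centered_gaussian_rv M (\<lambda>\<omega>. \<Sum>t\<in>J. c t * V t \<omega>))"

definition standard_brownian_motion_real ::
    "'a measure \<Rightarrow> (real \<Rightarrow> 'a \<Rightarrow> real) \<Rightarrow> bool" where
  "standard_brownian_motion_real M W \<longleftrightarrow>
     (\<forall>t\<ge>0. W t \<in> borel_measurable M) \<and>
     (AE \<omega> in M. W 0 \<omega> = 0) \<and>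
     (AE \<omega> in M. continuous_on {0..} (\<lambda>t. W t \<omega>)) \<and>
     (\<forall>s t. 0 \<le> s \<and> s < t \<longrightarrow>
        distributed M lborel (\<lambda>\<omega>. W t \<omega> - W s \<omega>)
          (\<lambda>x. ennreal (normal_density 0 (sqrt (t - s)) x))) \<and>
     (\<forall>n (p :: nat \<Rightarrow> real). 0 \<le> p 0 \<and> (\<forall>i<n. p i < p (Suc i)) \<longrightarrow>
        prob_space.indep_vars M (\<lambda>_. borel) (\<lambda>i \<omega>. W (p (Suc i)) \<omega> - W (p i) \<omega>) {..<n})"

text \<open>
  The dimension is that of the Euclidean space \<open>'b\<close>: the coordinate processes are
  real Brownian motions, and they are independent as random elements of the space of paths.
  For \<open>'b = real\<close> the only coordinate is the process itself.
\<close>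

definition standard_brownian_motion ::
    "'a measure \<Rightarrow> (real \<Rightarrow> 'a \<Rightarrow> 'b::euclidean_space) \<Rightarrow> bool" where
  "standard_brownian_motion M B \<longleftrightarrow>
     (\<forall>b\<in>Basis. standard_brownian_motion_real M (\<lambda>t \<omega>. B t \<omega> \<bullet> b)) \<and>
     prob_space.indep_vars M (\<lambda>_. PiM {0..} (\<lambda>_. borel))
       (\<lambda>b \<omega>. \<lambda>t\<in>{0..}. B t \<omega> \<bullet> b) Basis"

text \<open>
  The step function with value \<open>c i\<close> on \<open>(p i, p (i + 1)]\<close> for \<open>i < m\<close>, and its integral
  against a process; for vectors the integral is \<open>\<integral> \<phi>\<^sup>T dB\<close>.
\<close>

definition step_function ::
    "nat \<Rightarrow> (nat \<Rightarrow> real) \<Rightarrow> (nat \<Rightarrow> 'b) \<Rightarrow> real \<Rightarrow> 'b::euclidean_space" where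
  "step_function m p c s = (\<Sum>i<m. indicator {p i<..p (Suc i)} s *\<^sub>R c i)"

definition step_integral ::
    "(real \<Rightarrow> 'a \<Rightarrow> 'b) \<Rightarrow> nat \<Rightarrow> (nat \<Rightarrow> real) \<Rightarrow> (nat \<Rightarrow> 'b::euclidean_space) \<Rightarrow> 'a \<Rightarrow> real" where
  "step_integral B m p c \<omega> = (\<Sum>i<m. c i \<bullet> (B (p (Suc i)) \<omega> - B (p i) \<omega>))"

text \<open>
  \<open>J\<close> is a version of \<open>\<integral>\<^sub>0\<^sup>t f(s)\<^sup>T dB\<^sub>s\<close>: the \<open>L\<^sup>2(M)\<close> limit of the integrals of step
  functions which converge to \<open>f\<close> in \<open>L\<^sup>2((0,t])\<close>.  By the isometry, \<open>J\<close> is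
  determined almost surely and does not depend on the approximating sequence.
\<close>

definition has_wiener_integral ::
    "'a measure \<Rightarrow> (real \<Rightarrow> 'a \<Rightarrow> 'b::euclidean_space) \<Rightarrow> real \<Rightarrow> (real \<Rightarrow> 'b) \<Rightarrow> ('a \<Rightarrow> real) \<Rightarrow> bool" where
  "has_wiener_integral M B t f J \<longleftrightarrow>
     set_borel_measurable lborel {0<..t} f \<and> J \<in> borel_measurable M \<and>
     (\<exists>(m :: nat \<Rightarrow> nat) (p :: nat \<Rightarrow> nat \<Rightarrow> real) (c :: nat \<Rightarrow> nat \<Rightarrow> 'b).
        (\<forall>n. 0 \<le> p n 0 \<and> (\<forall>i<m n. p n i < p n (Suc i)) \<and> p n (m n) \<le> t) \<and>
        (\<lambda>n. \<integral>\<^sup>+s\<in>{0<..t}. ennreal ((norm (f s - step_function (m n) (p n) (c n) s))\<^sup>2) \<partial>lborel)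
          \<longlonglongrightarrow> 0 \<and>
        (\<lambda>n. \<integral>\<^sup>+\<omega>. ennreal ((J \<omega> - step_integral B (m n) (p n) (c n) \<omega>)\<^sup>2) \<partial>M) \<longlonglongrightarrow> 0)"

definition A_matrix :: "real \<Rightarrow> real \<Rightarrow> real^2^2" where
  "A_matrix \<alpha>\<^sub>1 \<alpha>\<^sub>2 = vector [vector [0, \<alpha>\<^sub>1], vector [\<alpha>\<^sub>2, 0]]"

definition e_vector :: "real^2" where
  "e_vector = vector [1, -1]"

definition limit_process ::
    "'a measure \<Rightarrow> real \<Rightarrow> real \<Rightarrow> (real \<Rightarrow> 'a \<Rightarrow> real) \<Rightarrow> bool" where
  "limit_process M \<alpha>\<^sub>1 \<alpha>\<^sub>2 V \<longleftrightarrow>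
     centered_gaussian_process M {0..} V \<and>
     (AE \<omega> in M. continuous_on {0..} (\<lambda>t. V t \<omega>)) \<and>
     (AE \<omega> in M. V 0 \<omega> = 0) \<and>
     (\<alpha>\<^sub>1 * \<alpha>\<^sub>2 < 1/4 \<longrightarrow>
        (\<exists>B :: real \<Rightarrow> 'a \<Rightarrow> real^2. standard_brownian_motion M B \<and>
           (\<forall>t>0. has_wiener_integral M B t
              (\<lambda>s. e_vector v* matrix_powr (t / s) (A_matrix \<alpha>\<^sub>1 \<alpha>\<^sub>2)) (V t)))) \<and>
     (\<alpha>\<^sub>1 = \<alpha>\<^sub>2 \<and> 1/2 \<le> \<alpha>\<^sub>1 \<and> \<alpha>\<^sub>1 < 1 \<longrightarrow>
        (\<exists>W :: real \<Rightarrow> 'a \<Rightarrow> real. standard_brownian_motion M W \<and>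
           (\<forall>t>0. \<exists>J. has_wiener_integral M W t (\<lambda>s. (t / s) powr (- \<alpha>\<^sub>1)) J \<and>
              (AE \<omega> in M. V t \<omega> = sqrt 2 * J \<omega>))))"

end

theory Submission
  imports Defs "HOL-Real_Asymp.Real_Asymp"
begin

text \<open>
  Both processes have the form \<open>V t = \<integral>\<^sub>0\<^sup>t h (ln (t / s)) \<bullet> dB s\<close>, with \<open>h y = e\<^sup>T exp (y A)\<close> or
  \<open>h y = \<surd>2 exp (- \<alpha> y)\<close>, and in both cases \<open>h\<close> and its derivative are bounded by a multiple
  of \<open>exp (r y)\<close> for some \<open>r < 1/2\<close>.  By the isometry \<open>V t\<close> has variance \<open>c t\<close> with
  \<open>c = \<integral>\<^sub>0\<^sup>1 \<bar>h (- ln u)\<bar>\<^sup>2 du\<close>, and \<open>V\<close> satisfies the law of the iterated logarithm of a Brownian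
  motion of variance \<open>c\<close>, although its increments are dependent (\<open>self_similar_lil\<close>).

  The upper bound (\<open>gaussian_lil_upper\<close>) is a fact on Gaussian processes: it needs only
  that \<open>V t\<close> has variance at most \<open>c t\<close> and \<open>V t - V s\<close> variance at most \<open>K (t - s)\<close> for
  \<open>s \<le> t \<le> 2 s\<close>.  On the grid \<open>q\<^sup>n\<close> the Borel--Cantelli lemma gives the constant \<open>\<surd>c\<close>, and
  chaining along dyadic points shows that the oscillation of \<open>V\<close> in \<open>[q\<^sup>n, q\<^sup>n\<^sup>+\<^sup>1]\<close> is at most a
  multiple of \<open>\<surd>(q - 1) \<surd>(q\<^sup>n ln n)\<close>, which is negligible when \<open>q\<close> is close to 1.

  The lower bound (\<open>wiener_lil_lower\<close>) uses the grid \<open>t\<^sub>n = q\<^sup>n\<^sup>+\<^sup>1\<close> with a large \<open>q\<close>.  The part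
  of \<open>V t\<^sub>n\<close> which comes from \<open>(0, t\<^sub>n / q]\<close> has variance at most \<open>\<epsilon> t\<^sub>n\<close>, where \<open>\<epsilon>\<close> is small for large
  \<open>q\<close>, and the parts from the blocks \<open>(t\<^sub>n / q, t\<^sub>n]\<close> are independent, so that the second
  Borel--Cantelli lemma applies to them.  A Wiener integral is only an \<open>L\<^sup>2\<close> limit of step
  integrals.  Therefore \<open>V t\<^sub>n\<close> is first replaced by one step integral with a summable relative error;
  this step integral is then split at \<open>t\<^sub>n / q\<close>.  Its two parts are exactly Gaussian and the
  later parts are exactly independent, as they are linear combinations of finitely many Brownian
  increments (\<open>increment_sum_gaussian\<close>, \<open>increment_sum_indep_blocks\<close>), so independence never has
  to be carried through a limit.

  For the constant: \<open>A\<^sup>2 = \<mu> I\<close>, so \<open>exp (y A) = C y I + S y A\<close> with \<open>C' = \<mu> S\<close> and \<open>S' = C\<close>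
  (\<open>exponential_pair\<close>, \<open>matrix_exp_A_matrix\<close>).  The energy \<open>\<bar>h y\<bar>\<^sup>2 exp (- y)\<close> is a quadratic form
  in \<open>C\<close> and \<open>S\<close> times \<open>exp (- y)\<close>, and so is its antiderivative, whose value at \<open>y = 0\<close> is read off
  (\<open>kernel_energy\<close>).
\<close>

section \<open>Tails of centered Gaussian variables\<close>

text \<open>
  For \<open>x, z \<ge> 0\<close> the density at \<open>x + z\<close> is at most \<open>exp (- x\<^sup>2 / 2)\<close> times the density at \<open>z\<close>.
\<close>

lemma (in prob_space) standard_normal_tail_upper:
  assumes X: "distributed M lborel X std_normal_density" and x: "0 \<le> x"
  shows "prob {\<omega>\<in>space M. x < X \<omega>} \<le> exp (- x\<^sup>2 / 2)"
proof -
  have [measurable]: "X \<in> borel_measurable M"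
    using distributed_measurable[OF X] by simp
  have "emeasure M {\<omega>\<in>space M. x < X \<omega>} = emeasure M (X -` {x<..} \<inter> space M)"
    by (auto intro!: arg_cong[where f="emeasure M"])
  also have "\<dots> = (\<integral>\<^sup>+y. ennreal (std_normal_density y) * indicator {x<..} y \<partial>lborel)"
    by (rule distributed_emeasure[OF X]) simp
  also have "\<dots> = (\<integral>\<^sup>+z. ennreal (std_normal_density (x + z)) * indicator {x<..} (x + z) \<partial>lborel)"
    by (subst nn_integral_real_affine[where c=1 and t=x]) auto
  also have "\<dots> \<le> (\<integral>\<^sup>+z. ennreal (exp (- x\<^sup>2 / 2)) * ennreal (std_normal_density z) \<partial>lborel)"
  proof (rule nn_integral_mono)
    fix z :: real
    show "ennreal (std_normal_density (x + z)) * indicator {x<..} (x + z)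
        \<le> ennreal (exp (- x\<^sup>2 / 2)) * ennreal (std_normal_density z)"
    proof (cases "0 < z")
      case True
      have "exp (- (x + z)\<^sup>2 / 2) \<le> exp (- x\<^sup>2 / 2) * exp (- z\<^sup>2 / 2)"
        using x True by (simp add: exp_add[symmetric] power2_eq_square field_simps)
      hence "std_normal_density (x + z) \<le> exp (- x\<^sup>2 / 2) * std_normal_density z"
        by (simp add: std_normal_density_def divide_right_mono)
      thus ?thesis by (simp add: ennreal_mult'[symmetric] True)
    qed (simp add: indicator_def)
  qed
  also have "\<dots> = ennreal (exp (- x\<^sup>2 / 2)) * (\<integral>\<^sup>+z. ennreal (std_normal_density z) \<partial>lborel)"
    by (rule nn_integral_cmult) simp
  also have "(\<integral>\<^sup>+z. ennreal (std_normal_density z) \<partial>lborel) = 1"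
    by (subst nn_integral_eq_integral) auto
  finally show ?thesis by (simp add: emeasure_eq_measure)
qed

text \<open>
  The mass of \<open>(x, x + 1]\<close> alone is enough: compared with the whole tail it loses a factor of
  order \<open>exp (- x)\<close>, and against \<open>exp (- x\<^sup>2 / 2)\<close> this does not matter for the divergence of the series
  in \<open>gaussian_sequence_frequently_gt\<close>.
\<close>

lemma (in prob_space) standard_normal_tail_lower:
  assumes X: "distributed M lborel X std_normal_density" and x: "0 \<le> x"
  shows "std_normal_density (x + 1) \<le> prob {\<omega>\<in>space M. x < X \<omega>}"
proof -
  have [measurable]: "X \<in> borel_measurable M"
    using distributed_measurable[OF X] by simp
  have "ennreal (std_normal_density (x + 1))
      = (\<integral>\<^sup>+y. ennreal (std_normal_density (x + 1)) * indicator {x<..x + 1} y \<partial>lborel)"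
    by (subst nn_integral_cmult) (auto simp: ennreal_mult'[symmetric])
  also have "\<dots> \<le> (\<integral>\<^sup>+y. ennreal (std_normal_density y) * indicator {x<..} y \<partial>lborel)"
  proof (rule nn_integral_mono)
    fix y :: real
    have "std_normal_density (x + 1) \<le> std_normal_density y" if "x < y" "y \<le> x + 1"
    proof -
      have "y\<^sup>2 \<le> (x + 1)\<^sup>2" using that x by (intro power_mono) auto
      thus ?thesis by (simp add: std_normal_density_def divide_right_mono)
    qed
    thus "ennreal (std_normal_density (x + 1)) * indicator {x<..x + 1} y
        \<le> ennreal (std_normal_density y) * indicator {x<..} y"
      by (auto simp: indicator_def ennreal_leI)
  qed
  also have "\<dots> = emeasure M (X -` {x<..} \<inter> space M)"
    by (rule distributed_emeasure[OF X, symmetric]) simp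
  also have "\<dots> = emeasure M {\<omega>\<in>space M. x < X \<omega>}"
    by (auto intro!: arg_cong[where f="emeasure M"])
  finally show ?thesis by (simp add: emeasure_eq_measure)
qed

lemma (in prob_space) normal_second_moment:
  assumes X: "distributed M lborel X (\<lambda>x. ennreal (normal_density 0 s x))" and s: "0 < s"
  shows "(\<integral>\<^sup>+\<omega>. ennreal ((X \<omega>)\<^sup>2) \<partial>M) = ennreal (s\<^sup>2)"
proof -
  have "(\<integral>\<^sup>+\<omega>. ennreal ((X \<omega>)\<^sup>2) \<partial>M) = (\<integral>\<^sup>+y. ennreal (normal_density 0 s y) * ennreal (y\<^sup>2) \<partial>lborel)"
    by (rule distributed_nn_integral[OF X, symmetric]) simp
  also have "\<dots> = ennreal (\<integral>y. normal_density 0 s y * (y - 0)^(2*1) \<partial>lborel)"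
    using integrable_normal_moment[OF s, of 0 2]
    by (subst nn_integral_eq_integral[symmetric]) (auto simp: ennreal_mult'[symmetric])
  also have "(\<integral>y. normal_density 0 s y * (y - 0)^(2*1) \<partial>lborel) = s\<^sup>2"
    by (subst integral_normal_moment_even[OF s]) (simp add: fact_numeral)
  finally show ?thesis .
qed

lemma (in prob_space) centered_gaussian_normal:
  assumes X: "centered_gaussian_rv M X" and v: "(\<integral>\<^sup>+\<omega>. ennreal ((X \<omega>)\<^sup>2) \<partial>M) = ennreal v" "0 < v"
  shows "distributed M lborel X (\<lambda>x. ennreal (normal_density 0 (sqrt v) x))"
proof -
  have "\<not> (AE \<omega> in M. X \<omega> = 0)"
  proof
    assume "AE \<omega> in M. X \<omega> = 0"
    hence "(\<integral>\<^sup>+\<omega>. ennreal ((X \<omega>)\<^sup>2) \<partial>M) = (\<integral>\<^sup>+\<omega>. 0 \<partial>M)"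
      by (intro nn_integral_cong_AE) (auto elim!: eventually_mono)
    thus False using v by simp
  qed
  then obtain s where s: "s > 0" "distributed M lborel X (\<lambda>x. ennreal (normal_density 0 s x))"
    using X by (auto simp: centered_gaussian_rv_def)
  have "s\<^sup>2 = v" using normal_second_moment[OF s(2,1)] v by simp
  hence "sqrt v = s" using s(1) by auto
  thus ?thesis using s(2) by simp
qed

lemma (in prob_space) centered_gaussian_tail:
  assumes X: "centered_gaussian_rv M X"
    and v: "(\<integral>\<^sup>+\<omega>. ennreal ((X \<omega>)\<^sup>2) \<partial>M) \<le> ennreal v" "0 < v" and x: "0 \<le> x"
  shows "prob {\<omega>\<in>space M. x < \<bar>X \<omega>\<bar>} \<le> 2 * exp (- x\<^sup>2 / (2 * v))"
proof -
  have [measurable]: "X \<in> borel_measurable M"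
    using X by (simp add: centered_gaussian_rv_def)
  consider "AE \<omega> in M. X \<omega> = 0"
    | s where "s > 0" "distributed M lborel X (\<lambda>x. ennreal (normal_density 0 s x))"
    using X by (auto simp: centered_gaussian_rv_def)
  thus ?thesis
  proof cases
    case 1
    have "prob {\<omega>\<in>space M. x < \<bar>X \<omega>\<bar>} = prob {}"
      using 1 x by (intro measure_eq_AE) (auto elim!: eventually_mono)
    thus ?thesis by simp
  next
    case 2
    have std: "distributed M lborel (\<lambda>\<omega>. X \<omega> / s) std_normal_density"
      using 2 normal_standard_normal_convert[of s X 0] by simp
    have std': "distributed M lborel (\<lambda>\<omega>. - X \<omega> / s) std_normal_density"
      using normal_density_affine[OF std, of "-1" 0] by simp
    have s: "s\<^sup>2 \<le> v"
      using normal_second_moment[OF 2(2,1)] v by simp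
    have "prob {\<omega>\<in>space M. x < \<bar>X \<omega>\<bar>}
        \<le> prob ({\<omega>\<in>space M. x / s < X \<omega> / s} \<union> {\<omega>\<in>space M. x / s < - X \<omega> / s})"
      using 2(1) by (intro finite_measure_mono) (auto simp: field_simps abs_if split: if_splits)
    also have "\<dots> \<le> prob {\<omega>\<in>space M. x / s < X \<omega> / s} + prob {\<omega>\<in>space M. x / s < - X \<omega> / s}"
      by (intro measure_Un_le) auto
    also have "\<dots> \<le> exp (- (x / s)\<^sup>2 / 2) + exp (- (x / s)\<^sup>2 / 2)"
      using x 2(1) by (intro add_mono standard_normal_tail_upper std std') auto
    also have "\<dots> \<le> 2 * exp (- x\<^sup>2 / (2 * v))"
      using s 2(1) v(2) by (auto simp: power_divide intro!: divide_left_mono)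
    finally show ?thesis .
  qed
qed

section \<open>Borel--Cantelli for Gaussian sequences\<close>

lemma (in prob_space) borel_cantelli_prob:
  assumes A: "\<And>n. {\<omega>\<in>space M. P n \<omega>} \<in> events"
    and le: "\<forall>\<^sub>F n in sequentially. prob {\<omega>\<in>space M. P n \<omega>} \<le> a n" and a: "summable a"
  shows "AE \<omega> in M. \<forall>\<^sub>F n in sequentially. \<not> P n \<omega>"
proof -
  have "summable (\<lambda>n. prob {\<omega>\<in>space M. P n \<omega>})"
    by (rule summable_comparison_test_ev[OF _ a]) (use le in simp)
  hence "AE \<omega> in M. \<forall>\<^sub>F n in sequentially. \<omega> \<in> space M - {\<omega>\<in>space M. P n \<omega>}"
    by (intro borel_cantelli_AE1 A) (auto simp: emeasure_eq_measure suminf_ennreal_eq)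
  thus ?thesis by eventually_elim (auto elim!: eventually_mono)
qed

text \<open>
  The probability that none of the events \<open>N, \<dots>, N + k - 1\<close> happens is
  \<open>\<Prod>(1 - p n) \<le> exp (- \<Sum>p n)\<close>, which tends to 0.
\<close>

lemma (in prob_space) borel_cantelli_indep_vars:
  fixes Y :: "nat \<Rightarrow> 'a \<Rightarrow> real"
  assumes ind: "\<And>m. indep_vars (\<lambda>_. borel) Y {..m}" and A[measurable]: "\<And>n. A n \<in> sets borel"
    and div: "\<not> summable (\<lambda>n. prob {\<omega>\<in>space M. Y n \<omega> \<in> A n})"
  shows "AE \<omega> in M. \<exists>\<^sub>F n in sequentially. Y n \<omega> \<in> A n"
proof -
  have Y[measurable]: "Y n \<in> borel_measurable M" for n
    using ind[of n] by (auto simp: indep_vars_def)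
  define p where "p n = prob {\<omega>\<in>space M. Y n \<omega> \<in> A n}" for n
  have null: "AE \<omega> in M. \<not> (\<forall>n\<ge>N. Y n \<omega> \<notin> A n)" for N
  proof -
    have meas: "{\<omega>\<in>space M. Y n \<omega> \<in> A n} \<in> events" for n
      using A by measurable
    have bound: "prob {\<omega>\<in>space M. \<forall>n\<ge>N. Y n \<omega> \<notin> A n} \<le> exp (- (\<Sum>n=N..<N+k. p n))" if "0 < k" for k
    proof -
      have "prob {\<omega>\<in>space M. \<forall>n\<ge>N. Y n \<omega> \<notin> A n} \<le> prob (\<Inter>n\<in>{N..<N+k}. Y n -` (- A n) \<inter> space M)"
        using A that by (intro finite_measure_mono) (auto intro!: sets.finite_INT measurable_sets[OF Y] borel_comp)
      also have "\<dots> = (\<Prod>n=N..<N+k. prob (Y n -` (- A n) \<inter> space M))"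
        using A that by (intro indep_varsD_finite[OF indep_vars_subset[OF ind[of "N+k"]]]) auto
      also have "\<dots> \<le> (\<Prod>n=N..<N+k. exp (- p n))"
      proof (intro prod_mono conjI)
        fix n
        have "Y n -` (- A n) \<inter> space M = space M - {\<omega>\<in>space M. Y n \<omega> \<in> A n}" by auto
        hence "prob (Y n -` (- A n) \<inter> space M) = 1 - p n"
          using prob_compl[OF meas[of n]] by (simp add: p_def)
        thus "prob (Y n -` (- A n) \<inter> space M) \<le> exp (- p n)"
          using exp_ge_add_one_self[of "- p n"] by simp
      qed simp
      finally show ?thesis by (simp add: exp_sum sum_negf[symmetric])
    qed
    have "prob {\<omega>\<in>space M. \<forall>n\<ge>N. Y n \<omega> \<notin> A n} < e" if "e > 0" for e
    proof -
      have "\<not> summable (\<lambda>n. p (n + N))"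
        using div unfolding p_def[symmetric] by (simp add: summable_iff_shift)
      hence "\<exists>k. - ln e < (\<Sum>n<k. p (n + N))"
        using bounded_imp_summable[of "\<lambda>n. p (n + N)" "- ln e"] 
        by (metis le_cases lessThan_Suc_atMost measure_nonneg not_le p_def)
      then obtain k where k: "- ln e < (\<Sum>n<k. p (n + N))" by auto
      also have "\<dots> \<le> (\<Sum>n<Suc k. p (n + N))" by (simp add: p_def)
      also have "\<dots> = (\<Sum>n=N..<N+Suc k. p n)"
        by (rule sum.reindex_bij_witness[of _ "\<lambda>n. n - N" "\<lambda>n. n + N"]) auto
      finally have "- (\<Sum>n=N..<N+Suc k. p n) < ln e" by linarith
      hence less: "exp (- (\<Sum>n=N..<N+Suc k. p n)) < exp (ln e)" by (rule exp_less_mono)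
      have "prob {\<omega>\<in>space M. \<forall>n\<ge>N. Y n \<omega> \<notin> A n} \<le> exp (- (\<Sum>n=N..<N+Suc k. p n))"
        by (rule bound) simp
      also note less
      also have "exp (ln e) = e" using that by simp
      finally show ?thesis .
    qed
    from this[of "prob {\<omega>\<in>space M. \<forall>n\<ge>N. Y n \<omega> \<notin> A n}"]
    have "prob {\<omega>\<in>space M. \<forall>n\<ge>N. Y n \<omega> \<notin> A n} = 0"
      using zero_less_measure_iff by blast
    moreover have "{\<omega>\<in>space M. \<forall>n\<ge>N. Y n \<omega> \<notin> A n} \<in> events" by measurable
    ultimately show ?thesis
      by (subst AE_iff_measurable[OF _ refl]) (auto simp: emeasure_eq_measure)
  qed
  have "AE \<omega> in M. \<forall>N. \<not> (\<forall>n\<ge>N. Y n \<omega> \<notin> A n)" using null by (simp add: AE_all_countable)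
  thus ?thesis by eventually_elim (auto simp: frequently_def eventually_sequentially)
qed

text \<open>
  At the threshold \<open>\<eta> \<surd>(2 v ln n)\<close> the tail is at most \<open>2 n powr (- \<eta>\<^sup>2)\<close>.
\<close>

lemma (in prob_space) gaussian_sequence_eventually_le:
  assumes X: "\<And>n. centered_gaussian_rv M (X n)"
    and v: "\<And>n. (\<integral>\<^sup>+\<omega>. ennreal ((X n \<omega>)\<^sup>2) \<partial>M) \<le> ennreal (v n)" "\<And>n. 0 < v n" and \<eta>: "1 < \<eta>"
  shows "AE \<omega> in M. \<forall>\<^sub>F n in sequentially. \<bar>X n \<omega>\<bar> \<le> \<eta> * sqrt (2 * v n * ln n)"
proof -
  have [measurable]: "X n \<in> borel_measurable M" for n
    using X by (simp add: centered_gaussian_rv_def)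
  have "AE \<omega> in M. \<forall>\<^sub>F n in sequentially. \<not> (\<eta> * sqrt (2 * v n * ln n) < \<bar>X n \<omega>\<bar>)"
  proof (rule borel_cantelli_prob)
    show "\<forall>\<^sub>F n in sequentially. prob {\<omega>\<in>space M. \<eta> * sqrt (2 * v n * ln n) < \<bar>X n \<omega>\<bar>}
      \<le> 2 * real n powr (- \<eta>\<^sup>2)"
      using eventually_gt_at_top[of 1]
    proof eventually_elim
      case (elim n)
      have "prob {\<omega>\<in>space M. \<eta> * sqrt (2 * v n * ln n) < \<bar>X n \<omega>\<bar>}
          \<le> 2 * exp (- (\<eta> * sqrt (2 * v n * ln n))\<^sup>2 / (2 * v n))"
        using \<eta> v(2)[of n] elim by (intro centered_gaussian_tail X v) auto
      also have "(\<eta> * sqrt (2 * v n * ln n))\<^sup>2 / (2 * v n) = \<eta>\<^sup>2 * ln n"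
        using v(2)[of n] elim by (simp add: power_mult_distrib)
      hence "2 * exp (- (\<eta> * sqrt (2 * v n * ln n))\<^sup>2 / (2 * v n)) = 2 * real n powr (- \<eta>\<^sup>2)"
        using elim by (simp add: powr_def)
      finally show ?case .
    qed
    have "1 < \<eta>\<^sup>2" using \<eta> by (simp add: one_less_power)
    thus "summable (\<lambda>n. 2 * real n powr (- \<eta>\<^sup>2))"
      by (intro summable_mult) (simp add: summable_real_powr_iff)
  qed measurable
  thus ?thesis by (simp add: not_less)
qed

text \<open>
  For \<open>\<theta> < 1\<close> the lower tail bound at \<open>\<theta> \<surd>(2 ln n)\<close> still dominates a multiple of the harmonic series.
\<close>

lemma (in prob_space) gaussian_sequence_frequently_gt:
  fixes Y :: "nat \<Rightarrow> 'a \<Rightarrow> real"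
  assumes ind: "\<And>m. indep_vars (\<lambda>_. borel) Y {..m}"
    and Y: "\<And>n. distributed M lborel (Y n) (\<lambda>x. ennreal (normal_density 0 (s n) x))"
    and s: "\<And>n. 0 < s n" and \<theta>: "0 < \<theta>" "\<theta> < 1"
  shows "AE \<omega> in M. \<exists>\<^sub>F n in sequentially. \<theta> * s n * sqrt (2 * ln n) < Y n \<omega>"
proof -
  define x where "x n = \<theta> * sqrt (2 * ln (real n))" for n
  have [measurable]: "Y n \<in> borel_measurable M" for n
    using ind[of n] by (auto simp: indep_vars_def)
  have std: "distributed M lborel (\<lambda>\<omega>. Y n \<omega> / s n) std_normal_density" for n
    using Y[of n] s[of n] normal_standard_normal_convert[of "s n" "Y n" 0] by simp
  have low: "std_normal_density (x n + 1) \<le> prob {\<omega>\<in>space M. Y n \<omega> \<in> {\<theta> * s n * sqrt (2 * ln n)<..}}"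
    if "n \<ge> 1" for n
  proof -
    have "std_normal_density (x n + 1) \<le> prob {\<omega>\<in>space M. x n < Y n \<omega> / s n}"
      using that \<theta> by (intro standard_normal_tail_lower std) (auto simp: x_def)
    also have "{\<omega>\<in>space M. x n < Y n \<omega> / s n} = {\<omega>\<in>space M. Y n \<omega> \<in> {\<theta> * s n * sqrt (2 * ln n)<..}}"
      using s[of n] by (auto simp: x_def field_simps)
    finally show ?thesis .
  qed
  have "\<forall>\<^sub>F n in sequentially. x n + 1 \<le> sqrt (2 * ln (real n))"
    unfolding x_def using \<theta> by real_asymp
  hence ev: "\<forall>\<^sub>F n in sequentially. norm (1 / sqrt (2 * pi) * (1 / real n))
    \<le> prob {\<omega>\<in>space M. Y n \<omega> \<in> {\<theta> * s n * sqrt (2 * ln n)<..}}"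
    using eventually_ge_at_top[of 1]
  proof eventually_elim
    case (elim n)
    have "(x n + 1)\<^sup>2 \<le> (sqrt (2 * ln (real n)))\<^sup>2"
      using elim \<theta> by (intro power_mono) (auto simp: x_def)
    also have "\<dots> = 2 * ln n" using elim by simp
    finally have "exp (- ln n) \<le> exp (- (x n + 1)\<^sup>2 / 2)" by simp
    hence "1 / real n \<le> exp (- (x n + 1)\<^sup>2 / 2)" using elim by (simp add: exp_minus field_simps)
    hence "1 / sqrt (2 * pi) * (1 / real n) \<le> std_normal_density (x n + 1)"
      unfolding std_normal_density_def by (intro mult_left_mono) auto
    hence "norm (1 / sqrt (2 * pi) * (1 / real n)) \<le> std_normal_density (x n + 1)"
      by simp
    thus ?case using low[of n] elim by simp
  qed
  have "AE \<omega> in M. \<exists>\<^sub>F n in sequentially. Y n \<omega> \<in> {\<theta> * s n * sqrt (2 * ln n)<..}"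
  proof (rule borel_cantelli_indep_vars[OF ind])
    have "\<not> summable (\<lambda>n. 1 / sqrt (2 * pi) * (1 / real n))"
    proof
      assume "summable (\<lambda>n. 1 / sqrt (2 * pi) * (1 / real n))"
      from summable_mult[OF this, of "sqrt (2 * pi)"] have "summable (\<lambda>n. inverse (real n))"
        by (simp add: field_simps)
      thus False using not_summable_harmonic[where 'a=real] by simp
    qed
    thus "\<not> summable (\<lambda>n. prob {\<omega>\<in>space M. Y n \<omega> \<in> {\<theta> * s n * sqrt (2 * ln n)<..}})"
      using summable_comparison_test_ev[OF ev] by blast
  qed simp
  thus ?thesis by simp
qed

section \<open>Chaining and the upper bound for Gaussian processes\<close>

text \<open>
  A dyadic point of level \<open>j\<close> is a dyadic point of level \<open>j - 1\<close> or the right neighbour of one, so it is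
  reached from 0 with one increment of each level.  Continuity gives the other points.
\<close>

lemma dyadic_chaining:
  fixes g :: "real \<Rightarrow> real"
  assumes cont: "continuous_on {0..1} g"
    and inc: "\<And>j i. i < 2 ^ j \<Longrightarrow> \<bar>g (real (Suc i) / 2 ^ j) - g (real i / 2 ^ j)\<bar> \<le> r * (3/4) ^ j"
    and x: "x \<in> {0..1}"
  shows "\<bar>g x - g 0\<bar> \<le> 4 * r"
proof -
  have r: "0 \<le> r" using inc[of 0 0] by simp
  have "\<bar>g (real i / 2 ^ j) - g 0\<bar> \<le> r * (\<Sum>l\<le>j. (3/4) ^ l)" if "i \<le> 2 ^ j" for i j
    using that
  proof (induction j arbitrary: i)
    case 0
    hence "i = 0 \<or> i = 1" by auto
    thus ?case using inc[of 0 0] r by auto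
  next
    case (Suc j)
    define k where "k = i div 2"
    have k: "\<bar>g (real k / 2 ^ j) - g 0\<bar> \<le> r * (\<Sum>l\<le>j. (3/4) ^ l)"
      using Suc.prems by (intro Suc.IH) (auto simp: k_def)
    have half: "real k / 2 ^ j = real (2 * k) / 2 ^ Suc j" by simp
    consider "i = 2 * k" | "i = Suc (2 * k)" unfolding k_def by linarith
    thus ?case
    proof cases
      case 1
      have "0 \<le> r * (3/4) ^ Suc j" using r by simp
      with k show ?thesis unfolding half 1 by (simp add: distrib_left)
    next
      case 2
      have "\<bar>g (real (Suc (2 * k)) / 2 ^ Suc j) - g (real (2 * k) / 2 ^ Suc j)\<bar> \<le> r * (3/4) ^ Suc j"
        using Suc.prems 2 by (intro inc) auto
      with k show ?thesis unfolding half 2 by (simp only: sum.atMost_Suc distrib_left)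
    qed
  qed
  moreover have "(\<Sum>l\<le>j. (3/4::real) ^ l) \<le> 4" for j
    by (simp add: lessThan_Suc_atMost[symmetric] sum_gp_strict del: sum.lessThan_Suc)
  ultimately have dyadic: "\<bar>g (real i / 2 ^ j) - g 0\<bar> \<le> 4 * r" if "i \<le> 2 ^ j" for i j
    using that r mult_left_mono[of "\<Sum>l\<le>j. (3/4::real) ^ l" 4 r] by (smt (verit, best) mult.commute)
  define y where "y j = real (nat \<lfloor>x * 2 ^ j\<rfloor>) / 2 ^ j" for j :: nat
  have le: "nat \<lfloor>x * 2 ^ j\<rfloor> \<le> 2 ^ j" for j
  proof -
    have "x * 2 ^ j \<le> 2 ^ j" using x by simp
    hence "\<lfloor>x * 2 ^ j\<rfloor> \<le> 2 ^ j" by (metis floor_mono floor_numeral_power)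
    thus ?thesis by (simp add: nat_le_iff)
  qed
  have y: "x - (1/2) ^ j \<le> y j" "y j \<le> x" for j
  proof -
    have "real (nat \<lfloor>x * 2 ^ j\<rfloor>) = of_int \<lfloor>x * 2 ^ j\<rfloor>" using x by simp
    moreover have "of_int \<lfloor>x * 2 ^ j\<rfloor> \<le> x * 2 ^ j" "x * 2 ^ j < of_int \<lfloor>x * 2 ^ j\<rfloor> + 1" by linarith+
    moreover have "x - (1/2) ^ j = (x * 2 ^ j - 1) / 2 ^ j" by (simp add: field_simps power_one_over)
    ultimately show "x - (1/2) ^ j \<le> y j" "y j \<le> x"
      by (auto simp: y_def pos_divide_le_eq intro!: divide_right_mono)
  qed
  have "y \<longlonglongrightarrow> x"
  proof (rule tendsto_sandwich[OF _ _ _ tendsto_const])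
    show "(\<lambda>j. x - (1/2) ^ j) \<longlonglongrightarrow> x"
      using tendsto_diff[OF tendsto_const LIMSEQ_power_zero[of "1/2::real"], of x] by simp
  qed (use y in auto)
  moreover have "y j \<in> {0..1}" for j
  proof -
    have "0 \<le> y j" by (simp add: y_def)
    thus ?thesis using y(2)[of j] x by simp
  qed
  ultimately have "(\<lambda>j. g (y j)) \<longlonglongrightarrow> g x"
    using x by (intro continuous_on_tendsto_compose[OF cont]) auto
  hence "(\<lambda>j. \<bar>g (y j) - g 0\<bar>) \<longlonglongrightarrow> \<bar>g x - g 0\<bar>"
    by (intro tendsto_intros)
  thus ?thesis
    by (rule tendsto_upperbound) (use dyadic le in \<open>auto simp: y_def\<close>)
qed

text \<open>
  An increment of level \<open>j\<close> in the block has variance at most \<open>K (q - 1) q\<^sup>n / 2\<^sup>j\<close>, and is allowed the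
  size \<open>\<eta> (3/4)\<^sup>j \<surd>(q\<^sup>n ln n)\<close>.  The ratio of allowed square to variance grows like \<open>(9/8)\<^sup>j\<close>, which makes the
  exceptional probabilities summable over all levels, all \<open>2\<^sup>j\<close> positions and all \<open>n\<close>, as soon
  as \<open>q - 1\<close> is small compared with \<open>\<eta>\<^sup>2\<close>.
\<close>

lemma (in prob_space) gaussian_block_oscillation:
  assumes gauss: "\<And>s t. 0 < s \<Longrightarrow> s \<le> t \<Longrightarrow> centered_gaussian_rv M (\<lambda>\<omega>. V t \<omega> - V s \<omega>)"
    and var: "\<And>s t. 0 < s \<Longrightarrow> s \<le> t \<Longrightarrow> t \<le> 2 * s \<Longrightarrow>
      (\<integral>\<^sup>+\<omega>. ennreal ((V t \<omega> - V s \<omega>)\<^sup>2) \<partial>M) \<le> ennreal (K * (t - s))"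
    and cont: "AE \<omega> in M. continuous_on {0..} (\<lambda>t. V t \<omega>)"
    and q: "1 < q" "q \<le> 2" and K: "0 < K" and \<eta>: "0 < \<eta>" "16 * K * (q - 1) \<le> \<eta>\<^sup>2"
  shows "AE \<omega> in M. \<forall>\<^sub>F n in sequentially. \<forall>t\<in>{q ^ n..q ^ Suc n}.
    \<bar>V t \<omega> - V (q ^ n) \<omega>\<bar> \<le> 4 * (\<eta> * sqrt (q ^ n * ln (real n)))"
proof -
  define p where "p n j i = q ^ n + (q - 1) * q ^ n * (real i / 2 ^ j)" for n j i :: nat
  have p_pos: "0 < p n j i" for n j i using q by (auto simp: p_def intro!: add_pos_nonneg)
  have p_mono: "p n j i \<le> p n j (Suc i)" for n j i
    using q by (auto simp: p_def divide_simps)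
  have p_diff: "p n j (Suc i) - p n j i = (q - 1) * q ^ n / 2 ^ j" for n j i
    by (simp add: p_def field_simps)
  define bad where "bad n j i \<omega> \<longleftrightarrow>
    \<eta> * (3/4) ^ j * sqrt (q ^ n * ln (real n)) < \<bar>V (p n j (Suc i)) \<omega> - V (p n j i) \<omega>\<bar>" for n j i :: nat and \<omega>
  have [measurable]: "(\<lambda>\<omega>. V (p n j (Suc i)) \<omega> - V (p n j i) \<omega>) \<in> borel_measurable M" for n j i
    using gauss[OF p_pos[of n j i] p_mono[of n j i]] by (simp add: centered_gaussian_rv_def)
  have [measurable]: "{\<omega>\<in>space M. bad n j i \<omega>} \<in> events" for n j i
    unfolding bad_def by measurable
  have single: "prob {\<omega>\<in>space M. bad n j i \<omega>} \<le> 2 / real n ^ (8 + j)" if n: "1 \<le> n" and i: "i < 2 ^ j" for n j i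
  proof -
    define v where "v = K * ((q - 1) * q ^ n / 2 ^ j)"
    have v: "0 < v" using K q by (simp add: v_def)
    have dbl: "p n j (Suc i) \<le> 2 * p n j i"
    proof -
      have "(q - 1) * q ^ n / 2 ^ j \<le> 1 * q ^ n / 1"
        using q by (intro frac_le mult_right_mono) auto
      also have "\<dots> \<le> p n j i" using q by (simp add: p_def)
      finally show ?thesis using p_diff[of n j i] by simp
    qed
    have "prob {\<omega>\<in>space M. bad n j i \<omega>} \<le> 2 * exp (- (\<eta> * (3/4) ^ j * sqrt (q ^ n * ln (real n)))\<^sup>2 / (2 * v))"
      unfolding bad_def
    proof (rule centered_gaussian_tail[OF gauss[OF p_pos p_mono]])
      show "(\<integral>\<^sup>+\<omega>. ennreal ((V (p n j (Suc i)) \<omega> - V (p n j i) \<omega>)\<^sup>2) \<partial>M) \<le> ennreal v"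
        using var[OF p_pos p_mono dbl] unfolding p_diff v_def by simp
    qed (use v \<eta> q n in auto)
    also have "\<dots> \<le> 2 * exp (- ((8 + real j) * ln n))"
    proof -
      \<comment> \<open>Bernoulli's inequality yields the exponent \<open>8 + j\<close>: the factor \<open>n ^ j\<close> absorbs the \<open>2\<^sup>j\<close> positions of
        level \<open>j\<close> for \<open>n \<ge> 4\<close>, and a power of \<open>n\<close> is left for the sum over \<open>n\<close>.\<close>
      have "(8 + real j) \<le> 8 * (9/8) ^ j"
        using Bernoulli_inequality[of "1/8::real" j] by simp
      also have "\<dots> \<le> (\<eta>\<^sup>2 / (2 * (K * (q - 1)))) * (9/8) ^ j"
        using \<eta> K q by (intro mult_right_mono) (auto simp: field_simps)
      finally have "(8 + real j) * ln n \<le> (\<eta>\<^sup>2 / (2 * (K * (q - 1)))) * (9/8) ^ j * ln n"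
        using n by (intro mult_right_mono) auto
      also have "\<dots> = (\<eta> * (3/4) ^ j * sqrt (q ^ n * ln (real n)))\<^sup>2 / (2 * v)"
      proof -
        have "(9/8::real) ^ j = ((3/4) ^ j)\<^sup>2 * 2 ^ j"
          by (simp add: power2_eq_square power_mult_distrib[symmetric])
        thus ?thesis using n q K by (simp add: v_def power_mult_distrib) 
      qed
      finally show ?thesis by simp
    qed
    also have "exp (- ((8 + real j) * ln n)) = 1 / real n ^ (8 + j)"
    proof -
      have "exp ((8 + real j) * ln n) = real n ^ (8 + j)"
        using n exp_of_nat_mult[of "8 + j" "ln (real n)"] by simp
      thus ?thesis by (simp only: exp_minus inverse_eq_divide)
    qed
    finally show ?thesis by simp
  qed
  have level: "prob (\<Union>i<2 ^ j. {\<omega>\<in>space M. bad n j i \<omega>}) \<le> 2 / real n ^ 2 * (1/2) ^ j" if n: "4 \<le> n" for n j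
  proof -
    have "prob (\<Union>i<2 ^ j. {\<omega>\<in>space M. bad n j i \<omega>}) \<le> (\<Sum>i<2 ^ j. prob {\<omega>\<in>space M. bad n j i \<omega>})"
      by (intro measure_UNION_le) auto
    also have "\<dots> \<le> (\<Sum>i<(2::nat) ^ j. 2 / real n ^ (8 + j))"
      using n by (intro sum_mono single) auto
    also have "\<dots> = 2 / real n ^ 8 * (2 / real n) ^ j"
      by (simp add: power_add power_divide)
    also have "\<dots> \<le> 2 / real n ^ 2 * (1/2) ^ j"
      using n by (intro mult_mono divide_left_mono power_mono power_increasing) (auto simp: field_simps)
    finally show ?thesis .
  qed
  have "AE \<omega> in M. \<forall>\<^sub>F n in sequentially. \<not> (\<exists>j. \<exists>i<2 ^ j. bad n j i \<omega>)"
  proof (rule borel_cantelli_prob)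
    show "\<forall>\<^sub>F n in sequentially. prob {\<omega>\<in>space M. \<exists>j. \<exists>i<2 ^ j. bad n j i \<omega>} \<le> 4 * inverse (real n ^ 2)"
      using eventually_ge_at_top[of 4]
    proof eventually_elim
      case (elim n)
      have summ: "summable (\<lambda>j. 2 / real n ^ 2 * (1/2) ^ j)" by (intro summable_mult summable_geometric) simp
      have summ': "summable (\<lambda>j. prob (\<Union>i<2 ^ j. {\<omega>\<in>space M. bad n j i \<omega>}))"
        by (rule summable_comparison_test'[OF summ]) (use level elim in auto)
      have rng: "range (\<lambda>j. \<Union>i<2 ^ j. {\<omega>\<in>space M. bad n j i \<omega>}) \<subseteq> events"
        by (intro image_subsetI sets.finite_UN) auto
      have "{\<omega>\<in>space M. \<exists>j. \<exists>i<2 ^ j. bad n j i \<omega>} = (\<Union>j. \<Union>i<2 ^ j. {\<omega>\<in>space M. bad n j i \<omega>})"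
        by auto
      hence "prob {\<omega>\<in>space M. \<exists>j. \<exists>i<2 ^ j. bad n j i \<omega>} \<le> (\<Sum>j. prob (\<Union>i<2 ^ j. {\<omega>\<in>space M. bad n j i \<omega>}))"
        using finite_measure_subadditive_countably[OF _ summ'] rng by simp
      also have "\<dots> \<le> (\<Sum>j. 2 / real n ^ 2 * (1/2) ^ j)"
        by (intro suminf_le level elim summ summ')
      also have "\<dots> = 2 / real n ^ 2 * (1 / (1 - 1/2))"
        by (subst suminf_mult) (auto intro: summable_geometric simp: suminf_geometric)
      finally show ?case by (simp add: field_simps)
    qed
    show "summable (\<lambda>n. 4 * inverse (real n ^ 2))"
      by (intro summable_mult inverse_power_summable) simp
  qed measurable
  with cont show ?thesis
  proof eventually_elim
    case (elim \<omega>)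
    from elim(2) show ?case
    proof eventually_elim
      case (elim n)
      show ?case
      proof
        fix t assume t: "t \<in> {q ^ n..q ^ Suc n}"
        define g where "g x = V (q ^ n + (q - 1) * q ^ n * x) \<omega>" for x
        define x where "x = (t - q ^ n) / ((q - 1) * q ^ n)"
        have x: "x \<in> {0..1}" using t q by (auto simp: x_def divide_le_eq_1 field_simps)
        have tx: "q ^ n + (q - 1) * q ^ n * x = t" using q by (simp add: x_def)
        have "\<bar>g x - g 0\<bar> \<le> 4 * (\<eta> * sqrt (q ^ n * ln (real n)))"
        proof (rule dyadic_chaining[OF _ _ x])
          show "continuous_on {0..1} g" unfolding g_def
            using q by (intro continuous_on_compose2[OF \<open>continuous_on {0..} (\<lambda>t. V t \<omega>)\<close>] continuous_intros) auto
          show "\<bar>g (real (Suc i) / 2 ^ j) - g (real i / 2 ^ j)\<bar> \<le> \<eta> * sqrt (q ^ n * ln (real n)) * (3/4) ^ j"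
            if "i < 2 ^ j" for i j
          proof -
            have "\<not> bad n j i \<omega>" using elim that by blast
            thus ?thesis unfolding bad_def p_def g_def not_less by (simp only: mult_ac)
          qed
        qed
        thus "\<bar>V t \<omega> - V (q ^ n) \<omega>\<bar> \<le> 4 * (\<eta> * sqrt (q ^ n * ln (real n)))"
          by (simp add: g_def tx)
      qed
    qed
  qed
qed

lemma eventually_at_top_geometric_blocks:
  fixes q :: real
  assumes q: "1 < q" and P: "\<forall>\<^sub>F n in sequentially. \<forall>t\<in>{q ^ n..q ^ Suc n}. P t"
  shows "\<forall>\<^sub>F t in at_top. P t"
proof -
  obtain N where N: "\<And>n t. N \<le> n \<Longrightarrow> t \<in> {q ^ n..q ^ Suc n} \<Longrightarrow> P t"
    using P unfolding eventually_sequentially by blast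
  have "P t" if t: "q ^ N \<le> t" for t
  proof -
    obtain m where "t < q ^ m" using real_arch_pow[OF q] by blast
    define l where "l = (LEAST m. t < q ^ m)"
    have l: "t < q ^ l" unfolding l_def by (rule LeastI[of _ m]) fact
    have "N < l" using l t q by (meson le_less_trans power_less_imp_less_exp)
    then obtain n where n: "l = Suc n" "N \<le> n" by (cases l) auto
    have "\<not> t < q ^ n" using not_less_Least[of n "\<lambda>m. t < q ^ m"] n l_def by auto
    thus ?thesis using N[of n t] n l by auto
  qed
  thus ?thesis unfolding eventually_at_top_linorder by blast
qed

lemma (in prob_space) gaussian_lil_upper:
  assumes gauss: "\<And>t. 0 < t \<Longrightarrow> centered_gaussian_rv M (V t)"
    and gauss_inc: "\<And>s t. 0 < s \<Longrightarrow> s \<le> t \<Longrightarrow> centered_gaussian_rv M (\<lambda>\<omega>. V t \<omega> - V s \<omega>)"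
    and var: "\<And>t. 0 < t \<Longrightarrow> (\<integral>\<^sup>+\<omega>. ennreal ((V t \<omega>)\<^sup>2) \<partial>M) \<le> ennreal (c * t)"
    and var_inc: "\<And>s t. 0 < s \<Longrightarrow> s \<le> t \<Longrightarrow> t \<le> 2 * s \<Longrightarrow>
      (\<integral>\<^sup>+\<omega>. ennreal ((V t \<omega> - V s \<omega>)\<^sup>2) \<partial>M) \<le> ennreal (K * (t - s))"
    and cont: "AE \<omega> in M. continuous_on {0..} (\<lambda>t. V t \<omega>)"
    and c: "0 < c" and K: "0 < K" and \<epsilon>: "0 < \<epsilon>"
  shows "AE \<omega> in M. \<forall>\<^sub>F t in at_top. \<bar>V t \<omega>\<bar> \<le> (sqrt c + \<epsilon>) * sqrt (2 * t * ln (ln t))"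
proof -
  \<comment> \<open>The final constant is \<open>(\<surd>c (1 + \<eta>) + 4 \<eta>) (1 + \<eta>)\<close>; for \<open>\<eta> \<le> 1\<close> it exceeds \<open>\<surd>c\<close> by at most \<open>\<eta> (3 \<surd>c + 8)\<close>.\<close>
  define \<eta> where "\<eta> = min 1 (\<epsilon> / (3 * sqrt c + 8))"
  have \<eta>: "0 < \<eta>" "\<eta> \<le> 1" "\<eta> * (3 * sqrt c + 8) \<le> \<epsilon>"
  proof -
    have "0 < 3 * sqrt c + 8" using c by (simp add: add_pos_pos)
    thus "0 < \<eta>" "\<eta> \<le> 1" "\<eta> * (3 * sqrt c + 8) \<le> \<epsilon>"
      using \<epsilon> by (auto simp: \<eta>_def pos_le_divide_eq[symmetric])
  qed
  have const: "(sqrt c * (1 + \<eta>) + 4 * \<eta>) * (1 + \<eta>) \<le> sqrt c + \<epsilon>"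
  proof -
    have "\<eta> * \<eta> \<le> \<eta>" using \<eta> by (simp add: mult_left_le)
    hence "sqrt c * (\<eta> * \<eta>) + 4 * (\<eta> * \<eta>) \<le> sqrt c * \<eta> + 4 * \<eta>"
      using c by (intro add_mono mult_left_mono) auto
    with \<eta>(3) show ?thesis by (simp add: algebra_simps)
  qed
  define q where "q = 1 + min 1 (\<eta>\<^sup>2 / (16 * K))"
  have q: "1 < q" "q \<le> 2" "16 * K * (q - 1) \<le> \<eta>\<^sup>2"
  proof -
    have "q - 1 \<le> \<eta>\<^sup>2 / (16 * K)" by (simp add: q_def)
    thus "16 * K * (q - 1) \<le> \<eta>\<^sup>2" using K by (simp add: field_simps)
  qed (use \<eta> K in \<open>auto simp: q_def\<close>)
  have grid: "AE \<omega> in M. \<forall>\<^sub>F n in sequentially. \<bar>V (q ^ n) \<omega>\<bar> \<le> (1 + \<eta>) * sqrt (2 * (c * q ^ n) * ln (real n))"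
    using q c \<eta> by (intro gaussian_sequence_eventually_le gauss var) auto
  have osc: "AE \<omega> in M. \<forall>\<^sub>F n in sequentially. \<forall>t\<in>{q ^ n..q ^ Suc n}.
      \<bar>V t \<omega> - V (q ^ n) \<omega>\<bar> \<le> 4 * (\<eta> * sqrt (q ^ n * ln (real n)))"
    by (rule gaussian_block_oscillation[OF gauss_inc var_inc cont q(1,2) K \<eta>(1) q(3)])
  have ln_n: "\<forall>\<^sub>F n in sequentially. ln (real n) \<le> (1 + \<eta>)\<^sup>2 * (ln (real n) + ln (ln q))"
  proof -
    have "filterlim (\<lambda>n. ln (real n)) at_top sequentially" by real_asymp
    hence "\<forall>\<^sub>F n in sequentially. - ((1 + \<eta>)\<^sup>2 * ln (ln q)) / ((1 + \<eta>)\<^sup>2 - 1) \<le> ln (real n)"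
      by (simp add: filterlim_at_top)
    thus ?thesis
    proof eventually_elim
      case (elim n)
      have "0 < (1 + \<eta>)\<^sup>2 - 1" using \<eta> by (simp add: one_less_power)
      from elim[unfolded pos_divide_le_eq[OF this]] show ?case by (simp add: algebra_simps)
    qed
  qed
  from grid osc show ?thesis
  proof eventually_elim
    case (elim \<omega>)
    from elim(1) elim(2) ln_n eventually_ge_at_top[of 1]
    have "\<forall>\<^sub>F n in sequentially. \<forall>t\<in>{q ^ n..q ^ Suc n}. \<bar>V t \<omega>\<bar> \<le> (sqrt c + \<epsilon>) * sqrt (2 * t * ln (ln t))"
    proof eventually_elim
      case (elim n)
      define R where "R = sqrt (2 * q ^ n * ln (real n))"
      have R: "0 \<le> R" using elim(4) q by (simp add: R_def)
      show ?case
      proof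
        fix t assume t: "t \<in> {q ^ n..q ^ Suc n}"
        have t0: "0 < t" using t q by (auto intro: less_le_trans[of 0 "q ^ n"])
        have "ln (q ^ n) \<le> ln t" using t q t0 by (subst ln_le_cancel_iff) auto
        hence "real n * ln q \<le> ln t" using q by (simp add: ln_realpow)
        moreover have "0 < real n * ln q" using elim(4) q by simp
        ultimately have "ln (real n * ln q) \<le> ln (ln t)" by simp
        hence "ln (real n) + ln (ln q) \<le> ln (ln t)" using elim(4) q by (simp add: ln_mult)
        hence lnn: "ln (real n) \<le> (1 + \<eta>)\<^sup>2 * ln (ln t)"
          using elim(3) \<eta> by (smt (verit, ccfv_SIG) mult_left_mono zero_le_power2)
        have "2 * q ^ n * ln (real n) \<le> 2 * t * ((1 + \<eta>)\<^sup>2 * ln (ln t))"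
          using t t0 lnn elim(4) q by (intro mult_mono) auto
        hence "R \<le> sqrt (2 * t * ((1 + \<eta>)\<^sup>2 * ln (ln t)))" by (simp add: R_def)
        also have "\<dots> = sqrt ((1 + \<eta>)\<^sup>2 * (2 * t * ln (ln t)))" by (simp add: mult_ac)
        also have "\<dots> = (1 + \<eta>) * sqrt (2 * t * ln (ln t))" using \<eta> by (simp add: real_sqrt_mult)
        finally have R_le: "R \<le> (1 + \<eta>) * sqrt (2 * t * ln (ln t))" .
        have nonneg: "0 \<le> sqrt (2 * t * ln (ln t))" using R R_le \<eta> by (smt (verit) zero_le_mult_iff)
        have "\<bar>V t \<omega>\<bar> \<le> \<bar>V (q ^ n) \<omega>\<bar> + \<bar>V t \<omega> - V (q ^ n) \<omega>\<bar>" by linarith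
        also have "\<dots> \<le> (1 + \<eta>) * sqrt (2 * (c * q ^ n) * ln (real n)) + 4 * (\<eta> * sqrt (q ^ n * ln (real n)))"
          using elim(1) elim(2) t by (intro add_mono) auto
        also have "\<dots> \<le> (1 + \<eta>) * (sqrt c * R) + 4 * (\<eta> * R)"
        proof (intro add_mono mult_left_mono)
          show "sqrt (2 * (c * q ^ n) * ln (real n)) \<le> sqrt c * R"
            by (simp add: R_def real_sqrt_mult mult_ac)
          show "sqrt (q ^ n * ln (real n)) \<le> R"
            using elim(4) q by (auto simp: R_def)
        qed (use \<eta> in auto)
        also have "\<dots> = (sqrt c * (1 + \<eta>) + 4 * \<eta>) * R" by (simp add: algebra_simps)
        also have "\<dots> \<le> (sqrt c * (1 + \<eta>) + 4 * \<eta>) * ((1 + \<eta>) * sqrt (2 * t * ln (ln t)))"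
          using c \<eta> by (intro mult_left_mono R_le) auto
        also have "\<dots> = ((sqrt c * (1 + \<eta>) + 4 * \<eta>) * (1 + \<eta>)) * sqrt (2 * t * ln (ln t))"
          by (simp only: mult.assoc)
        also have "\<dots> \<le> (sqrt c + \<epsilon>) * sqrt (2 * t * ln (ln t))"
          by (intro mult_right_mono const nonneg)
        finally show "\<bar>V t \<omega>\<bar> \<le> (sqrt c + \<epsilon>) * sqrt (2 * t * ln (ln t))" .
      qed
    qed
    thus ?case by (rule eventually_at_top_geometric_blocks[OF q(1)])
  qed
qed

section \<open>Increments of Brownian motion\<close>

text \<open>
  Brownian motion in several dimensions has coordinates with independent increments, and the coordinates
  are independent as paths.  This lemma turns the two facts into independence of the whole array
  of increments of the coordinates: independence of the rows and independence within each row.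
\<close>

lemma (in prob_space) indep_vars_Times:
  assumes fin: "finite I" "finite J"
    and outer: "indep_vars (\<lambda>i. PiM J N) (\<lambda>i \<omega>. \<lambda>j\<in>J. X i j \<omega>) I"
    and inner: "\<And>i. i \<in> I \<Longrightarrow> indep_vars N (X i) J"
  shows "indep_vars (\<lambda>(i, j). N j) (\<lambda>(i, j). X i j) (I \<times> J)"
proof (cases "I = {} \<or> J = {}")
  case False
  have rv: "X i j \<in> measurable M (N j)" if "i \<in> I" "j \<in> J" for i j
    using inner[OF that(1)] that(2) unfolding indep_vars_def by blast
  define G where "G = (\<lambda>x. {(case x of (i, j) \<Rightarrow> X i j) -` A \<inter> space M |A. A \<in> sets (case x of (i, j) \<Rightarrow> N j)})"
  have "indep_sets G (I \<times> J)"
  proof (subst indep_sets_finite)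
    show "\<forall>A\<in>Pi (I \<times> J) G. prob (\<Inter>x\<in>I \<times> J. A x) = (\<Prod>x\<in>I \<times> J. prob (A x))"
    proof
      fix A assume "A \<in> Pi (I \<times> J) G"
      have "\<forall>x\<in>I \<times> J. \<exists>E. E \<in> sets (N (snd x)) \<and> A x = X (fst x) (snd x) -` E \<inter> space M"
      proof (intro ballI)
        fix x assume x: "x \<in> I \<times> J"
        have "A x \<in> G x" using \<open>A \<in> Pi (I \<times> J) G\<close> x by (rule Pi_mem)
        thus "\<exists>E. E \<in> sets (N (snd x)) \<and> A x = X (fst x) (snd x) -` E \<inter> space M"
          by (cases x) (auto simp: G_def)
      qed
      from bchoice[OF this] obtain E where
        E0: "\<forall>x\<in>I \<times> J. E x \<in> sets (N (snd x)) \<and> A x = X (fst x) (snd x) -` E x \<inter> space M" ..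
      have E: "E (i, j) \<in> sets (N j)" "A (i, j) = X i j -` E (i, j) \<inter> space M" if "i \<in> I" "j \<in> J" for i j
        using bspec[OF E0, of "(i, j)"] that by simp_all
      have row: "(\<Inter>j\<in>J. A (i, j)) = (\<lambda>\<omega>. \<lambda>j\<in>J. X i j \<omega>) -` (PiE J (\<lambda>j. E (i, j))) \<inter> space M" if "i \<in> I" for i
        using False E(2)[OF that] by (auto simp: PiE_iff)
      have "(\<Inter>x\<in>I \<times> J. A x) = (\<Inter>i\<in>I. \<Inter>j\<in>J. A (i, j))" by auto
      also have "\<dots> = (\<Inter>i\<in>I. (\<lambda>\<omega>. \<lambda>j\<in>J. X i j \<omega>) -` (PiE J (\<lambda>j. E (i, j))) \<inter> space M)"
        by (simp only: row cong: INF_cong)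
      also have "prob \<dots> = (\<Prod>i\<in>I. prob ((\<lambda>\<omega>. \<lambda>j\<in>J. X i j \<omega>) -` (PiE J (\<lambda>j. E (i, j))) \<inter> space M))"
        using False fin E(1) by (intro indep_varsD_finite[OF outer] sets_PiM_I_finite) auto
      also have "\<dots> = (\<Prod>i\<in>I. prob (\<Inter>j\<in>J. X i j -` E (i, j) \<inter> space M))"
        by (intro prod.cong refl arg_cong[where f=prob], subst row[symmetric]) (auto simp: E(2))
      also have "\<dots> = (\<Prod>i\<in>I. \<Prod>j\<in>J. prob (A (i, j)))"
        using False fin E by (intro prod.cong refl, subst indep_varsD_finite[OF inner]) auto
      finally show "prob (\<Inter>x\<in>I \<times> J. A x) = (\<Prod>x\<in>I \<times> J. prob (A x))"
        by (simp add: prod.cartesian_product)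
    qed
    show "G x \<subseteq> events" if "x \<in> I \<times> J" for x
      using that rv by (auto simp: G_def intro!: measurable_sets)
    show "space M \<in> G x" if x: "x \<in> I \<times> J" for x
    proof -
      obtain i j where ij: "x = (i, j)" "i \<in> I" "j \<in> J" using x by auto
      have "space M = X i j -` space (N j) \<inter> space M"
        using measurable_space[OF rv[OF ij(2,3)]] by auto
      thus ?thesis unfolding G_def ij by auto
    qed
  qed (use False fin in auto)
  moreover have "(case x of (i, j) \<Rightarrow> X i j) \<in> measurable M (case x of (i, j) \<Rightarrow> N j)" if "x \<in> I \<times> J" for x
    using that rv by auto
  ultimately show ?thesis unfolding indep_vars_def2 G_def by blast
qed (auto simp: indep_vars_def2 indep_sets_def)

text \<open>
  The intervals \<open>(a i, b i]\<close> may overlap, unlike those of a partition.  Hence the difference of two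
  step integrals with different partitions is again of this form.
\<close>

definition increment_sum ::
    "(real \<Rightarrow> 'a \<Rightarrow> 'b) \<Rightarrow> 'i set \<Rightarrow> ('i \<Rightarrow> real) \<Rightarrow> ('i \<Rightarrow> real) \<Rightarrow> ('i \<Rightarrow> 'b::euclidean_space) \<Rightarrow> 'a \<Rightarrow> real" where
  "increment_sum B I a b c \<omega> = (\<Sum>i\<in>I. c i \<bullet> (B (b i) \<omega> - B (a i) \<omega>))"

definition interval_sum ::
    "'i set \<Rightarrow> ('i \<Rightarrow> real) \<Rightarrow> ('i \<Rightarrow> real) \<Rightarrow> ('i \<Rightarrow> 'b) \<Rightarrow> real \<Rightarrow> 'b::euclidean_space" where
  "interval_sum I a b c s = (\<Sum>i\<in>I. indicator {a i<..b i} s *\<^sub>R c i)"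

context prob_space
begin

lemma brownian_coordinate_increment:
  assumes B: "standard_brownian_motion M B" and u: "u \<in> Basis" and st: "0 \<le> s" "0 \<le> t"
  shows "(\<lambda>\<omega>. (B t \<omega> - B s \<omega>) \<bullet> u) \<in> borel_measurable M"
    and "integrable M (\<lambda>\<omega>. ((B t \<omega> - B s \<omega>) \<bullet> u)\<^sup>2)"
    and "expectation (\<lambda>\<omega>. ((B t \<omega> - B s \<omega>) \<bullet> u)\<^sup>2) = \<bar>t - s\<bar>"
    and "expectation (\<lambda>\<omega>. (B t \<omega> - B s \<omega>) \<bullet> u) = 0"
proof -
  have W: "standard_brownian_motion_real M (\<lambda>t \<omega>. B t \<omega> \<bullet> u)"
    using B u by (simp add: standard_brownian_motion_def)
  have rv: "(\<lambda>\<omega>. B r \<omega> \<bullet> u) \<in> borel_measurable M" if "0 \<le> r" for r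
    using W that by (auto simp: standard_brownian_motion_real_def)
  show meas: "(\<lambda>\<omega>. (B t \<omega> - B s \<omega>) \<bullet> u) \<in> borel_measurable M"
    using rv[OF st(1)] rv[OF st(2)] by (simp add: inner_diff_left)
  have norm: "distributed M lborel (\<lambda>\<omega>. (B r \<omega> - B l \<omega>) \<bullet> u) (\<lambda>x. ennreal (normal_density 0 (sqrt (r - l)) x))"
    if "0 \<le> l" "l < r" for l r
    using W that by (auto simp: standard_brownian_motion_real_def inner_diff_left)
  have sq: "(\<integral>\<^sup>+\<omega>. ennreal (((B r \<omega> - B l \<omega>) \<bullet> u)\<^sup>2) \<partial>M) = ennreal \<bar>r - l\<bar>" if "0 \<le> l" "l < r" for l r
    using that by (subst normal_second_moment[OF norm]) auto
  have "(B s \<omega> - B t \<omega>) \<bullet> u = - ((B t \<omega> - B s \<omega>) \<bullet> u)" for \<omega> by (simp add: inner_diff_left)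
  hence nn: "(\<integral>\<^sup>+\<omega>. ennreal (((B t \<omega> - B s \<omega>) \<bullet> u)\<^sup>2) \<partial>M) = ennreal \<bar>t - s\<bar>"
    using sq[of s t] sq[of t s] st by (cases s t rule: linorder_cases) (auto simp: abs_minus_commute)
  show int: "integrable M (\<lambda>\<omega>. ((B t \<omega> - B s \<omega>) \<bullet> u)\<^sup>2)"
    using meas nn by (intro integrableI_nonneg) auto
  show "expectation (\<lambda>\<omega>. ((B t \<omega> - B s \<omega>) \<bullet> u)\<^sup>2) = \<bar>t - s\<bar>"
    using meas nn by (subst integral_eq_nn_integral) auto
  have zero: "expectation (\<lambda>\<omega>. (B r \<omega> - B l \<omega>) \<bullet> u) = 0" if "0 \<le> l" "l < r" for l r
    using that by (intro normal_distributed_expectation[OF _ norm]) auto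
  have "expectation (\<lambda>\<omega>. (B t \<omega> - B s \<omega>) \<bullet> u) = - expectation (\<lambda>\<omega>. (B s \<omega> - B t \<omega>) \<bullet> u)"
    by (subst Bochner_Integration.integral_minus[symmetric]) (simp add: inner_diff_left)
  thus "expectation (\<lambda>\<omega>. (B t \<omega> - B s \<omega>) \<bullet> u) = 0"
    using zero[of s t] zero[of t s] st by (cases s t rule: linorder_cases) auto
qed

lemma integrable_mult_square:
  fixes X Y :: "'a \<Rightarrow> real"
  assumes [measurable]: "X \<in> borel_measurable M" "Y \<in> borel_measurable M"
    and int: "integrable M (\<lambda>\<omega>. (X \<omega>)\<^sup>2)" "integrable M (\<lambda>\<omega>. (Y \<omega>)\<^sup>2)"
  shows "integrable M (\<lambda>\<omega>. X \<omega> * Y \<omega>)"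
proof (rule Bochner_Integration.integrable_bound)
  show "integrable M (\<lambda>\<omega>. (X \<omega>)\<^sup>2 + (Y \<omega>)\<^sup>2)" using int by simp
  show "AE \<omega> in M. norm (X \<omega> * Y \<omega>) \<le> norm ((X \<omega>)\<^sup>2 + (Y \<omega>)\<^sup>2)"
  proof (rule AE_I2)
    fix \<omega>
    have "2 * (\<bar>X \<omega>\<bar> * \<bar>Y \<omega>\<bar>) \<le> (X \<omega>)\<^sup>2 + (Y \<omega>)\<^sup>2"
      using sum_squares_bound[of "\<bar>X \<omega>\<bar>" "\<bar>Y \<omega>\<bar>"] by simp
    moreover have "0 \<le> \<bar>X \<omega>\<bar> * \<bar>Y \<omega>\<bar>" by simp
    ultimately have "\<bar>X \<omega>\<bar> * \<bar>Y \<omega>\<bar> \<le> (X \<omega>)\<^sup>2 + (Y \<omega>)\<^sup>2" by linarith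
    thus "norm (X \<omega> * Y \<omega>) \<le> norm ((X \<omega>)\<^sup>2 + (Y \<omega>)\<^sup>2)"
      by (simp add: abs_mult)
  qed
qed measurable

text \<open>
  In one coordinate the covariance follows by polarization from
  \<open>E (W t - W s)\<^sup>2 = \<bar>t - s\<bar>\<close>, since
  \<open>2 (W b - W a) (W d - W c)
    = (W b - W c)\<^sup>2 + (W d - W a)\<^sup>2 - (W b - W d)\<^sup>2 - (W c - W a)\<^sup>2\<close>.
\<close>

lemma brownian_increment_covariance:
  fixes B :: "real \<Rightarrow> 'a \<Rightarrow> 'b::euclidean_space"
  assumes B: "standard_brownian_motion M B" and uv: "u \<in> Basis" "v \<in> Basis"
    and ab: "0 \<le> a" "a \<le> b" and cd: "0 \<le> c" "c \<le> d"
  shows "integrable M (\<lambda>\<omega>. ((B b \<omega> - B a \<omega>) \<bullet> u) * ((B d \<omega> - B c \<omega>) \<bullet> v))"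
    and "expectation (\<lambda>\<omega>. ((B b \<omega> - B a \<omega>) \<bullet> u) * ((B d \<omega> - B c \<omega>) \<bullet> v))
      = (if u = v then measure lborel ({a<..b} \<inter> {c<..d}) else 0)"
proof -
  note inc = brownian_coordinate_increment[OF B]
  have pos: "0 \<le> b" "0 \<le> d" using ab cd by auto
  show "integrable M (\<lambda>\<omega>. ((B b \<omega> - B a \<omega>) \<bullet> u) * ((B d \<omega> - B c \<omega>) \<bullet> v))"
    using ab cd pos uv by (intro integrable_mult_square inc) auto
  show "expectation (\<lambda>\<omega>. ((B b \<omega> - B a \<omega>) \<bullet> u) * ((B d \<omega> - B c \<omega>) \<bullet> v))
      = (if u = v then measure lborel ({a<..b} \<inter> {c<..d}) else 0)"
  proof (cases "u = v")
    case True
    define Q where "Q s t \<omega> = ((B t \<omega> - B s \<omega>) \<bullet> u)\<^sup>2" for s t \<omega>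
    have "((B b \<omega> - B a \<omega>) \<bullet> u) * ((B d \<omega> - B c \<omega>) \<bullet> u) = (Q c b \<omega> + Q a d \<omega> - Q d b \<omega> - Q a c \<omega>) / 2" for \<omega>
      by (simp add: Q_def inner_diff_left power2_eq_square algebra_simps)
    hence "expectation (\<lambda>\<omega>. ((B b \<omega> - B a \<omega>) \<bullet> u) * ((B d \<omega> - B c \<omega>) \<bullet> u))
        = expectation (\<lambda>\<omega>. (Q c b \<omega> + Q a d \<omega> - Q d b \<omega> - Q a c \<omega>) / 2)" by (simp only:)
    also have "\<dots> = (\<bar>b - c\<bar> + \<bar>d - a\<bar> - \<bar>b - d\<bar> - \<bar>c - a\<bar>) / 2"
      using inc(2,3)[OF uv(1)] ab cd pos unfolding Q_def by simp
    also have "\<dots> = max 0 (min b d - max a c)" using ab cd by (auto simp: max_def min_def)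
    also have "\<dots> = measure lborel ({a<..b} \<inter> {c<..d})"
    proof -
      have "{a<..b} \<inter> {c<..d} = {max a c<..min b d}" by auto
      thus ?thesis by (cases "max a c \<le> min b d") auto
    qed
    finally show ?thesis using True by simp
  next
    case False
    define p r where "p w = (if w = u then a else c)" and "r w = (if w = u then b else d)" for w
    have pr: "0 \<le> p w" "0 \<le> r w" for w using ab cd pos by (auto simp: p_def r_def)
    have paths: "indep_vars (\<lambda>_. PiM {0..} (\<lambda>_. borel)) (\<lambda>w \<omega>. \<lambda>t\<in>{0..}. B t \<omega> \<bullet> w) {u, v}"
      by (rule indep_vars_subset[of _ _ Basis]) (use B uv in \<open>unfold standard_brownian_motion_def, blast+\<close>)
    have proj: "(\<lambda>f. f (r w) - f (p w) :: real) \<in> borel_measurable (PiM {0..} (\<lambda>_. borel))" for w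
      using pr by (intro borel_measurable_diff measurable_component_singleton) auto
    have ind: "indep_vars (\<lambda>_. borel) (\<lambda>w \<omega>. (B (r w) \<omega> - B (p w) \<omega>) \<bullet> w) {u, v}"
      using indep_vars_compose2[OF paths, where N="\<lambda>_. borel" and Y="\<lambda>w f. f (r w) - f (p w)", OF proj] pr
      by (simp add: inner_diff_left)
    have integ: "integrable M (\<lambda>\<omega>. (B (r w) \<omega> - B (p w) \<omega>) \<bullet> w)" if "w \<in> {u, v}" for w
    proof -
      have w: "w \<in> Basis" using that uv by auto
      show ?thesis by (rule square_integrable_imp_integrable[OF inc(1)[OF w pr] inc(2)[OF w pr]])
    qed
    have "expectation (\<lambda>\<omega>. \<Prod>w\<in>{u, v}. (B (r w) \<omega> - B (p w) \<omega>) \<bullet> w)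
        = (\<Prod>w\<in>{u, v}. expectation (\<lambda>\<omega>. (B (r w) \<omega> - B (p w) \<omega>) \<bullet> w))"
      by (rule indep_vars_lebesgue_integral[OF _ ind integ]) auto
    also have "\<dots> = 0" using uv pr inc(4) by simp
    finally show ?thesis using False by (simp add: p_def r_def)
  qed
qed

text \<open>
  Both sides expand into double sums over the intervals.  The covariance of two increments is the
  length of the overlap of their intervals, which is also the integral of the product of the indicators.
\<close>

lemma increment_sum_isometry:
  fixes B :: "real \<Rightarrow> 'a \<Rightarrow> 'b::euclidean_space"
  assumes B: "standard_brownian_motion M B" and I: "finite I"
    and ab: "\<And>i. i \<in> I \<Longrightarrow> 0 \<le> a i" "\<And>i. i \<in> I \<Longrightarrow> a i \<le> b i"
  shows "increment_sum B I a b c \<in> borel_measurable M"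
    and "(\<integral>\<^sup>+\<omega>. ennreal ((increment_sum B I a b c \<omega>)\<^sup>2) \<partial>M)
      = (\<integral>\<^sup>+s. ennreal ((norm (interval_sum I a b c s))\<^sup>2) \<partial>lborel)"
proof -
  define X where "X i u \<omega> = (B (b i) \<omega> - B (a i) \<omega>) \<bullet> u" for i u \<omega>
  have b0: "0 \<le> b i" if "i \<in> I" for i using ab[OF that] by linarith
  have S: "increment_sum B I a b c = (\<lambda>\<omega>. \<Sum>i\<in>I. \<Sum>u\<in>Basis. (c i \<bullet> u) * X i u \<omega>)"
    unfolding increment_sum_def X_def by (intro ext sum.cong refl) (rule euclidean_inner)
  have X[measurable]: "X i u \<in> borel_measurable M" if "i \<in> I" "u \<in> Basis" for i u
    unfolding X_def using that ab b0 by (intro brownian_coordinate_increment(1)[OF B]) auto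
  show meas: "increment_sum B I a b c \<in> borel_measurable M"
    unfolding S by (intro borel_measurable_sum borel_measurable_times borel_measurable_const X)
  have S2: "(increment_sum B I a b c \<omega>)\<^sup>2
      = (\<Sum>i\<in>I. \<Sum>j\<in>I. \<Sum>u\<in>Basis. \<Sum>v\<in>Basis. (c i \<bullet> u) * (c j \<bullet> v) * (X i u \<omega> * X j v \<omega>))" for \<omega>
    unfolding S by (simp add: power2_eq_square sum_product mult_ac)
  have XX: "has_bochner_integral M (\<lambda>\<omega>. X i u \<omega> * X j v \<omega>)
      (if u = v then measure lborel ({a i<..b i} \<inter> {a j<..b j}) else 0)"
    if "i \<in> I" "j \<in> I" "u \<in> Basis" "v \<in> Basis" for i j u v
    unfolding X_def has_bochner_integral_iff
    using ab(1)[OF that(1)] ab(2)[OF that(1)] ab(1)[OF that(2)] ab(2)[OF that(2)]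
    by (intro conjI; rule brownian_increment_covariance[OF B that(3,4)])
  have S2_int: "has_bochner_integral M (\<lambda>\<omega>. (increment_sum B I a b c \<omega>)\<^sup>2)
      (\<Sum>i\<in>I. \<Sum>j\<in>I. \<Sum>u\<in>Basis. \<Sum>v\<in>Basis. (c i \<bullet> u) * (c j \<bullet> v) *
          (if u = v then measure lborel ({a i<..b i} \<inter> {a j<..b j}) else 0))"
    unfolding S2 by (intro has_bochner_integral_sum has_bochner_integral_mult_right XX)
  have int: "integrable M (\<lambda>\<omega>. (increment_sum B I a b c \<omega>)\<^sup>2)"
    using S2_int by (rule integrable.intros)
  have "expectation (\<lambda>\<omega>. (increment_sum B I a b c \<omega>)\<^sup>2)
      = (\<Sum>i\<in>I. \<Sum>j\<in>I. \<Sum>u\<in>Basis. \<Sum>v\<in>Basis. (c i \<bullet> u) * (c j \<bullet> v) *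
          (if u = v then measure lborel ({a i<..b i} \<inter> {a j<..b j}) else 0))"
    using S2_int by (rule has_bochner_integral_integral_eq)
  also have "\<dots> = (\<Sum>i\<in>I. \<Sum>j\<in>I. (c i \<bullet> c j) * measure lborel ({a i<..b i} \<inter> {a j<..b j}))"
  proof (intro sum.cong refl)
    fix i j
    show "(\<Sum>u\<in>Basis. \<Sum>v\<in>Basis. (c i \<bullet> u) * (c j \<bullet> v) *
        (if u = v then measure lborel ({a i<..b i} \<inter> {a j<..b j}) else 0))
        = (c i \<bullet> c j) * measure lborel ({a i<..b i} \<inter> {a j<..b j})"
      by (subst euclidean_inner[of "c i" "c j"]) (simp add: sum_distrib_right if_distrib cong: if_cong)
  qed
  finally have E: "expectation (\<lambda>\<omega>. (increment_sum B I a b c \<omega>)\<^sup>2)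
      = (\<Sum>i\<in>I. \<Sum>j\<in>I. (c i \<bullet> c j) * measure lborel ({a i<..b i} \<inter> {a j<..b j}))" .
  have N2: "(norm (interval_sum I a b c s))\<^sup>2
      = (\<Sum>i\<in>I. \<Sum>j\<in>I. (c i \<bullet> c j) * indicator ({a i<..b i} \<inter> {a j<..b j}) s)" for s
    unfolding power2_norm_eq_inner interval_sum_def inner_sum_left
    by (intro sum.cong refl, subst inner_sum_right, intro sum.cong refl) (auto simp: indicator_def)
  have fin: "emeasure lborel ({a i<..b i} \<inter> {a j<..b j}) < \<infinity>" for i j
  proof -
    have "emeasure lborel ({a i<..b i} \<inter> {a j<..b j}) \<le> emeasure lborel {a i..b i}"
      by (intro emeasure_mono) auto
    also have "\<dots> < \<infinity>" by (cases "a i \<le> b i") auto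
    finally show ?thesis .
  qed
  have "has_bochner_integral lborel (\<lambda>s. indicator ({a i<..b i} \<inter> {a j<..b j}) s :: real)
      (measure lborel ({a i<..b i} \<inter> {a j<..b j}))" for i j
    by (rule has_bochner_integral_real_indicator) (use fin in auto)
  hence N2_int: "has_bochner_integral lborel (\<lambda>s. (norm (interval_sum I a b c s))\<^sup>2)
      (\<Sum>i\<in>I. \<Sum>j\<in>I. (c i \<bullet> c j) * measure lborel ({a i<..b i} \<inter> {a j<..b j}))"
    unfolding N2 by (intro has_bochner_integral_sum has_bochner_integral_mult_right)
  have int': "integrable lborel (\<lambda>s. (norm (interval_sum I a b c s))\<^sup>2)"
    using N2_int by (rule integrable.intros)
  have "(\<integral>s. (norm (interval_sum I a b c s))\<^sup>2 \<partial>lborel)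
      = (\<Sum>i\<in>I. \<Sum>j\<in>I. (c i \<bullet> c j) * measure lborel ({a i<..b i} \<inter> {a j<..b j}))"
    using N2_int by (rule has_bochner_integral_integral_eq)
  with E have "expectation (\<lambda>\<omega>. (increment_sum B I a b c \<omega>)\<^sup>2)
    = (\<integral>s. (norm (interval_sum I a b c s))\<^sup>2 \<partial>lborel)"
    by simp
  thus "(\<integral>\<^sup>+\<omega>. ennreal ((increment_sum B I a b c \<omega>)\<^sup>2) \<partial>M)
      = (\<integral>\<^sup>+s. ennreal ((norm (interval_sum I a b c s))\<^sup>2) \<partial>lborel)"
    by (simp add: nn_integral_eq_integral[OF int] nn_integral_eq_integral[OF int'])
qed

end

section \<open>Gaussianity and independence of sums of increments\<close>

lemma finite_set_enumeration:
  fixes F :: "real set"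
  assumes "finite F" "F \<noteq> {}"
  obtains p :: "nat \<Rightarrow> real" and m where "strict_mono_on {..m} p" "F = p ` {..m}"
proof
  define xs where "xs = sorted_list_of_set F"
  have len: "length xs = Suc (card F - 1)" using assms by (simp add: xs_def card_gt_0_iff)
  show "strict_mono_on {..card F - 1} ((!) xs)"
    using sorted_wrt_nth_less[of "(<)" xs] len by (intro strict_mono_onI) (simp add: xs_def)
  have "F = set xs" using assms by (simp add: xs_def)
  also have "\<dots> = (!) xs ` {..<Suc (card F - 1)}" by (simp only: nth_image len set_conv_nth) auto
  finally show "F = (!) xs ` {..card F - 1}" by (simp add: lessThan_Suc_atMost)
qed

lemma telescoping_refinement:
  fixes p :: "nat \<Rightarrow> real" and g :: "real \<Rightarrow> 'b::ab_group_add"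
  assumes p: "\<And>i j. i < j \<Longrightarrow> j \<le> m \<Longrightarrow> p i < p j"
    and ab: "a \<in> p ` {..m}" "b \<in> p ` {..m}" "a \<le> b"
  shows "g b - g a = (\<Sum>k | k < m \<and> a \<le> p k \<and> p k < b. g (p (Suc k)) - g (p k))"
proof -
  obtain i j where ij: "a = p i" "b = p j" "i \<le> m" "j \<le> m" using ab by auto
  have less: "p k < p l \<longleftrightarrow> k < l" if "k \<le> m" "l \<le> m" for k l
    using p[of k l] p[of l k] that by (cases k l rule: linorder_cases) auto
  have "i \<le> j" using less[of j i] ij ab by auto
  have "{k. k < m \<and> a \<le> p k \<and> p k < b} = {i..<j}"
    using ij less by (auto simp: not_less[symmetric])
  thus ?thesis using sum_Suc_diff'[OF \<open>i \<le> j\<close>, of "\<lambda>k. g (p k)"] ij by simp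
qed

text \<open>
  The coefficient of the increment over \<open>(p k, p (k + 1)]\<close> in direction \<open>u\<close>, after all
  intervals have been cut at the points \<open>p\<close>.
\<close>

definition refined_coeff ::
    "'i set \<Rightarrow> ('i \<Rightarrow> real) \<Rightarrow> ('i \<Rightarrow> real) \<Rightarrow> ('i \<Rightarrow> 'b) \<Rightarrow> (nat \<Rightarrow> real) \<Rightarrow> 'b::euclidean_space \<times> nat \<Rightarrow> real" where
  "refined_coeff I a b c p = (\<lambda>(u, k). \<Sum>i\<in>I. if a i \<le> p k \<and> p k < b i then c i \<bullet> u else 0)"

context prob_space
begin

lemma brownian_increments_indep:
  fixes B :: "real \<Rightarrow> 'a \<Rightarrow> 'b::euclidean_space"
  assumes B: "standard_brownian_motion M B" and p: "0 \<le> p 0" "\<And>k. k < m \<Longrightarrow> p k < p (Suc k)"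
  shows "indep_vars (\<lambda>_. borel) (\<lambda>(u, k) \<omega>. (B (p (Suc k)) \<omega> - B (p k) \<omega>) \<bullet> u) (Basis \<times> {..<m})"
proof -
  have p0: "0 \<le> p k" if "k \<le> m" for k
    using that
  proof (induction k)
    case (Suc k)
    thus ?case using p(2)[of k] by simp
  qed (use p in simp)
  have paths: "indep_vars (\<lambda>_. PiM {0..} (\<lambda>_. borel)) (\<lambda>u \<omega>. \<lambda>t\<in>{0..}. B t \<omega> \<bullet> u) Basis"
    using B unfolding standard_brownian_motion_def by blast
  have proj: "(\<lambda>f. \<lambda>k\<in>{..<m}. f (p (Suc k)) - f (p k) :: real)
      \<in> measurable (PiM {0..} (\<lambda>_. borel)) (PiM {..<m} (\<lambda>_. borel))"
    using p0 by (intro measurable_restrict borel_measurable_diff measurable_component_singleton) auto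
  have outer: "indep_vars (\<lambda>_. PiM {..<m} (\<lambda>_. borel)) (\<lambda>u \<omega>. \<lambda>k\<in>{..<m}. (B (p (Suc k)) \<omega> - B (p k) \<omega>) \<bullet> u) Basis"
  proof -
    have eq: "(\<lambda>k\<in>{..<m}. (\<lambda>t\<in>{0..}. B t \<omega> \<bullet> u) (p (Suc k)) - (\<lambda>t\<in>{0..}. B t \<omega> \<bullet> u) (p k))
        = (\<lambda>k\<in>{..<m}. (B (p (Suc k)) \<omega> - B (p k) \<omega>) \<bullet> u)" for u \<omega>
      using p0 by (auto simp: inner_diff_left fun_eq_iff)
    show ?thesis
      using indep_vars_compose2[OF paths, where N="\<lambda>_. PiM {..<m} (\<lambda>_. borel)"
          and Y="\<lambda>u f. \<lambda>k\<in>{..<m}. f (p (Suc k)) - f (p k)", OF proj]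
      unfolding eq .
  qed
  have inner: "indep_vars (\<lambda>_. borel) (\<lambda>k \<omega>. (B (p (Suc k)) \<omega> - B (p k) \<omega>) \<bullet> u) {..<m}" if "u \<in> Basis" for u
  proof -
    have "standard_brownian_motion_real M (\<lambda>t \<omega>. B t \<omega> \<bullet> u)"
      using B that unfolding standard_brownian_motion_def by blast
    hence "indep_vars (\<lambda>_. borel) (\<lambda>k \<omega>. B (p (Suc k)) \<omega> \<bullet> u - B (p k) \<omega> \<bullet> u) {..<m}"
      using p unfolding standard_brownian_motion_real_def by blast
    thus ?thesis by (simp only: inner_diff_left)
  qed
  show ?thesis
    using indep_vars_Times[where X="\<lambda>u k \<omega>. (B (p (Suc k)) \<omega> - B (p k) \<omega>) \<bullet> u" and N="\<lambda>_. borel",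
        OF finite_Basis finite_lessThan outer inner]
    by (simp add: case_prod_unfold)
qed

lemma increment_sum_refine:
  fixes B :: "real \<Rightarrow> 'a \<Rightarrow> 'b::euclidean_space"
  assumes p: "\<And>i j. i < j \<Longrightarrow> j \<le> m \<Longrightarrow> p i < p j"
    and ab: "\<And>i. i \<in> I \<Longrightarrow> a i \<in> p ` {..m}" "\<And>i. i \<in> I \<Longrightarrow> b i \<in> p ` {..m}" "\<And>i. i \<in> I \<Longrightarrow> a i \<le> b i"
  shows "increment_sum B I a b c \<omega>
    = (\<Sum>(u, k)\<in>Basis \<times> {..<m}. refined_coeff I a b c p (u, k) * ((B (p (Suc k)) \<omega> - B (p k) \<omega>) \<bullet> u))"
proof -
  define D where "D k = B (p (Suc k)) \<omega> - B (p k) \<omega>" for k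
  have inner: "c i \<bullet> (B (b i) \<omega> - B (a i) \<omega>)
      = (\<Sum>u\<in>Basis. \<Sum>k<m. (if a i \<le> p k \<and> p k < b i then c i \<bullet> u else 0) * (D k \<bullet> u))" if i: "i \<in> I" for i
  proof -
    have "B (b i) \<omega> - B (a i) \<omega> = (\<Sum>k | k < m \<and> a i \<le> p k \<and> p k < b i. D k)"
      unfolding D_def by (rule telescoping_refinement[OF p ab(1)[OF i] ab(2)[OF i] ab(3)[OF i], of "\<lambda>t. B t \<omega>"])
    also have "\<dots> = (\<Sum>k<m. if a i \<le> p k \<and> p k < b i then D k else 0)"
      by (subst sum.inter_filter[symmetric]) auto
    finally have "c i \<bullet> (B (b i) \<omega> - B (a i) \<omega>) = (\<Sum>k<m. if a i \<le> p k \<and> p k < b i then c i \<bullet> D k else 0)"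
      by (simp add: inner_sum_right if_distrib[of "\<lambda>x. _ \<bullet> x"] cong: if_cong)
    also have "\<dots> = (\<Sum>k<m. \<Sum>u\<in>Basis. (if a i \<le> p k \<and> p k < b i then c i \<bullet> u else 0) * (D k \<bullet> u))"
    proof (intro sum.cong refl)
      fix k
      show "(if a i \<le> p k \<and> p k < b i then c i \<bullet> D k else 0)
          = (\<Sum>u\<in>Basis. (if a i \<le> p k \<and> p k < b i then c i \<bullet> u else 0) * (D k \<bullet> u))"
      proof (cases "a i \<le> p k \<and> p k < b i")
        case True
        thus ?thesis by (simp add: euclidean_inner[of "c i" "D k"])
      next
        case False
        show ?thesis by (simp only: if_not_P[OF False] mult_zero_left sum.neutral_const)
      qed
    qed
    also have "\<dots> = (\<Sum>u\<in>Basis. \<Sum>k<m. (if a i \<le> p k \<and> p k < b i then c i \<bullet> u else 0) * (D k \<bullet> u))"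
      by (rule sum.swap)
    finally show ?thesis .
  qed
  have "increment_sum B I a b c \<omega>
    = (\<Sum>i\<in>I. \<Sum>u\<in>Basis. \<Sum>k<m. (if a i \<le> p k \<and> p k < b i then c i \<bullet> u else 0) * (D k \<bullet> u))"
    unfolding increment_sum_def by (intro sum.cong refl inner)
  also have "\<dots> = (\<Sum>u\<in>Basis. \<Sum>k<m. \<Sum>i\<in>I. (if a i \<le> p k \<and> p k < b i then c i \<bullet> u else 0) * (D k \<bullet> u))"
    by (subst sum.swap, intro sum.cong refl, subst sum.swap, rule refl)
  also have "\<dots> = (\<Sum>u\<in>Basis. \<Sum>k<m. refined_coeff I a b c p (u, k) * (D k \<bullet> u))"
    by (simp add: refined_coeff_def sum_distrib_right)
  finally show ?thesis by (simp add: sum.cartesian_product D_def)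
qed

text \<open>
  Cutting at all end points turns the sum into a linear combination of the independent Gaussian increments of one
  partition.  The terms with coefficient 0 are dropped because
  \<open>normal_density 0 0\<close> is not a density.
\<close>

lemma increment_sum_gaussian:
  fixes B :: "real \<Rightarrow> 'a \<Rightarrow> 'b::euclidean_space"
  assumes B: "standard_brownian_motion M B" and I: "finite I"
    and ab: "\<And>i. i \<in> I \<Longrightarrow> 0 \<le> a i" "\<And>i. i \<in> I \<Longrightarrow> a i \<le> b i"
  shows "centered_gaussian_rv M (increment_sum B I a b c)"
proof -
  define F where "F = insert 0 (a ` I \<union> b ` I)"
  have finF: "finite F" "F \<noteq> {}" using I by (auto simp: F_def)
  obtain p :: "nat \<Rightarrow> real" and m :: nat where mono: "strict_mono_on {..m} p" and F: "F = p ` {..m}"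
    using finite_set_enumeration[OF finF] by blast
  have p: "p i < p j" if "i < j" "j \<le> m" for i j
    using strict_mono_onD[OF mono] that by simp
  have pF: "p k \<in> F" if "k \<le> m" for k using that F by auto
  have "0 \<le> x" if "x \<in> F" for x
    using that unfolding F_def by (auto intro: ab(1) order_trans[OF ab])
  hence p0: "0 \<le> p 0" using pF[of 0] by simp
  have pS: "p k < p (Suc k)" if "k < m" for k using p that by auto
  have pk: "0 \<le> p k" if "k \<le> m" for k using p0 p[of 0 k] that by (cases "k = 0") auto
  define D where "D = (\<lambda>(u, k) \<omega>. (B (p (Suc k)) \<omega> - B (p k) \<omega>) \<bullet> u)"
  define d where "d = refined_coeff I a b c p"
  have ind: "indep_vars (\<lambda>_. borel) D (Basis \<times> {..<m})"
    unfolding D_def by (rule brownian_increments_indep[OF B p0 pS])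
  have sum: "increment_sum B I a b c = (\<lambda>\<omega>. \<Sum>x\<in>Basis \<times> {..<m}. d x * D x \<omega>)"
  proof
    fix \<omega>
    have "a i \<in> p ` {..m}" "b i \<in> p ` {..m}" if "i \<in> I" for i
      using that F[symmetric] by (auto simp: F_def)
    thus "increment_sum B I a b c \<omega> = (\<Sum>x\<in>Basis \<times> {..<m}. d x * D x \<omega>)"
      unfolding d_def D_def by (subst increment_sum_refine[OF p _ _ ab(2)]) (auto simp: case_prod_unfold)
  qed
  define K where "K = {x \<in> Basis \<times> {..<m}. d x \<noteq> 0}"
  have finK: "finite K" by (auto simp: K_def)
  have sumK: "increment_sum B I a b c = (\<lambda>\<omega>. \<Sum>x\<in>K. d x * D x \<omega>)"
    unfolding sum K_def by (intro ext sum.mono_neutral_right) auto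
  show ?thesis
  proof (cases "K = {}")
    case True
    thus ?thesis by (simp add: centered_gaussian_rv_def sumK)
  next
    case False
    define s where "s x = \<bar>d x\<bar> * sqrt (p (Suc (snd x)) - p (snd x))" for x :: "'b \<times> nat"
    have normal: "distributed M lborel (\<lambda>\<omega>. d x * D x \<omega>) (\<lambda>y. ennreal (normal_density 0 (s x) y))"
      and s: "0 < s x" if xK: "x \<in> K" for x
    proof -
      obtain u k where x: "x = (u, k)" "u \<in> Basis" "k < m" "d x \<noteq> 0"
        using xK by (cases x) (auto simp: K_def)
      have "standard_brownian_motion_real M (\<lambda>t \<omega>. B t \<omega> \<bullet> u)"
        using B x(2) unfolding standard_brownian_motion_def by blast
      hence "distributed M lborel (\<lambda>\<omega>. B (p (Suc k)) \<omega> \<bullet> u - B (p k) \<omega> \<bullet> u)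
          (\<lambda>y. ennreal (normal_density 0 (sqrt (p (Suc k) - p k)) y))"
        using pk[of k] pS[OF x(3)] x(3) unfolding standard_brownian_motion_real_def by simp
      hence "distributed M lborel (D x) (\<lambda>y. ennreal (normal_density 0 (sqrt (p (Suc k) - p k)) y))"
        by (simp add: D_def x(1) inner_diff_left)
      from normal_density_affine[OF this _ x(4), of 0] pS[OF x(3)]
      show "distributed M lborel (\<lambda>\<omega>. d x * D x \<omega>) (\<lambda>y. ennreal (normal_density 0 (s x) y))"
        by (simp add: s_def x(1))
      show "0 < s x" using pS[OF x(3)] x by (simp add: s_def)
    qed
    have "indep_vars (\<lambda>_. borel) D K"
      by (rule indep_vars_subset[OF ind]) (auto simp: K_def)
    from indep_vars_compose2[OF this, where N="\<lambda>_. borel" and Y="\<lambda>x y. d x * y"]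
    have "indep_vars (\<lambda>_. borel) (\<lambda>x \<omega>. d x * D x \<omega>) K" by simp
    from sum_indep_normal[OF finK False this s normal]
    have "distributed M lborel (increment_sum B I a b c)
        (\<lambda>y. ennreal (normal_density 0 (sqrt (\<Sum>x\<in>K. (s x)\<^sup>2)) y))"
      by (simp add: sumK)
    moreover have "0 < (\<Sum>x\<in>K. (s x)\<^sup>2)"
      using False finK by (intro sum_pos zero_less_power s)
    moreover have "increment_sum B I a b c \<in> borel_measurable M"
      by (rule increment_sum_isometry(1)[OF B I ab])
    ultimately show ?thesis unfolding centered_gaussian_rv_def
      by (intro conjI disjI2 exI[of _ "sqrt (\<Sum>x\<in>K. (s x)\<^sup>2)"]) auto
  qed
qed

text \<open>
  All end points of the first \<open>N + 1\<close> sums are put into one partition.  A sum which lives in the block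
  \<open>[\<tau> n, \<tau> (n + 1)]\<close> uses only increments that start in \<open>[\<tau> n, \<tau> (n + 1))\<close>, and these index sets
  are disjoint.
\<close>

lemma increment_sum_indep_blocks:
  fixes B :: "real \<Rightarrow> 'a \<Rightarrow> 'b::euclidean_space" and I :: "nat \<Rightarrow> 'i set"
  assumes B: "standard_brownian_motion M B" and I: "\<And>n. finite (I n)"
    and \<tau>: "0 \<le> \<tau> 0" "\<And>n. \<tau> n \<le> \<tau> (Suc n)"
    and a: "\<And>n i. i \<in> I n \<Longrightarrow> \<tau> n \<le> a n i" and ab: "\<And>n i. i \<in> I n \<Longrightarrow> a n i \<le> b n i"
    and b: "\<And>n i. i \<in> I n \<Longrightarrow> b n i \<le> \<tau> (Suc n)"
  shows "indep_vars (\<lambda>_. borel) (\<lambda>n. increment_sum B (I n) (a n) (b n) (c n)) {..N}"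
proof -
  have \<tau>_mono: "\<tau> m \<le> \<tau> n" if "m \<le> n" for m n
    using lift_Suc_mono_le[of \<tau>, OF \<tau>(2) that] .
  have \<tau>0: "0 \<le> \<tau> n" for n using \<tau>(1) \<tau>_mono[of 0 n] by simp
  define F where "F = insert 0 (\<Union>n\<le>N. a n ` I n \<union> b n ` I n)"
  have finF: "finite F" "F \<noteq> {}" using I by (auto simp: F_def)
  obtain p :: "nat \<Rightarrow> real" and m :: nat where mono: "strict_mono_on {..m} p" and F: "F = p ` {..m}"
    using finite_set_enumeration[OF finF] by blast
  have p: "p i < p j" if "i < j" "j \<le> m" for i j
    using strict_mono_onD[OF mono] that by simp
  have "0 \<le> x" if "x \<in> F" for x
    using that unfolding F_def by (auto intro: order_trans[OF \<tau>0 a] order_trans[OF order_trans[OF \<tau>0 a] ab])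
  hence p0: "0 \<le> p 0" using F by auto
  have pS: "p k < p (Suc k)" if "k < m" for k using p that by auto
  define D where "D = (\<lambda>(u, k) \<omega>. (B (p (Suc k)) \<omega> - B (p k) \<omega>) \<bullet> u)"
  define d where "d n = refined_coeff (I n) (a n) (b n) (c n) p" for n
  define K where "K n = (Basis :: 'b set) \<times> {k. k < m \<and> \<tau> n \<le> p k \<and> p k < \<tau> (Suc n)}" for n
  have ind: "indep_vars (\<lambda>_. borel) D (Basis \<times> {..<m})"
    unfolding D_def by (rule brownian_increments_indep[OF B p0 pS])
  have sum: "increment_sum B (I n) (a n) (b n) (c n) \<omega> = (\<Sum>x\<in>K n. d n x * D x \<omega>)" if "n \<le> N" for n \<omega>
  proof -
    have "increment_sum B (I n) (a n) (b n) (c n) \<omega> = (\<Sum>x\<in>Basis \<times> {..<m}. d n x * D x \<omega>)"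
    proof -
      have "a n i \<in> p ` {..m}" "b n i \<in> p ` {..m}" if "i \<in> I n" for i
        using that \<open>n \<le> N\<close> unfolding F[symmetric] F_def by auto
      thus ?thesis
        unfolding d_def D_def by (subst increment_sum_refine[OF p _ _ ab]) (auto simp: case_prod_unfold)
    qed
    also have "\<dots> = (\<Sum>x\<in>K n. d n x * D x \<omega>)"
    proof (rule sum.mono_neutral_right)
      have "d n (u, k) = 0" if "\<not> (\<tau> n \<le> p k \<and> p k < \<tau> (Suc n))" for u k
        unfolding d_def refined_coeff_def using that
        by (auto intro!: sum.neutral dest: a b order_trans[OF a] less_le_trans[OF _ b])
      thus "\<forall>x\<in>Basis \<times> {..<m} - K n. d n x * D x \<omega> = 0" by (auto simp: K_def)
    qed (auto simp: K_def)
    finally show ?thesis .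
  qed
  have disj: "disjoint_family_on K {..N}"
  proof (unfold disjoint_family_on_def, intro ballI impI)
    fix n n' :: nat assume "n \<noteq> n'"
    thus "K n \<inter> K n' = {}"
    proof (induction n n' rule: linorder_wlog)
      case (le n n')
      hence "\<tau> (Suc n) \<le> \<tau> n'" by (intro \<tau>_mono) auto
      thus ?case by (auto simp: K_def)
    next
      case (sym n n')
      thus ?case by auto
    qed
  qed
  have "indep_vars (\<lambda>n. PiM (K n) (\<lambda>_. borel)) (\<lambda>n \<omega>. restrict (\<lambda>x. D x \<omega>) (K n)) {..N}"
    by (rule indep_vars_restrict[OF ind _ disj]) (auto simp: K_def)
  from indep_vars_compose2[OF this, where N="\<lambda>_. borel" and Y="\<lambda>n f. \<Sum>x\<in>K n. d n x * f x"]
  have "indep_vars (\<lambda>_. borel) (\<lambda>n \<omega>. \<Sum>x\<in>K n. d n x * restrict (\<lambda>x. D x \<omega>) (K n) x) {..N}"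
    by (simp add: borel_measurable_sum)
  hence "indep_vars (\<lambda>_. borel) (\<lambda>n \<omega>. \<Sum>x\<in>K n. d n x * D x \<omega>) {..N}"
    by (simp cong: sum.cong)
  also have "?this \<longleftrightarrow> ?thesis"
    by (rule indep_vars_cong) (auto simp: sum)
  finally show ?thesis .
qed

end

section \<open>Wiener integrals\<close>

text \<open>
  A substitute for the triangle inequality in \<open>L\<^sup>2\<close> that needs squared norms only.  The
  factor \<open>1 + \<eta>\<close> of the main term can be chosen as close to 1 as the error term permits.
\<close>

lemma norm_add_square_le:
  fixes x y :: "'b::real_normed_vector"
  assumes "0 < \<eta>"
  shows "(norm (x + y))\<^sup>2 \<le> (1 + \<eta>) * (norm x)\<^sup>2 + (1 + 1 / \<eta>) * (norm y)\<^sup>2"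
proof -
  have "0 \<le> (\<eta> * norm x - norm y)\<^sup>2 / \<eta>" using assms by simp
  also have "\<dots> = \<eta> * (norm x)\<^sup>2 + 1 / \<eta> * (norm y)\<^sup>2 - 2 * norm x * norm y"
    using assms by (simp add: field_simps power2_eq_square)
  finally have "2 * norm x * norm y \<le> \<eta> * (norm x)\<^sup>2 + 1 / \<eta> * (norm y)\<^sup>2" by simp
  moreover have "(norm (x + y))\<^sup>2 \<le> (norm x + norm y)\<^sup>2"
    by (intro power_mono norm_triangle_ineq) simp
  ultimately show ?thesis by (simp add: power2_sum algebra_simps)
qed

lemma nn_integral_norm_add_square_le:
  fixes f g :: "'c \<Rightarrow> 'b::{real_normed_vector, second_countable_topology}"
  assumes [measurable]: "f \<in> borel_measurable N" "g \<in> borel_measurable N" and \<eta>: "0 < \<eta>"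
    and ab: "(\<integral>\<^sup>+x. ennreal ((norm (f x))\<^sup>2) \<partial>N) \<le> ennreal a" "(\<integral>\<^sup>+x. ennreal ((norm (g x))\<^sup>2) \<partial>N) \<le> ennreal b"
      "0 \<le> a" "0 \<le> b"
  shows "(\<integral>\<^sup>+x. ennreal ((norm (f x + g x))\<^sup>2) \<partial>N) \<le> ennreal ((1 + \<eta>) * a + (1 + 1 / \<eta>) * b)"
proof -
  have "(\<integral>\<^sup>+x. ennreal ((norm (f x + g x))\<^sup>2) \<partial>N)
      \<le> (\<integral>\<^sup>+x. ennreal (1 + \<eta>) * ennreal ((norm (f x))\<^sup>2) + ennreal (1 + 1 / \<eta>) * ennreal ((norm (g x))\<^sup>2) \<partial>N)"
  proof (rule nn_integral_mono)
    fix x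
    have "ennreal ((norm (f x + g x))\<^sup>2) \<le> ennreal ((1 + \<eta>) * (norm (f x))\<^sup>2 + (1 + 1 / \<eta>) * (norm (g x))\<^sup>2)"
      by (intro ennreal_leI norm_add_square_le \<eta>)
    also have "\<dots> = ennreal (1 + \<eta>) * ennreal ((norm (f x))\<^sup>2) + ennreal (1 + 1 / \<eta>) * ennreal ((norm (g x))\<^sup>2)"
      using \<eta> by (simp add: ennreal_plus ennreal_mult)
    finally show "ennreal ((norm (f x + g x))\<^sup>2)
        \<le> ennreal (1 + \<eta>) * ennreal ((norm (f x))\<^sup>2) + ennreal (1 + 1 / \<eta>) * ennreal ((norm (g x))\<^sup>2)" .
  qed
  also have "\<dots> = ennreal (1 + \<eta>) * (\<integral>\<^sup>+x. ennreal ((norm (f x))\<^sup>2) \<partial>N)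
      + ennreal (1 + 1 / \<eta>) * (\<integral>\<^sup>+x. ennreal ((norm (g x))\<^sup>2) \<partial>N)"
    by (simp add: nn_integral_add nn_integral_cmult)
  also have "\<dots> \<le> ennreal (1 + \<eta>) * ennreal a + ennreal (1 + 1 / \<eta>) * ennreal b"
    by (intro add_mono mult_left_mono ab) auto
  also have "\<dots> = ennreal ((1 + \<eta>) * a + (1 + 1 / \<eta>) * b)"
    using \<eta> ab by (simp add: ennreal_plus ennreal_mult)
  finally show ?thesis .
qed

lemma step_integral_eq_increment_sum:
  "step_integral B m p c = increment_sum B {..<m} p (\<lambda>i. p (Suc i)) c"
  by (simp add: fun_eq_iff step_integral_def increment_sum_def)

lemma step_function_eq_interval_sum:
  "step_function m p c = interval_sum {..<m} p (\<lambda>i. p (Suc i)) c"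
  by (simp add: fun_eq_iff step_function_def interval_sum_def)

lemma interval_sum_measurable [measurable]: "interval_sum I a b c \<in> borel_measurable borel"
  unfolding interval_sum_def[abs_def] by measurable

lemma partition_bounds:
  fixes p :: "nat \<Rightarrow> real"
  assumes p: "\<And>i. i < m \<Longrightarrow> p i < p (Suc i)" and i: "i \<le> m"
  shows "p 0 \<le> p i" "p i \<le> p m"
proof -
  show "p 0 \<le> p i" using i
  proof (induction i)
    case (Suc i)
    thus ?case using p[of i] by simp
  qed simp
  show "p i \<le> p m" using i
  proof (induction rule: inc_induct)
    case (step i)
    thus ?case using p[of i] by simp
  qed simp
qed

lemma step_function_outside:
  assumes p: "0 \<le> p 0" "\<And>i. i < m \<Longrightarrow> p i < p (Suc i)" "p m \<le> t" and s: "s \<notin> {0<..t}"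
  shows "step_function m p c s = 0"
  unfolding step_function_def
proof (intro sum.neutral ballI)
  fix i assume i: "i \<in> {..<m}"
  have "p 0 \<le> p i" "p (Suc i) \<le> p m" using partition_bounds[of m p, OF p(2)] i by auto
  hence "s \<notin> {p i<..p (Suc i)}" using p(1,3) s by auto
  thus "indicator {p i<..p (Suc i)} s *\<^sub>R c i = 0" by simp
qed

text \<open>
  The step function vanishes outside \<open>(0, t]\<close>, so its distance to \<open>f\<close> can be measured on the whole
  line once \<open>f\<close> is cut off.
\<close>

lemma has_wiener_integral_approx:
  fixes f :: "real \<Rightarrow> 'b::euclidean_space"
  assumes J: "has_wiener_integral M B t f J" and \<delta>: "0 < \<delta>"
  shows "\<exists>m p c. 0 \<le> p 0 \<and> (\<forall>i<m. p i < p (Suc i)) \<and> p m \<le> t \<and>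
    (\<integral>\<^sup>+s. ennreal ((norm (indicator {0<..t} s *\<^sub>R f s - step_function m p c s))\<^sup>2) \<partial>lborel) \<le> ennreal \<delta> \<and>
    (\<integral>\<^sup>+\<omega>. ennreal ((J \<omega> - step_integral B m p c \<omega>)\<^sup>2) \<partial>M) \<le> ennreal \<delta>"
proof -
  obtain m p c where part: "\<And>n. 0 \<le> p n 0 \<and> (\<forall>i<m n. p n i < p n (Suc i)) \<and> p n (m n) \<le> t"
    and lim: "(\<lambda>n. \<integral>\<^sup>+s\<in>{0<..t}. ennreal ((norm (f s - step_function (m n) (p n) (c n) s))\<^sup>2) \<partial>lborel) \<longlonglongrightarrow> 0"
      "(\<lambda>n. \<integral>\<^sup>+\<omega>. ennreal ((J \<omega> - step_integral B (m n) (p n) (c n) \<omega>)\<^sup>2) \<partial>M) \<longlonglongrightarrow> 0"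
    using J unfolding has_wiener_integral_def by blast
  have "\<forall>\<^sub>F n in sequentially. (\<integral>\<^sup>+s\<in>{0<..t}. ennreal ((norm (f s - step_function (m n) (p n) (c n) s))\<^sup>2) \<partial>lborel) < ennreal \<delta>
      \<and> (\<integral>\<^sup>+\<omega>. ennreal ((J \<omega> - step_integral B (m n) (p n) (c n) \<omega>)\<^sup>2) \<partial>M) < ennreal \<delta>"
    using lim \<delta> by (intro eventually_conj order_tendstoD(2)) auto
  then obtain n where n: "(\<integral>\<^sup>+s\<in>{0<..t}. ennreal ((norm (f s - step_function (m n) (p n) (c n) s))\<^sup>2) \<partial>lborel) < ennreal \<delta>"
      "(\<integral>\<^sup>+\<omega>. ennreal ((J \<omega> - step_integral B (m n) (p n) (c n) \<omega>)\<^sup>2) \<partial>M) < ennreal \<delta>"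
    using eventually_happens[of _ sequentially] by auto
  have "(\<integral>\<^sup>+s. ennreal ((norm (indicator {0<..t} s *\<^sub>R f s - step_function (m n) (p n) (c n) s))\<^sup>2) \<partial>lborel)
      = (\<integral>\<^sup>+s\<in>{0<..t}. ennreal ((norm (f s - step_function (m n) (p n) (c n) s))\<^sup>2) \<partial>lborel)"
  proof (intro nn_integral_cong)
    fix s
    show "ennreal ((norm (indicator {0<..t} s *\<^sub>R f s - step_function (m n) (p n) (c n) s))\<^sup>2)
        = ennreal ((norm (f s - step_function (m n) (p n) (c n) s))\<^sup>2) * indicator {0<..t} s"
      using step_function_outside[of "p n" "m n" t s "c n"] part[of n] by (cases "s \<in> {0<..t}") auto
  qed
  with n part[of n] show ?thesis
    by (intro exI[of _ "m n"] exI[of _ "p n"] exI[of _ "c n"]) (simp add: less_imp_le)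
qed

text \<open>
  The isometry, for integrals over different intervals.  It holds for the approximating step
  integrals, whose difference is an increment sum, and passes to the limit up to the error terms
  of \<open>norm_add_square_le\<close>.
\<close>

lemma (in prob_space) wiener_integral_diff_le:
  fixes B :: "real \<Rightarrow> 'a \<Rightarrow> 'b::euclidean_space"
  assumes B: "standard_brownian_motion M B"
    and X: "has_wiener_integral M B t f X" and Y: "has_wiener_integral M B s g Y"
    and d: "(\<integral>\<^sup>+x. ennreal ((norm (indicator {0<..t} x *\<^sub>R f x - indicator {0<..s} x *\<^sub>R g x))\<^sup>2) \<partial>lborel)
      \<le> ennreal d" "0 \<le> d"
  shows "(\<integral>\<^sup>+\<omega>. ennreal ((X \<omega> - Y \<omega>)\<^sup>2) \<partial>M) \<le> ennreal d"
proof -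
  define F G where "F x = indicator {0<..t} x *\<^sub>R f x" and "G x = indicator {0<..s} x *\<^sub>R g x" for x
  have [measurable]: "F \<in> borel_measurable lborel" "G \<in> borel_measurable lborel"
    and [measurable]: "X \<in> borel_measurable M" "Y \<in> borel_measurable M"
    using X Y by (auto simp: has_wiener_integral_def set_borel_measurable_def F_def[abs_def] G_def[abs_def])
  have approx: "(\<integral>\<^sup>+\<omega>. ennreal ((X \<omega> - Y \<omega>)\<^sup>2) \<partial>M)
      \<le> ennreal ((1 + \<eta>) * ((1 + \<eta>) * d + (1 + 1 / \<eta>) * (4 * \<delta>)) + (1 + 1 / \<eta>) * (4 * \<delta>))"
    if \<eta>: "0 < \<eta>" and \<delta>: "0 < \<delta>" for \<eta> \<delta>
  proof -
    obtain m p c where p: "0 \<le> p 0" "\<forall>i<m. p i < p (Suc i)" "p m \<le> t"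
      and f1: "(\<integral>\<^sup>+x. ennreal ((norm (F x - step_function m p c x))\<^sup>2) \<partial>lborel) \<le> ennreal \<delta>"
      and X1: "(\<integral>\<^sup>+\<omega>. ennreal ((X \<omega> - step_integral B m p c \<omega>)\<^sup>2) \<partial>M) \<le> ennreal \<delta>"
      using has_wiener_integral_approx[OF X \<delta>, folded F_def] by (elim exE conjE) (rule that)
    obtain m' p' c' where p': "0 \<le> p' 0" "\<forall>i<m'. p' i < p' (Suc i)" "p' m' \<le> s"
      and g1: "(\<integral>\<^sup>+x. ennreal ((norm (G x - step_function m' p' c' x))\<^sup>2) \<partial>lborel) \<le> ennreal \<delta>"
      and Y1: "(\<integral>\<^sup>+\<omega>. ennreal ((Y \<omega> - step_integral B m' p' c' \<omega>)\<^sup>2) \<partial>M) \<le> ennreal \<delta>"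
      using has_wiener_integral_approx[OF Y \<delta>, folded G_def] by (elim exE conjE) (rule that)
    define \<phi> \<phi>' where "\<phi> = step_function m p c" and "\<phi>' = step_function m' p' c'"
    define S S' where "S = step_integral B m p c" and "S' = step_integral B m' p' c'"
    have [measurable]: "\<phi> \<in> borel_measurable lborel" "\<phi>' \<in> borel_measurable lborel"
      unfolding \<phi>_def \<phi>'_def step_function_eq_interval_sum by auto
    have pos: "0 \<le> p i" if "i < m" for i using partition_bounds(1)[of m p i] p that by force
    have pos': "0 \<le> p' i" if "i < m'" for i using partition_bounds(1)[of m' p' i] p' that by force
    have [measurable]: "S \<in> borel_measurable M" "S' \<in> borel_measurable M"
      unfolding S_def S'_def step_integral_eq_increment_sum
      using pos pos' p p' by (auto intro!: increment_sum_isometry(1)[OF B] simp: less_imp_le)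
    have iso: "(\<integral>\<^sup>+\<omega>. ennreal ((S \<omega> - S' \<omega>)\<^sup>2) \<partial>M) = (\<integral>\<^sup>+x. ennreal ((norm (\<phi> x - \<phi>' x))\<^sup>2) \<partial>lborel)"
    proof -
      define I where "I = {..<m} <+> {..<m'}"
      define a b e where "a = case_sum p p'" and "b = case_sum (\<lambda>i. p (Suc i)) (\<lambda>i. p' (Suc i))"
        and "e = case_sum c (\<lambda>i. - c' i)"
      have "S \<omega> - S' \<omega> = increment_sum B I a b e \<omega>" for \<omega>
        by (simp add: S_def S'_def step_integral_def increment_sum_def I_def a_def b_def e_def sum.Plus sum_negf)
      moreover have "\<phi> x - \<phi>' x = interval_sum I a b e x" for x
        unfolding \<phi>_def \<phi>'_def step_function_def interval_sum_def I_def a_def b_def e_def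
        by (subst sum.Plus) (simp_all add: sum_negf)
      moreover have "(\<integral>\<^sup>+\<omega>. ennreal ((increment_sum B I a b e \<omega>)\<^sup>2) \<partial>M)
          = (\<integral>\<^sup>+x. ennreal ((norm (interval_sum I a b e x))\<^sup>2) \<partial>lborel)"
        using pos pos' p p'
        by (intro increment_sum_isometry(2)[OF B]) (auto simp: I_def a_def b_def less_imp_le)
      ultimately show ?thesis by simp
    qed
    have err: "(\<integral>\<^sup>+x. ennreal ((norm ((\<phi> x - F x) + (G x - \<phi>' x)))\<^sup>2) \<partial>lborel)
      \<le> ennreal ((1 + 1) * \<delta> + (1 + 1 / 1) * \<delta>)"
      by (rule nn_integral_norm_add_square_le) (use f1[folded \<phi>_def] g1[folded \<phi>'_def] \<delta> in \<open>auto simp: norm_minus_commute\<close>)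
    have "(\<integral>\<^sup>+x. ennreal ((norm ((F x - G x) + ((\<phi> x - F x) + (G x - \<phi>' x))))\<^sup>2) \<partial>lborel)
        \<le> ennreal ((1 + \<eta>) * d + (1 + 1 / \<eta>) * ((1 + 1) * \<delta> + (1 + 1 / 1) * \<delta>))"
      by (rule nn_integral_norm_add_square_le) (use d(1)[folded F_def G_def] d(2) err \<eta> \<delta> in \<open>auto\<close>)
    hence main: "(\<integral>\<^sup>+\<omega>. ennreal ((norm (S \<omega> - S' \<omega>))\<^sup>2) \<partial>M) \<le> ennreal ((1 + \<eta>) * d + (1 + 1 / \<eta>) * (4 * \<delta>))"
      using iso by (simp add: algebra_simps)
    have err': "(\<integral>\<^sup>+\<omega>. ennreal ((norm ((X \<omega> - S \<omega>) + (S' \<omega> - Y \<omega>)))\<^sup>2) \<partial>M)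
      \<le> ennreal ((1 + 1) * \<delta> + (1 + 1 / 1) * \<delta>)"
      by (rule nn_integral_norm_add_square_le) (use X1[folded S_def] Y1[folded S'_def] \<delta> in \<open>auto simp: power2_commute\<close>)
    have "(\<integral>\<^sup>+\<omega>. ennreal ((norm ((S \<omega> - S' \<omega>) + ((X \<omega> - S \<omega>) + (S' \<omega> - Y \<omega>))))\<^sup>2) \<partial>M)
        \<le> ennreal ((1 + \<eta>) * ((1 + \<eta>) * d + (1 + 1 / \<eta>) * (4 * \<delta>)) + (1 + 1 / \<eta>) * ((1 + 1) * \<delta> + (1 + 1 / 1) * \<delta>))"
      by (rule nn_integral_norm_add_square_le) (use main err' \<eta> \<delta> d(2) in \<open>auto\<close>)
    thus ?thesis by (simp add: algebra_simps)
  qed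
  have bound: "(\<integral>\<^sup>+\<omega>. ennreal ((X \<omega> - Y \<omega>)\<^sup>2) \<partial>M) \<le> ennreal ((1 + \<eta>)\<^sup>2 * d + \<eta>)" if \<eta>: "0 < \<eta>" for \<eta>
  proof -
    \<comment> \<open>The total factor of \<open>\<delta>\<close> in \<open>approx\<close>; with \<open>\<delta> = \<eta> / \<kappa>\<close> the error terms add up to \<open>\<eta>\<close>.\<close>
    define \<kappa> where "\<kappa> = ((1 + \<eta>) * (1 + 1 / \<eta>) + (1 + 1 / \<eta>)) * 4"
    have \<kappa>: "0 < \<kappa>" using \<eta> by (simp add: \<kappa>_def add_pos_pos)
    have "(1 + \<eta>) * ((1 + \<eta>) * d + r * (4 * e)) + r * (4 * e)
      = (1 + \<eta>)\<^sup>2 * d + ((1 + \<eta>) * r + r) * 4 * e" for r e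
      by (simp add: algebra_simps power2_eq_square)
    from this[of "1 + 1 / \<eta>" "\<eta> / \<kappa>", folded \<kappa>_def]
    show ?thesis using approx[of \<eta> "\<eta> / \<kappa>"] \<eta> \<kappa> by simp
  qed
  show ?thesis
  proof (rule LIMSEQ_le_const)
    have "(\<lambda>n. (1 + 1 / real (Suc n))\<^sup>2 * d + 1 / real (Suc n)) \<longlonglongrightarrow> (1 + 0)\<^sup>2 * d + 0"
      using LIMSEQ_inverse_real_of_nat by (intro tendsto_intros) (simp_all add: inverse_eq_divide)
    thus "(\<lambda>n. ennreal ((1 + 1 / real (Suc n))\<^sup>2 * d + 1 / real (Suc n))) \<longlonglongrightarrow> ennreal d"
      by (intro tendsto_ennrealI) simp
    show "\<exists>N. \<forall>n\<ge>N. (\<integral>\<^sup>+\<omega>. ennreal ((X \<omega> - Y \<omega>)\<^sup>2) \<partial>M)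
      \<le> ennreal ((1 + 1 / real (Suc n))\<^sup>2 * d + 1 / real (Suc n))"
      by (intro exI allI impI bound) simp
  qed
qed

section \<open>The lower bound along a geometric grid\<close>

text \<open>
  Each interval \<open>(x, y]\<close> is cut into its parts before and after \<open>\<tau>\<close>, which
  are \<open>(min x \<tau>, min y \<tau>]\<close> and \<open>(max x \<tau>, max y \<tau>]\<close>; one of the two may be empty.
\<close>

lemma step_integral_split:
  fixes p :: "nat \<Rightarrow> real" and B :: "real \<Rightarrow> 'a \<Rightarrow> 'b::euclidean_space"
  shows "step_integral B m p c \<omega>
    = increment_sum B {..<m} (\<lambda>i. min (p i) \<tau>) (\<lambda>i. min (p (Suc i)) \<tau>) c \<omega>
    + increment_sum B {..<m} (\<lambda>i. max (p i) \<tau>) (\<lambda>i. max (p (Suc i)) \<tau>) c \<omega>"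
proof -
  have "B (min x \<tau>) \<omega> + B (max x \<tau>) \<omega> = B x \<omega> + B \<tau> \<omega>" for x
    by (cases "x \<le> \<tau>") (auto simp: min_def max_def)
  hence "B y \<omega> - B x \<omega> = (B (min y \<tau>) \<omega> - B (min x \<tau>) \<omega>) + (B (max y \<tau>) \<omega> - B (max x \<tau>) \<omega>)" for x y
    by (smt (verit) add_diff_cancel_right add_diff_add)
  thus ?thesis
    unfolding step_integral_def increment_sum_def sum.distrib[symmetric] inner_add_right[symmetric]
    by (intro sum.cong refl arg_cong[where f="inner _"])
qed

lemma interval_sum_min:
  assumes "\<And>i. i < m \<Longrightarrow> p i \<le> p (Suc i)"
  shows "interval_sum {..<m} (\<lambda>i. min (p i) \<tau>) (\<lambda>i. min (p (Suc i)) \<tau>) c s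
    = indicator {..\<tau>} s *\<^sub>R step_function m p c s"
  unfolding interval_sum_def step_function_def scaleR_sum_right
  by (intro sum.cong refl) (auto simp: indicator_def)

lemma interval_sum_max:
  assumes "\<And>i. i < m \<Longrightarrow> p i \<le> p (Suc i)"
  shows "interval_sum {..<m} (\<lambda>i. max (p i) \<tau>) (\<lambda>i. max (p (Suc i)) \<tau>) c s
    = indicator {\<tau><..} s *\<^sub>R step_function m p c s"
  unfolding interval_sum_def step_function_def scaleR_sum_right
  by (intro sum.cong refl) (auto simp: indicator_def)

text \<open>
  Chebyshev's inequality; it serves for the approximation error of a Wiener integral, of which only the
  mean square is known.
\<close>

lemma (in prob_space) mean_square_markov:
  assumes [measurable]: "Z \<in> borel_measurable M" and a: "0 < a"
    and le: "(\<integral>\<^sup>+\<omega>. ennreal ((Z \<omega>)\<^sup>2) \<partial>M) \<le> ennreal (d * a)" "0 \<le> d"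
  shows "prob {\<omega>\<in>space M. sqrt a < \<bar>Z \<omega>\<bar>} \<le> d"
proof -
  have "emeasure M {\<omega>\<in>space M. sqrt a < \<bar>Z \<omega>\<bar>} \<le> emeasure M {\<omega>\<in>space M. 1
    \<le> ennreal (1 / a) * ennreal ((Z \<omega>)\<^sup>2)}"
  proof (rule emeasure_mono)
    show "{\<omega>\<in>space M. sqrt a < \<bar>Z \<omega>\<bar>} \<subseteq> {\<omega>\<in>space M. 1 \<le> ennreal (1 / a) * ennreal ((Z \<omega>)\<^sup>2)}"
    proof safe
      fix \<omega> assume "sqrt a < \<bar>Z \<omega>\<bar>"
      hence "a \<le> (Z \<omega>)\<^sup>2" using a real_less_rsqrt[of "\<bar>Z \<omega>\<bar>"]
        by (metis less_imp_le linorder_not_less power2_abs real_sqrt_abs real_sqrt_less_iff)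
      hence "1 \<le> 1 / a * (Z \<omega>)\<^sup>2" using a by simp
      hence "ennreal 1 \<le> ennreal (1 / a * (Z \<omega>)\<^sup>2)" by (rule ennreal_leI)
      thus "1 \<le> ennreal (1 / a) * ennreal ((Z \<omega>)\<^sup>2)" using a by (simp add: ennreal_mult'[symmetric])
    qed
  qed measurable
  also have "\<dots> \<le> ennreal (1 / a) * (\<integral>\<^sup>+\<omega>. ennreal ((Z \<omega>)\<^sup>2) * indicator (space M) \<omega> \<partial>M)"
    by (rule nn_integral_Markov_inequality) auto
  also have "(\<integral>\<^sup>+\<omega>. ennreal ((Z \<omega>)\<^sup>2) * indicator (space M) \<omega> \<partial>M) = (\<integral>\<^sup>+\<omega>. ennreal ((Z \<omega>)\<^sup>2) \<partial>M)"
    by (intro nn_integral_cong) auto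
  also have "ennreal (1 / a) * \<dots> \<le> ennreal (1 / a) * ennreal (d * a)"
    by (intro mult_left_mono le) auto
  also have "\<dots> = ennreal d" using a le(2) by (simp add: ennreal_mult[symmetric])
  finally show ?thesis using le(2) by (simp add: emeasure_eq_measure)
qed

lemma nn_integral_norm_mono:
  assumes "\<And>x. norm (f x) \<le> norm (g x)"
  shows "(\<integral>\<^sup>+x. ennreal ((norm (f x))\<^sup>2) \<partial>N) \<le> (\<integral>\<^sup>+x. ennreal ((norm (g x))\<^sup>2) \<partial>N)"
  using assms by (intro nn_integral_mono ennreal_leI power_mono) auto

text \<open>
  If most of the energy of \<open>F\<close> lies after \<open>\<tau>\<close>, then the same holds for an approximation \<open>\<phi>\<close> of \<open>F\<close>.  The relative
  error \<open>\<epsilon>\<^sup>2\<close> is what \<open>norm_add_square_le\<close> with \<open>\<eta> = \<epsilon>\<close> turns into an error of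
  order \<open>\<epsilon>\<close>.
\<close>

lemma approximant_energy_split:
  fixes F \<phi> :: "real \<Rightarrow> 'b::euclidean_space"
  assumes [measurable]: "F \<in> borel_measurable lborel" "\<phi> \<in> borel_measurable lborel"
    and \<epsilon>: "0 < \<epsilon>" "\<epsilon> < 1" and t: "0 < t" and c: "0 \<le> c"
    and F: "(\<integral>\<^sup>+s. ennreal ((norm (F s))\<^sup>2) \<partial>lborel) = ennreal (c * t)"
    and F_low: "(\<integral>\<^sup>+s. ennreal ((norm (indicator {..\<tau>} s *\<^sub>R F s))\<^sup>2) \<partial>lborel) \<le> ennreal (\<epsilon> * t)"
    and approx: "(\<integral>\<^sup>+s. ennreal ((norm (F s - \<phi> s))\<^sup>2) \<partial>lborel) \<le> ennreal (\<epsilon>\<^sup>2 * t)"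
  shows "(\<integral>\<^sup>+s. ennreal ((norm (indicator {..\<tau>} s *\<^sub>R \<phi> s))\<^sup>2) \<partial>lborel) \<le> ennreal (4 * \<epsilon> * t)"
    and "\<exists>w. (\<integral>\<^sup>+s. ennreal ((norm (indicator {\<tau><..} s *\<^sub>R \<phi> s))\<^sup>2) \<partial>lborel)
      = ennreal w \<and> (c - 3 * \<epsilon>) / (1 + \<epsilon>) * t \<le> w"
proof -
  have \<epsilon>2: "\<epsilon>\<^sup>2 \<le> \<epsilon>" using \<epsilon> by (simp add: power2_eq_square mult_left_le)
  have err: "(\<integral>\<^sup>+s. ennreal ((norm (indicator A s *\<^sub>R (F s - \<phi> s)))\<^sup>2) \<partial>lborel) \<le> ennreal (\<epsilon>\<^sup>2 * t)" for A
  proof -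
    have "norm (indicator A s *\<^sub>R (F s - \<phi> s)) \<le> norm (F s - \<phi> s)" for s
      by (auto simp: indicator_def)
    from nn_integral_norm_mono[of "\<lambda>s. indicator A s *\<^sub>R (F s - \<phi> s)", OF this]
    show ?thesis using approx by (rule order_trans)
  qed
  have "(\<integral>\<^sup>+s. ennreal ((norm (indicator {..\<tau>} s *\<^sub>R F s + - (indicator {..\<tau>} s *\<^sub>R (F s - \<phi> s))))\<^sup>2) \<partial>lborel)
      \<le> ennreal ((1 + 1) * (\<epsilon> * t) + (1 + 1 / 1) * (\<epsilon>\<^sup>2 * t))"
    by (rule nn_integral_norm_add_square_le) (use F_low err[of "{..\<tau>}"] \<epsilon> t in \<open>auto\<close>)
  also have "\<dots> \<le> ennreal (4 * \<epsilon> * t)"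
    using \<epsilon>2 t mult_right_mono[OF \<epsilon>2, of t] by (intro ennreal_leI) simp
  finally show "(\<integral>\<^sup>+s. ennreal ((norm (indicator {..\<tau>} s *\<^sub>R \<phi> s))\<^sup>2) \<partial>lborel) \<le> ennreal (4 * \<epsilon> * t)"
    by (simp add: algebra_simps)
  define W where "W = (\<integral>\<^sup>+s. ennreal ((norm (indicator {\<tau><..} s *\<^sub>R \<phi> s))\<^sup>2) \<partial>lborel)"
  have "(\<integral>\<^sup>+s. ennreal ((norm (F s + - (indicator UNIV s *\<^sub>R (F s - \<phi> s))))\<^sup>2) \<partial>lborel)
      \<le> ennreal ((1 + 1) * (c * t) + (1 + 1 / 1) * (\<epsilon>\<^sup>2 * t))"
    by (rule nn_integral_norm_add_square_le) (use F err[of UNIV] \<epsilon> t c in \<open>auto simp: norm_minus_commute\<close>)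
  moreover have "W \<le> (\<integral>\<^sup>+s. ennreal ((norm (F s + - (indicator UNIV s *\<^sub>R (F s - \<phi> s))))\<^sup>2) \<partial>lborel)"
    unfolding W_def by (rule nn_integral_norm_mono) (auto simp: indicator_def)
  ultimately have "W \<le> ennreal ((1 + 1) * (c * t) + (1 + 1 / 1) * (\<epsilon>\<^sup>2 * t))" by (rule order_trans[rotated])
  hence "W < \<infinity>" by (rule le_less_trans) simp
  then obtain w where w: "W = ennreal w" "0 \<le> w" by (cases W) auto
  have high: "(\<integral>\<^sup>+s. ennreal ((norm (indicator {\<tau><..} s *\<^sub>R \<phi> s + indicator {\<tau><..} s *\<^sub>R (F s - \<phi> s)))\<^sup>2) \<partial>lborel)
      \<le> ennreal ((1 + \<epsilon>) * w + (1 + 1 / \<epsilon>) * (\<epsilon>\<^sup>2 * t))"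
    by (rule nn_integral_norm_add_square_le) (use w[unfolded W_def] err[of "{\<tau><..}"] \<epsilon> t in \<open>auto\<close>)
  have "ennreal (c * t) = (\<integral>\<^sup>+s. ennreal ((norm (indicator {..\<tau>} s *\<^sub>R F s))\<^sup>2)
      + ennreal ((norm (indicator {\<tau><..} s *\<^sub>R \<phi> s + indicator {\<tau><..} s *\<^sub>R (F s - \<phi> s)))\<^sup>2) \<partial>lborel)"
    unfolding F[symmetric] by (intro nn_integral_cong) (auto simp: indicator_def)
  also have "\<dots> = (\<integral>\<^sup>+s. ennreal ((norm (indicator {..\<tau>} s *\<^sub>R F s))\<^sup>2) \<partial>lborel)
      + (\<integral>\<^sup>+s. ennreal ((norm (indicator {\<tau><..} s *\<^sub>R \<phi> s + indicator {\<tau><..} s *\<^sub>R (F s - \<phi> s)))\<^sup>2) \<partial>lborel)"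
    by (rule nn_integral_add) auto
  also have "\<dots> \<le> ennreal (\<epsilon> * t) + ennreal ((1 + \<epsilon>) * w + (1 + 1 / \<epsilon>) * (\<epsilon>\<^sup>2 * t))"
    by (intro add_mono F_low high)
  also have "\<dots> = ennreal (\<epsilon> * t + ((1 + \<epsilon>) * w + (1 + 1 / \<epsilon>) * (\<epsilon>\<^sup>2 * t)))"
    using \<epsilon> t w by (intro ennreal_plus[symmetric]) auto
  finally have "c * t \<le> \<epsilon> * t + ((1 + \<epsilon>) * w + (1 + 1 / \<epsilon>) * (\<epsilon>\<^sup>2 * t))"
    using \<epsilon> t w by (subst (asm) ennreal_le_iff) auto
  also have "(1 + 1 / \<epsilon>) * (\<epsilon>\<^sup>2 * t) = \<epsilon>\<^sup>2 * t + \<epsilon> * t"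
    using \<epsilon> by (simp add: field_simps power2_eq_square)
  also have "\<epsilon>\<^sup>2 * t \<le> \<epsilon> * t" using \<epsilon>2 t by simp
  finally have "(c - 3 * \<epsilon>) * t \<le> (1 + \<epsilon>) * w" by (simp add: algebra_simps)
  hence "(c - 3 * \<epsilon>) / (1 + \<epsilon>) * t \<le> w" using \<epsilon> by (simp add: field_simps)
  thus "\<exists>w. (\<integral>\<^sup>+s. ennreal ((norm (indicator {\<tau><..} s *\<^sub>R \<phi> s))\<^sup>2) \<partial>lborel)
    = ennreal w \<and> (c - 3 * \<epsilon>) / (1 + \<epsilon>) * t \<le> w"
    using w unfolding W_def by blast
qed

text \<open>
  With \<open>t\<^sub>n = q\<^sup>n\<^sup>+\<^sup>1\<close> and \<open>\<tau>\<^sub>n = q\<^sup>n\<close> the variable \<open>V t\<^sub>n\<close> is, up to a summable relative error, the sum of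
  \<open>P n\<close>, which comes from \<open>(0, \<tau>\<^sub>n]\<close>, and \<open>S n\<close>, which comes from \<open>(\<tau>\<^sub>n, t\<^sub>n]\<close>.  The \<open>S n\<close> are independent and have
  almost the full variance, so they are infinitely often as large as claimed; \<open>P n\<close> has variance
  at most \<open>4 \<epsilon> t\<^sub>n\<close> and is eventually below \<open>4 \<surd>\<epsilon> \<surd>(2 t\<^sub>n ln n)\<close>.
\<close>

lemma (in prob_space) wiener_lil_lower_grid:
  fixes B :: "real \<Rightarrow> 'a \<Rightarrow> 'b::euclidean_space" and f :: "real \<Rightarrow> real \<Rightarrow> 'b"
  assumes B: "standard_brownian_motion M B"
    and V: "\<And>t. 0 < t \<Longrightarrow> has_wiener_integral M B t (f t) (V t)"
    and full: "\<And>t. 0 < t \<Longrightarrow>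
      (\<integral>\<^sup>+s. ennreal ((norm (indicator {0<..t} s *\<^sub>R f t s))\<^sup>2) \<partial>lborel) = ennreal (c * t)"
    and q: "1 < q" and \<epsilon>: "0 < \<epsilon>" "\<epsilon> < 1" "3 * \<epsilon> < c"
    and early: "\<And>t. 0 < t \<Longrightarrow>
      (\<integral>\<^sup>+s. ennreal ((norm (indicator {0<..t / q} s *\<^sub>R f t s))\<^sup>2) \<partial>lborel) \<le> ennreal (\<epsilon> * t)"
  shows "AE \<omega> in M. \<exists>\<^sub>F n in sequentially.
    ((1 - \<epsilon>) * sqrt ((c - 3 * \<epsilon>) / (1 + \<epsilon>)) - 4 * sqrt \<epsilon> - \<epsilon>) * sqrt (2 * q ^ Suc n * ln (real n)) \<le> V (q ^ Suc n) \<omega>"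
proof -
  define t \<tau> where "t n = q ^ Suc n" and "\<tau> n = q ^ n" for n
  have t: "0 < t n" and \<tau>: "0 < \<tau> n" "\<tau> n \<le> t n" "t n / q = \<tau> n" "\<tau> (Suc n) = t n" for n
    using q by (auto simp: t_def \<tau>_def)
  \<comment> \<open>Summable, for the first Borel--Cantelli lemma, and at most \<open>\<epsilon>\<^sup>2\<close>, for \<open>approximant_energy_split\<close>.\<close>
  define \<delta> where "\<delta> n = \<epsilon>\<^sup>2 / (real (Suc n))\<^sup>2" for n
  have \<delta>: "0 < \<delta> n" "\<delta> n \<le> \<epsilon>\<^sup>2" for n
    using \<epsilon> by (auto simp: \<delta>_def divide_le_eq intro!: mult_left_le mult_le_cancel_left1[THEN iffD2])
  have \<delta>t: "0 < \<delta> n * t n" for n using \<delta> t by simp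
  define good where "good n m p e \<longleftrightarrow> 0 \<le> p 0 \<and> (\<forall>i<m. p i < p (Suc i)) \<and> p m \<le> t n \<and>
      (\<integral>\<^sup>+s. ennreal ((norm (indicator {0<..t n} s *\<^sub>R f (t n) s - step_function m p e s))\<^sup>2) \<partial>lborel)
        \<le> ennreal (\<delta> n * t n) \<and>
      (\<integral>\<^sup>+\<omega>. ennreal ((V (t n) \<omega> - step_integral B m p e \<omega>)\<^sup>2) \<partial>M) \<le> ennreal (\<delta> n * t n)" for n m p e
  have "\<forall>n. \<exists>m p e. good n m p e"
    unfolding good_def by (intro allI has_wiener_integral_approx[OF V[OF t] \<delta>t])
  from choice[OF this] obtain m where "\<forall>n. \<exists>p e. good n (m n) p e" ..
  from choice[OF this] obtain p where "\<forall>n. \<exists>e. good n (m n) (p n) e" ..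
  from choice[OF this] obtain e where "\<forall>n. good n (m n) (p n) (e n)" ..
  hence p_start: "0 \<le> p n 0" and p_mono: "i < m n \<Longrightarrow> p n i < p n (Suc i)" and p_end: "p n (m n) \<le> t n"
    and approx: "(\<integral>\<^sup>+s. ennreal ((norm (indicator {0<..t n} s *\<^sub>R f (t n) s
      - step_function (m n) (p n) (e n) s))\<^sup>2) \<partial>lborel) \<le> ennreal (\<delta> n * t n)"
    and error: "(\<integral>\<^sup>+\<omega>. ennreal ((V (t n) \<omega> - step_integral B (m n) (p n) (e n) \<omega>)\<^sup>2) \<partial>M)
      \<le> ennreal (\<delta> n * t n)" for n i
    unfolding good_def by blast+
  have p_le: "p n i \<le> p n (Suc i)" if "i < m n" for n i using p_mono[OF that] by simp
  have p_range: "0 \<le> p n i" "p n i \<le> t n" if "i \<le> m n" for n i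
    using partition_bounds[of "m n" "p n", OF p_mono that] p_start[of n] p_end[of n] by auto
  define \<phi> where "\<phi> n = step_function (m n) (p n) (e n)" for n
  define F where "F n s = indicator {0<..t n} s *\<^sub>R f (t n) s" for n s
  define P where "P n = increment_sum B {..<m n} (\<lambda>i. min (p n i) (\<tau> n)) (\<lambda>i. min (p n (Suc i)) (\<tau> n)) (e n)" for n
  define S where "S n = increment_sum B {..<m n} (\<lambda>i. max (p n i) (\<tau> n)) (\<lambda>i. max (p n (Suc i)) (\<tau> n)) (e n)" for n
  have split: "step_integral B (m n) (p n) (e n) \<omega> = P n \<omega> + S n \<omega>" for n \<omega>
    unfolding P_def S_def by (rule step_integral_split)
  have \<phi>_meas[measurable]: "\<phi> n \<in> borel_measurable lborel" for n
    unfolding \<phi>_def step_function_eq_interval_sum by simp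
  have F_meas[measurable]: "F n \<in> borel_measurable lborel" for n
    using V[OF t[of n]] by (simp add: has_wiener_integral_def set_borel_measurable_def F_def[abs_def])
  have F_low: "(\<integral>\<^sup>+s. ennreal ((norm (indicator {..\<tau> n} s *\<^sub>R F n s))\<^sup>2) \<partial>lborel) \<le> ennreal (\<epsilon> * t n)" for n
  proof -
    have "(\<integral>\<^sup>+s. ennreal ((norm (indicator {..\<tau> n} s *\<^sub>R F n s))\<^sup>2) \<partial>lborel)
        = (\<integral>\<^sup>+s. ennreal ((norm (indicator {0<..t n / q} s *\<^sub>R f (t n) s))\<^sup>2) \<partial>lborel)"
      using \<tau>(2)[of n] unfolding \<tau>(3) F_def by (intro nn_integral_cong) (auto simp: indicator_def)
    thus ?thesis using early[OF t[of n]] by simp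
  qed
  have F_app: "(\<integral>\<^sup>+s. ennreal ((norm (F n s - \<phi> n s))\<^sup>2) \<partial>lborel) \<le> ennreal (\<epsilon>\<^sup>2 * t n)" for n
    unfolding F_def \<phi>_def
    by (rule order_trans[OF approx ennreal_leI]) (use \<delta> t in \<open>auto intro!: mult_right_mono less_imp_le\<close>)
  have c0: "0 \<le> c" using \<epsilon> by simp
  note split_le = approximant_energy_split[OF F_meas \<phi>_meas \<epsilon>(1,2) t c0 full[OF t, folded F_def] F_low F_app]
  have ends: "0 \<le> min (p n i) (\<tau> n)" "min (p n i) (\<tau> n) \<le> min (p n (Suc i)) (\<tau> n)"
    "0 \<le> max (p n i) (\<tau> n)" "max (p n i) (\<tau> n) \<le> max (p n (Suc i)) (\<tau> n)"
    if "i \<in> {..<m n}" for n i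
    using that p_range(1)[of i n] p_le[of i n] \<tau>(1)[of n] by auto
  have P_gauss: "centered_gaussian_rv M (P n)" for n
    unfolding P_def by (rule increment_sum_gaussian[OF B finite_lessThan ends(1,2)])
  have P_var: "(\<integral>\<^sup>+\<omega>. ennreal ((P n \<omega>)\<^sup>2) \<partial>M) \<le> ennreal (4 * \<epsilon> * t n)" for n
  proof -
    have "(\<integral>\<^sup>+\<omega>. ennreal ((P n \<omega>)\<^sup>2) \<partial>M)
        = (\<integral>\<^sup>+s. ennreal ((norm (interval_sum {..<m n} (\<lambda>i. min (p n i) (\<tau> n)) (\<lambda>i. min (p n (Suc i)) (\<tau> n)) (e n) s))\<^sup>2) \<partial>lborel)"
      unfolding P_def by (rule increment_sum_isometry(2)[OF B finite_lessThan ends(1,2)])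
    also have "\<dots> = (\<integral>\<^sup>+s. ennreal ((norm (indicator {..\<tau> n} s *\<^sub>R \<phi> n s))\<^sup>2) \<partial>lborel)"
      unfolding \<phi>_def by (subst interval_sum_min[of "m n" "p n", OF p_le]) auto
    finally show ?thesis using split_le(1)[of n] by simp
  qed
  have S_gauss: "centered_gaussian_rv M (S n)" for n
    unfolding S_def by (rule increment_sum_gaussian[OF B finite_lessThan ends(3,4)])
  have S_var: "(\<integral>\<^sup>+\<omega>. ennreal ((S n \<omega>)\<^sup>2) \<partial>M)
    = (\<integral>\<^sup>+s. ennreal ((norm (indicator {\<tau> n<..} s *\<^sub>R \<phi> n s))\<^sup>2) \<partial>lborel)" for n
  proof -
    have "(\<integral>\<^sup>+\<omega>. ennreal ((S n \<omega>)\<^sup>2) \<partial>M)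
        = (\<integral>\<^sup>+s. ennreal ((norm (interval_sum {..<m n} (\<lambda>i. max (p n i) (\<tau> n)) (\<lambda>i. max (p n (Suc i)) (\<tau> n)) (e n) s))\<^sup>2) \<partial>lborel)"
      unfolding S_def by (rule increment_sum_isometry(2)[OF B finite_lessThan ends(3,4)])
    thus ?thesis unfolding \<phi>_def by (subst (asm) interval_sum_max[of "m n" "p n", OF p_le]) auto
  qed
  have "\<forall>n. \<exists>w. (\<integral>\<^sup>+\<omega>. ennreal ((S n \<omega>)\<^sup>2) \<partial>M) = ennreal w \<and> (c - 3 * \<epsilon>) / (1 + \<epsilon>) * t n \<le> w"
    unfolding S_var using split_le(2) by blast
  from choice[OF this] obtain w where w: "\<And>n. (\<integral>\<^sup>+\<omega>. ennreal ((S n \<omega>)\<^sup>2) \<partial>M) = ennreal (w n)"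
    "\<And>n. (c - 3 * \<epsilon>) / (1 + \<epsilon>) * t n \<le> w n" by blast
  have "0 < (c - 3 * \<epsilon>) / (1 + \<epsilon>) * t n" for n using \<epsilon> t by simp
  hence w0: "0 < w n" for n using w(2)[of n] less_le_trans by blast
  have S_ind: "indep_vars (\<lambda>_. borel) S {..N}" for N
    unfolding S_def
    by (rule increment_sum_indep_blocks[OF B finite_lessThan, where \<tau>=\<tau>])
       (use ends(4) \<tau> p_range(2) in \<open>auto simp: less_imp_le Suc_le_eq\<close>)
  have S_often: "AE \<omega> in M. \<exists>\<^sub>F n in sequentially. (1 - \<epsilon>) * sqrt (w n) * sqrt (2 * ln (real n)) < S n \<omega>"
    using S_ind centered_gaussian_normal[OF S_gauss w(1) w0] w0 \<epsilon>
    by (intro gaussian_sequence_frequently_gt) auto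
  have P_small: "AE \<omega> in M. \<forall>\<^sub>F n in sequentially. \<bar>P n \<omega>\<bar> \<le> 2 * sqrt (2 * (4 * \<epsilon> * t n) * ln (real n))"
    using P_gauss P_var \<epsilon> t by (intro gaussian_sequence_eventually_le) auto
  have [measurable]: "V (t n) \<in> borel_measurable M" for n
    using V[OF t[of n]] by (simp add: has_wiener_integral_def)
  have [measurable]: "P n \<in> borel_measurable M" "S n \<in> borel_measurable M" for n
    using P_gauss S_gauss by (auto simp: centered_gaussian_rv_def)
  have V_close: "AE \<omega> in M. \<forall>\<^sub>F n in sequentially. \<not> (sqrt (t n) < \<bar>V (t n) \<omega> - (P n \<omega> + S n \<omega>)\<bar>)"
  proof (rule borel_cantelli_prob)
    show "\<forall>\<^sub>F n in sequentially. prob {\<omega>\<in>space M. sqrt (t n) < \<bar>V (t n) \<omega> - (P n \<omega> + S n \<omega>)\<bar>} \<le> \<delta> n"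
      using error \<delta>(1) t unfolding split
      by (intro always_eventually allI mean_square_markov) (auto simp: less_imp_le)
    have "summable (\<lambda>n. \<epsilon>\<^sup>2 * inverse ((real (Suc n))\<^sup>2))"
      by (intro summable_mult summable_Suc_iff[of "\<lambda>n. inverse ((real n)\<^sup>2)", THEN iffD2] inverse_power_summable) simp
    thus "summable \<delta>" by (simp add: \<delta>_def[abs_def] divide_inverse)
  qed measurable
  have ln_large: "\<forall>\<^sub>F n in sequentially. 1 \<le> \<epsilon> * sqrt (2 * ln (real n))"
    using \<epsilon> by real_asymp
  from S_often P_small V_close show ?thesis
  proof eventually_elim
    case (elim \<omega>)
    have "\<forall>\<^sub>F n in sequentially. (1 - \<epsilon>) * sqrt (w n) * sqrt (2 * ln (real n)) < S n \<omega> \<longrightarrow>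
      ((1 - \<epsilon>) * sqrt ((c - 3 * \<epsilon>) / (1 + \<epsilon>)) - 4 * sqrt \<epsilon> - \<epsilon>) * sqrt (2 * q ^ Suc n * ln (real n)) \<le> V (q ^ Suc n) \<omega>"
      using elim(2,3) ln_large eventually_ge_at_top[of 1]
    proof eventually_elim
      case (elim n)
      define L where "L = sqrt (2 * ln (real n))"
      have L: "0 \<le> L" using elim by (simp add: L_def)
      have R: "sqrt (2 * t n * ln (real n)) = sqrt (t n) * L"
        by (simp add: L_def real_sqrt_mult mult_ac)
      have "sqrt (2 * (4 * \<epsilon> * t n) * ln (real n)) = sqrt (2\<^sup>2 * (\<epsilon> * (t n * (2 * ln (real n)))))"
        by (rule arg_cong[where f=sqrt]) simp
      also have "\<dots> = 2 * (sqrt \<epsilon> * (sqrt (t n) * L))"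
        unfolding L_def real_sqrt_mult by simp
      finally have Pn: "\<bar>P n \<omega>\<bar> \<le> 4 * sqrt \<epsilon> * (sqrt (t n) * L)" using elim by simp
      have "sqrt (t n) * 1 \<le> sqrt (t n) * (\<epsilon> * L)"
        using elim t[of n] unfolding L_def by (intro mult_left_mono) auto
      hence Vn: "\<bar>V (t n) \<omega> - (P n \<omega> + S n \<omega>)\<bar> \<le> \<epsilon> * (sqrt (t n) * L)" using elim by (simp add: mult_ac)
      have "sqrt ((c - 3 * \<epsilon>) / (1 + \<epsilon>)) * sqrt (t n) \<le> sqrt (w n)"
        unfolding real_sqrt_mult[symmetric] by (intro real_sqrt_le_mono w)
      hence Sn: "(1 - \<epsilon>) * (sqrt ((c - 3 * \<epsilon>) / (1 + \<epsilon>)) * sqrt (t n)) * L \<le> (1 - \<epsilon>) * sqrt (w n) * L"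
        using \<epsilon> L by (intro mult_right_mono mult_left_mono) auto
      have "((1 - x) * a - 4 * b - x) * (r * l) = (1 - x) * (a * r) * l - 4 * b * (r * l) - x * (r * l)"
        for a b x r l :: real
        by (simp add: algebra_simps)
      hence "((1 - \<epsilon>) * sqrt ((c - 3 * \<epsilon>) / (1 + \<epsilon>)) - 4 * sqrt \<epsilon> - \<epsilon>) * (sqrt (t n) * L)
          = (1 - \<epsilon>) * (sqrt ((c - 3 * \<epsilon>) / (1 + \<epsilon>)) * sqrt (t n)) * L
            - 4 * sqrt \<epsilon> * (sqrt (t n) * L) - \<epsilon> * (sqrt (t n) * L)"
        .
      thus ?case
        using elim(1) Pn Vn Sn unfolding t_def[symmetric] R L_def[symmetric] by linarith
    qed
    with elim(1) show ?case by (rule frequently_rev_mp)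
  qed
qed

section \<open>The law of the iterated logarithm for Wiener integrals\<close>

text \<open>
  The constant of \<open>wiener_lil_lower_grid\<close> tends to \<open>\<surd>c\<close> for \<open>\<epsilon> \<rightarrow> 0\<close>.
\<close>

lemma (in prob_space) wiener_lil_lower:
  fixes B :: "real \<Rightarrow> 'a \<Rightarrow> 'b::euclidean_space" and f :: "real \<Rightarrow> real \<Rightarrow> 'b"
  assumes B: "standard_brownian_motion M B"
    and V: "\<And>t. 0 < t \<Longrightarrow> has_wiener_integral M B t (f t) (V t)"
    and full: "\<And>t. 0 < t \<Longrightarrow>
      (\<integral>\<^sup>+s. ennreal ((norm (indicator {0<..t} s *\<^sub>R f t s))\<^sup>2) \<partial>lborel) = ennreal (c * t)"
    and early: "\<And>\<epsilon>. 0 < \<epsilon> \<Longrightarrow> \<exists>q>1. \<forall>t>0.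
      (\<integral>\<^sup>+s. ennreal ((norm (indicator {0<..t / q} s *\<^sub>R f t s))\<^sup>2) \<partial>lborel) \<le> ennreal (\<epsilon> * t)"
    and c: "0 < c" and r: "0 \<le> r" "r < sqrt c"
  shows "AE \<omega> in M. \<exists>\<^sub>F t in at_top. r * sqrt (2 * t * ln (ln t)) \<le> V t \<omega>"
proof -
  define \<kappa> where "\<kappa> \<epsilon> = (1 - \<epsilon>) * sqrt ((c - 3 * \<epsilon>) / (1 + \<epsilon>)) - 4 * sqrt \<epsilon> - \<epsilon>" for \<epsilon> :: real
  have "(\<kappa> \<longlongrightarrow> (1 - 0) * sqrt ((c - 3 * 0) / (1 + 0)) - 4 * sqrt 0 - 0) (at_right 0)"
    unfolding \<kappa>_def by (intro tendsto_intros) auto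
  hence "\<forall>\<^sub>F \<epsilon> in at_right 0. r < \<kappa> \<epsilon>" using r(2) by (intro order_tendstoD(1)) auto
  moreover have "\<forall>\<^sub>F \<epsilon> in at_right (0::real). \<epsilon> \<in> {0<..<min 1 (c / 3)}"
    using c by (intro eventually_at_right_real) auto
  ultimately have "\<forall>\<^sub>F \<epsilon> in at_right 0. r < \<kappa> \<epsilon> \<and> \<epsilon> \<in> {0<..<min 1 (c / 3)}"
    by (rule eventually_conj)
  from eventually_happens'[OF _ this] obtain \<epsilon> where "r < \<kappa> \<epsilon> \<and> \<epsilon> \<in> {0<..<min 1 (c / 3)}" by auto
  hence \<epsilon>: "r < \<kappa> \<epsilon>" "0 < \<epsilon>" "\<epsilon> < 1" "3 * \<epsilon> < c" by auto
  obtain q where q: "1 < q" and early_q: "\<And>t. 0 < t \<Longrightarrow>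
      (\<integral>\<^sup>+s. ennreal ((norm (indicator {0<..t / q} s *\<^sub>R f t s))\<^sup>2) \<partial>lborel) \<le> ennreal (\<epsilon> * t)"
    using early[OF \<epsilon>(2)] by blast
  have \<kappa>: "0 < \<kappa> \<epsilon>" using r \<epsilon> by simp
  \<comment> \<open>\<open>ln (q\<^sup>n\<^sup>+\<^sup>1) \<le> n d\<close> for \<open>n \<ge> 1\<close>, so \<open>ln ln\<close> of the grid point is \<open>ln n\<close> up to a constant, which the gap
    between \<open>r\<close> and \<open>\<kappa> \<epsilon>\<close> absorbs.\<close>
  define d where "d = 2 * ln q"
  have d: "0 < d" using q by (simp add: d_def)
  have "filterlim (\<lambda>n. ln (real n)) at_top sequentially" by real_asymp
  hence "\<forall>\<^sub>F n in sequentially. r\<^sup>2 * ln d / ((\<kappa> \<epsilon>)\<^sup>2 - r\<^sup>2) \<le> ln (real n)"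
    by (simp add: filterlim_at_top)
  hence norming: "\<forall>\<^sub>F n in sequentially.
      r * sqrt (2 * q ^ Suc n * ln (ln (q ^ Suc n))) \<le> \<kappa> \<epsilon> * sqrt (2 * q ^ Suc n * ln (real n))"
    using eventually_ge_at_top[of 1]
  proof eventually_elim
    case (elim n)
    have "r\<^sup>2 < (\<kappa> \<epsilon>)\<^sup>2" using r \<epsilon>(1) by (intro power_strict_mono) auto
    hence "r\<^sup>2 * (ln (real n) + ln d) \<le> (\<kappa> \<epsilon>)\<^sup>2 * ln (real n)"
      using elim(1) by (simp add: pos_divide_le_eq algebra_simps)
    moreover have "ln (ln (q ^ Suc n)) \<le> ln (real n) + ln d"
    proof -
      have "ln (q ^ Suc n) = real (Suc n) * ln q" using q by (subst ln_realpow) auto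
      also have "\<dots> \<le> real n * d" using elim(2) q by (simp add: d_def)
      finally have "ln (ln (q ^ Suc n)) \<le> ln (real n * d)"
        using q by (subst ln_le_cancel_iff) (use d elim in \<open>auto simp: one_less_power ln_gt_zero simp del: power_Suc\<close>)
      thus ?thesis using elim(2) d by (simp add: ln_mult)
    qed
    ultimately have "r\<^sup>2 * ln (ln (q ^ Suc n)) \<le> (\<kappa> \<epsilon>)\<^sup>2 * ln (real n)"
      by (meson mult_left_mono order_trans zero_le_power2)
    hence "2 * q ^ Suc n * (r\<^sup>2 * ln (ln (q ^ Suc n))) \<le> 2 * q ^ Suc n * ((\<kappa> \<epsilon>)\<^sup>2 * ln (real n))"
      using q by (intro mult_left_mono) auto
    hence "sqrt (r\<^sup>2 * (2 * q ^ Suc n * ln (ln (q ^ Suc n)))) \<le> sqrt ((\<kappa> \<epsilon>)\<^sup>2 * (2 * q ^ Suc n * ln (real n)))"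
      by (intro real_sqrt_le_mono) (simp only: mult_ac)
    moreover have "sqrt (z\<^sup>2 * x) = z * sqrt x" if "0 \<le> z" for z x :: real
      using that by (simp add: real_sqrt_mult)
    ultimately show ?case using r(1) \<kappa> by (simp only: less_imp_le)
  qed
  have "AE \<omega> in M. \<exists>\<^sub>F n in sequentially. \<kappa> \<epsilon> * sqrt (2 * q ^ Suc n * ln (real n)) \<le> V (q ^ Suc n) \<omega>"
    unfolding \<kappa>_def by (rule wiener_lil_lower_grid[OF B V full q \<epsilon>(2-4) early_q])
  thus ?thesis
  proof eventually_elim
    case (elim \<omega>)
    have grid: "filterlim (\<lambda>n. q ^ Suc n) at_top sequentially"
      using q by real_asymp
    show ?case
    proof (rule ccontr)
      assume "\<not> ?thesis"
      hence "\<forall>\<^sub>F t in at_top. V t \<omega> < r * sqrt (2 * t * ln (ln t))"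
        by (simp add: not_frequently not_le)
      from eventually_compose_filterlim[OF this grid] norming
      have "\<forall>\<^sub>F n in sequentially. \<not> (\<kappa> \<epsilon> * sqrt (2 * q ^ Suc n * ln (real n)) \<le> V (q ^ Suc n) \<omega>)"
        by eventually_elim linarith
      thus False using elim by (simp add: frequently_def)
    qed
  qed
qed

text \<open>
  Compared with this integral in \<open>wiener_integral_diff_le\<close>, a Wiener integral gets its variance bound.
\<close>

lemma has_wiener_integral_zero:
  "has_wiener_integral M B 0 (\<lambda>_. 0) (\<lambda>_. 0)"
  unfolding has_wiener_integral_def set_borel_measurable_def
  by (auto intro!: exI[of _ "\<lambda>_. 0"] exI[of _ "\<lambda>_ _. 0"] simp: step_function_def step_integral_def)

text \<open>
  The kernel may depend on \<open>t\<close> and \<open>s\<close> in any way that gives the variance \<open>c t\<close> (\<open>full\<close>), makes the distant past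
  negligible (\<open>early\<close>), and makes the increments of \<open>V\<close> between nearby times of the order of those
  of a Brownian motion (\<open>inc\<close>).
\<close>

theorem (in prob_space) wiener_lil:
  fixes B :: "real \<Rightarrow> 'a \<Rightarrow> 'b::euclidean_space" and f :: "real \<Rightarrow> real \<Rightarrow> 'b"
  assumes B: "standard_brownian_motion M B"
    and gauss: "centered_gaussian_process M {0..} V"
    and cont: "AE \<omega> in M. continuous_on {0..} (\<lambda>t. V t \<omega>)"
    and V: "\<And>t. 0 < t \<Longrightarrow> has_wiener_integral M B t (f t) (V t)"
    and full: "\<And>t. 0 < t \<Longrightarrow>
      (\<integral>\<^sup>+s. ennreal ((norm (indicator {0<..t} s *\<^sub>R f t s))\<^sup>2) \<partial>lborel) = ennreal (c * t)"
    and early: "\<And>\<epsilon>. 0 < \<epsilon> \<Longrightarrow> \<exists>q>1. \<forall>t>0.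
      (\<integral>\<^sup>+s. ennreal ((norm (indicator {0<..t / q} s *\<^sub>R f t s))\<^sup>2) \<partial>lborel) \<le> ennreal (\<epsilon> * t)"
    and inc: "\<And>s t. 0 < s \<Longrightarrow> s \<le> t \<Longrightarrow> t \<le> 2 * s \<Longrightarrow>
      (\<integral>\<^sup>+x. ennreal ((norm (indicator {0<..t} x *\<^sub>R f t x - indicator {0<..s} x *\<^sub>R f s x))\<^sup>2) \<partial>lborel)
        \<le> ennreal (K * (t - s))"
    and c: "0 < c" and K: "0 < K"
  shows "AE \<omega> in M. Limsup at_top (\<lambda>t. ereal (V t \<omega> / sqrt (2 * t * ln (ln t)))) = ereal (sqrt c)"
proof -
  have comb: "centered_gaussian_rv M (\<lambda>\<omega>. \<Sum>t\<in>J. a t * V t \<omega>)" if "finite J" "J \<subseteq> {0..}" for J a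
    using gauss that by (simp add: centered_gaussian_process_def)
  have gauss1: "centered_gaussian_rv M (V t)" if "0 < t" for t
    using comb[of "{t}" "\<lambda>_. 1"] that by simp
  have gauss2: "centered_gaussian_rv M (\<lambda>\<omega>. V t \<omega> - V s \<omega>)" if "0 < s" "s \<le> t" for s t
  proof (cases "s = t")
    case True
    thus ?thesis by (simp add: centered_gaussian_rv_def)
  next
    case False
    thus ?thesis using comb[of "{s, t}" "\<lambda>x. if x = t then 1 else -1"] that by simp
  qed
  have var: "(\<integral>\<^sup>+\<omega>. ennreal ((V t \<omega>)\<^sup>2) \<partial>M) \<le> ennreal (c * t)" if "0 < t" for t
    using wiener_integral_diff_le[OF B V[OF that] has_wiener_integral_zero, of "c * t"] full[OF that] c that
    by simp
  have var_inc: "(\<integral>\<^sup>+\<omega>. ennreal ((V t \<omega> - V s \<omega>)\<^sup>2) \<partial>M) \<le> ennreal (K * (t - s))"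
    if "0 < s" "s \<le> t" "t \<le> 2 * s" for s t
    using wiener_integral_diff_le[OF B V V inc[OF that]] that K by simp
  have upper: "AE \<omega> in M. \<forall>k. \<forall>\<^sub>F t in at_top. \<bar>V t \<omega>\<bar> \<le> (sqrt c + 1 / real (Suc k)) * sqrt (2 * t * ln (ln t))"
    unfolding AE_all_countable
    by (intro allI gaussian_lil_upper[OF gauss1 gauss2 var var_inc cont c K]) auto
  have lower: "AE \<omega> in M. \<forall>k. \<exists>\<^sub>F t in at_top. sqrt c * (1 - 1 / real (Suc k)) * sqrt (2 * t * ln (ln t))
    \<le> V t \<omega>"
    unfolding AE_all_countable
    by (intro allI wiener_lil_lower[OF B V full early c]) (use c in \<open>auto simp: field_simps\<close>)
  have norming: "\<forall>\<^sub>F t in at_top. 0 < sqrt (2 * t * ln (ln t))" for t :: real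
    by real_asymp
  from upper lower show ?thesis
  proof eventually_elim
    case (elim \<omega>)
    define L where "L = Limsup at_top (\<lambda>t. ereal (V t \<omega> / sqrt (2 * t * ln (ln t))))"
    have inv: "(\<lambda>k. 1 / real (Suc k)) \<longlonglongrightarrow> 0"
      using LIMSEQ_inverse_real_of_nat by (simp add: inverse_eq_divide)
    have "L \<le> ereal (sqrt c + 1 / real (Suc k))" for k
      unfolding L_def
    proof (rule Limsup_bounded)
      show "\<forall>\<^sub>F t in at_top. ereal (V t \<omega> / sqrt (2 * t * ln (ln t))) \<le> ereal (sqrt c + 1 / real (Suc k))"
        using elim(1)[rule_format, of k] norming
        by eventually_elim (auto simp: divide_le_eq abs_le_iff)
    qed
    moreover have "(\<lambda>k. ereal (sqrt c + 1 / real (Suc k))) \<longlonglongrightarrow> ereal (sqrt c + 0)"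
      by (intro tendsto_intros inv)
    ultimately have upper_L: "L \<le> ereal (sqrt c + 0)"
      by (intro LIMSEQ_le_const[where X="\<lambda>k. ereal (sqrt c + 1 / real (Suc k))"]) auto
    have lower_k: "ereal (sqrt c * (1 - 1 / real (Suc k))) \<le> L" for k
    proof (rule ccontr)
      assume "\<not> ?thesis"
      hence "\<forall>\<^sub>F t in at_top. ereal (V t \<omega> / sqrt (2 * t * ln (ln t))) < ereal (sqrt c * (1 - 1 / real (Suc k)))"
        unfolding L_def by (intro Limsup_lessD) simp
      hence "\<forall>\<^sub>F t in at_top. \<not> (sqrt c * (1 - 1 / real (Suc k)) * sqrt (2 * t * ln (ln t)) \<le> V t \<omega>)"
        using norming by eventually_elim (simp add: divide_less_eq not_le)
      thus False using elim(2)[rule_format, of k] by (simp add: frequently_def)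
    qed
    have lower_lim: "(\<lambda>k. ereal (sqrt c * (1 - 1 / real (Suc k)))) \<longlonglongrightarrow> ereal (sqrt c * (1 - 0))"
      by (intro tendsto_intros inv)
    have "ereal (sqrt c * (1 - 0)) \<le> L"
      by (rule LIMSEQ_le_const2[OF lower_lim]) (use lower_k in blast)
    thus ?case using upper_L unfolding L_def[symmetric] by (intro antisym) auto
  qed
qed

section \<open>Self-similar kernels\<close>

text \<open>
  The square of \<open>exp (r ln (t / s))\<close> is \<open>(t / s) powr (2 r)\<close>, which is integrable at
  \<open>s = 0\<close> because \<open>2 r < 1\<close>.
\<close>

lemma nn_integral_power_kernel:
  fixes r t a :: real
  assumes r: "r < 1/2" and t: "0 < t" and a: "0 \<le> a"
  shows "(\<integral>\<^sup>+s. ennreal ((exp (r * ln (t / s)))\<^sup>2 * indicator {0<..a} s) \<partial>lborel)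
    = ennreal (t powr (2 * r) * a powr (1 - 2 * r) / (1 - 2 * r))"
proof -
  have "((\<lambda>s. t powr (2 * r) * s powr (- 2 * r)) has_integral t powr (2 * r) * (a powr (- 2 * r + 1) / (- 2 * r + 1))) {0..a}"
    using r a by (intro has_integral_mult_right has_integral_powr_from_0) auto
  hence "(\<integral>\<^sup>+s. ennreal (t powr (2 * r) * s powr (- 2 * r)) * indicator {0..a} s \<partial>lborel)
      = ennreal (t powr (2 * r) * (a powr (- 2 * r + 1) / (- 2 * r + 1)))"
    by (intro nn_integral_has_integral_lebesgue') auto
  moreover have "ennreal ((exp (r * ln (t / s)))\<^sup>2 * indicator {0<..a} s)
      = ennreal (t powr (2 * r) * s powr (- 2 * r)) * indicator {0..a} s" for s
  proof (cases "0 < s")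
    case True
    have "(exp (r * ln (t / s)))\<^sup>2 = t powr (2 * r) * s powr (- 2 * r)"
      using True t by (simp add: powr_def exp_add[symmetric] exp_double[symmetric] ln_div algebra_simps)
    thus ?thesis using True by (simp add: indicator_def)
  qed (auto simp: indicator_def not_less le_less)
  ultimately show ?thesis by (simp add: add.commute[of _ 1])
qed

lemma nn_integral_power_kernel_bound:
  fixes G :: "real \<Rightarrow> 'b::real_normed_vector"
  assumes r: "r < 1/2" and t: "0 < t" and a: "0 \<le> a" and D: "0 \<le> D"
    and G: "\<And>s. norm (G s) \<le> D * exp (r * ln (t / s)) * indicator {0<..a} s"
  shows "(\<integral>\<^sup>+s. ennreal ((norm (G s))\<^sup>2) \<partial>lborel)
    \<le> ennreal (D\<^sup>2 * (t powr (2 * r) * a powr (1 - 2 * r) / (1 - 2 * r)))"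
proof -
  have "(\<integral>\<^sup>+s. ennreal ((norm (G s))\<^sup>2) \<partial>lborel)
      \<le> (\<integral>\<^sup>+s. ennreal (D\<^sup>2) * ennreal ((exp (r * ln (t / s)))\<^sup>2 * indicator {0<..a} s) \<partial>lborel)"
  proof (rule nn_integral_mono)
    fix s
    have "(norm (G s))\<^sup>2 \<le> (D * exp (r * ln (t / s)) * indicator {0<..a} s)\<^sup>2"
      by (intro power_mono G) simp
    also have "\<dots> = D\<^sup>2 * ((exp (r * ln (t / s)))\<^sup>2 * indicator {0<..a} s)"
      by (simp add: power_mult_distrib indicator_def)
    finally have "ennreal ((norm (G s))\<^sup>2) \<le> ennreal (D\<^sup>2 * ((exp (r * ln (t / s)))\<^sup>2 * indicator {0<..a} s))"
      by (rule ennreal_leI)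
    thus "ennreal ((norm (G s))\<^sup>2) \<le> ennreal (D\<^sup>2) * ennreal ((exp (r * ln (t / s)))\<^sup>2 * indicator {0<..a} s)"
      by (simp add: ennreal_mult')
  qed
  also have "\<dots> = ennreal (D\<^sup>2) * (\<integral>\<^sup>+s. ennreal ((exp (r * ln (t / s)))\<^sup>2 * indicator {0<..a} s) \<partial>lborel)"
    by (rule nn_integral_cmult) simp
  also have "\<dots> = ennreal (D\<^sup>2 * (t powr (2 * r) * a powr (1 - 2 * r) / (1 - 2 * r)))"
    unfolding nn_integral_power_kernel[OF r t a] by (rule ennreal_mult'[symmetric]) simp
  finally show ?thesis .
qed

text \<open>
  The conditions of \<open>wiener_lil\<close> follow from the growth of \<open>h\<close> and \<open>h'\<close>.  By scaling, the energy on \<open>(0, t]\<close>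
  is \<open>c t\<close>.  The energy on \<open>(0, t / q]\<close> is at most a multiple of \<open>t q powr (2 r - 1)\<close>.  For the increments,
  the kernels at \<open>s < t\<close> differ by at most \<open>ln (t / s) K exp (r ln (t / x))\<close> by the mean value theorem, and
  \<open>ln (t / s) \<le> (t - s) / s\<close>.
\<close>

theorem (in prob_space) self_similar_lil:
  fixes B :: "real \<Rightarrow> 'a \<Rightarrow> 'b::euclidean_space" and h h' :: "real \<Rightarrow> 'b"
  assumes B: "standard_brownian_motion M B"
    and gauss: "centered_gaussian_process M {0..} V"
    and cont: "AE \<omega> in M. continuous_on {0..} (\<lambda>t. V t \<omega>)"
    and V: "\<And>t. 0 < t \<Longrightarrow> has_wiener_integral M B t (\<lambda>s. h (ln (t / s))) (V t)"
    and deriv: "\<And>y. 0 \<le> y \<Longrightarrow> (h has_vector_derivative h' y) (at y)"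
    and h: "\<And>y. 0 \<le> y \<Longrightarrow> norm (h y) \<le> K * exp (r * y)"
    and h': "\<And>y. 0 \<le> y \<Longrightarrow> norm (h' y) \<le> K * exp (r * y)"
    and K: "0 < K" and r: "0 \<le> r" "r < 1/2"
    and c: "((\<lambda>u. (norm (h (- ln u)))\<^sup>2) has_integral c) {0..1}" "0 < c"
  shows "AE \<omega> in M. Limsup at_top (\<lambda>t. ereal (V t \<omega> / sqrt (2 * t * ln (ln t)))) = ereal (sqrt c)"
proof -
  define f where "f t s = h (ln (t / s))" for t s :: real
  define K' where "K' = 2 * K\<^sup>2 / (1 - 2 * r) + 4 * K\<^sup>2"
  have f_bound: "norm (f t s) \<le> K * exp (r * ln (t / s))" if "0 < s" "s \<le> t" for s t
    unfolding f_def using that by (intro h) (auto simp: ln_ge_zero)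
  have powr_self: "t powr (2 * r) * t powr (1 - 2 * r) = t" if "0 < t" for t
    using that by (simp add: powr_add[symmetric])
  have lipschitz: "norm (h b - h a) \<le> (b - a) * (K * exp (r * b))" if ab: "0 \<le> a" "a < b" for a b
  proof -
    have "\<exists>x\<in>{a<..<b}. norm (h b - h a) \<le> norm ((b - a) *\<^sub>R h' x)"
    proof (rule mvt_general[where f'="\<lambda>x y. y *\<^sub>R h' x"])
      show "continuous_on {a..b} h"
        using ab by (intro continuous_at_imp_continuous_on ballI has_vector_derivative_continuous[OF deriv]) auto
      show "(h has_derivative (\<lambda>y. y *\<^sub>R h' x)) (at x)" if "a < x" "x < b" for x
        using deriv[of x] that ab by (simp add: has_vector_derivative_def)
    qed (use ab in simp)
    then obtain x where x: "a < x" "x < b" "norm (h b - h a) \<le> norm ((b - a) *\<^sub>R h' x)" by auto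
    have "norm ((b - a) *\<^sub>R h' x) \<le> (b - a) * (K * exp (r * x))"
      using h'[of x] x ab by (simp add: mult_left_mono)
    also have "\<dots> \<le> (b - a) * (K * exp (r * b))"
      using x ab K r by (intro mult_left_mono) (auto intro: mult_left_mono)
    finally show ?thesis using x(3) by linarith
  qed
  have full: "(\<integral>\<^sup>+s. ennreal ((norm (indicator {0<..t} s *\<^sub>R f t s))\<^sup>2) \<partial>lborel) = ennreal (c * t)"
    if t: "0 < t" for t
  proof -
    define g where "g s = ennreal ((norm (indicator {0<..t} s *\<^sub>R f t s))\<^sup>2)" for s
    have [measurable]: "(\<lambda>s. indicator {0<..t} s *\<^sub>R f t s) \<in> borel_measurable borel"
      using V[OF t] unfolding has_wiener_integral_def set_borel_measurable_def f_def by simp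
    have g: "g \<in> borel_measurable borel" unfolding g_def[abs_def] by measurable
    have "(\<integral>\<^sup>+s. g s \<partial>lborel) = \<bar>t\<bar> * (\<integral>\<^sup>+u. g (0 + t * u) \<partial>lborel)"
      using t by (intro nn_integral_real_affine[OF g]) auto
    also have "(\<integral>\<^sup>+u. g (0 + t * u) \<partial>lborel)
        = (\<integral>\<^sup>+u. ennreal ((norm (h (- ln u)))\<^sup>2) * indicator {0..1} u \<partial>lborel)"
    proof (intro nn_integral_cong_AE)
      show "AE u in lborel. g (0 + t * u) = ennreal ((norm (h (- ln u)))\<^sup>2) * indicator {0..1} u"
        using AE_lborel_singleton[of "0::real"]
      proof eventually_elim
        case (elim u)
        show ?case using elim t
          by (auto simp: g_def f_def indicator_def zero_less_mult_iff mult_le_cancel_left1 ln_div)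
      qed
    qed
    also have "\<dots> = ennreal c"
      using c by (intro nn_integral_has_integral_lebesgue') auto
    finally show ?thesis using t c by (simp add: g_def ennreal_mult'[symmetric] mult.commute)
  qed
  have early: "\<exists>q>1. \<forall>t>0. (\<integral>\<^sup>+s. ennreal ((norm (indicator {0<..t / q} s *\<^sub>R f t s))\<^sup>2) \<partial>lborel)
    \<le> ennreal (\<epsilon> * t)"
    if \<epsilon>: "0 < \<epsilon>" for \<epsilon>
  proof -
    have "((\<lambda>q. K\<^sup>2 * (q powr (2 * r - 1) / (1 - 2 * r))) \<longlongrightarrow> K\<^sup>2 * (0 / (1 - 2 * r))) at_top"
      using r by (intro tendsto_intros tendsto_neg_powr) (auto simp: filterlim_ident)
    hence "\<forall>\<^sub>F q in at_top. K\<^sup>2 * (q powr (2 * r - 1) / (1 - 2 * r)) < \<epsilon>"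
      using \<epsilon> by (intro order_tendstoD(2)) auto
    from eventually_happens'[OF _ eventually_conj[OF this eventually_gt_at_top[of 1]]]
    obtain q where q: "K\<^sup>2 * (q powr (2 * r - 1) / (1 - 2 * r)) < \<epsilon>" "1 < q" by auto
    have "(\<integral>\<^sup>+s. ennreal ((norm (indicator {0<..t / q} s *\<^sub>R f t s))\<^sup>2) \<partial>lborel) \<le> ennreal (\<epsilon> * t)"
      if t: "0 < t" for t
    proof -
      have "t / q \<le> t" using t q by (simp add: divide_le_eq)
      hence "(\<integral>\<^sup>+s. ennreal ((norm (indicator {0<..t / q} s *\<^sub>R f t s))\<^sup>2) \<partial>lborel)
          \<le> ennreal (K\<^sup>2 * (t powr (2 * r) * (t / q) powr (1 - 2 * r) / (1 - 2 * r)))"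
        using t q K r f_bound[of _ t] by (intro nn_integral_power_kernel_bound) (auto simp: indicator_def)
      also have "K\<^sup>2 * (t powr (2 * r) * (t / q) powr (1 - 2 * r) / (1 - 2 * r))
          = t * (K\<^sup>2 * (q powr (2 * r - 1) / (1 - 2 * r)))"
      proof -
        have "q powr (2 * r - 1) = 1 / q powr (1 - 2 * r)" by (simp add: powr_minus_divide[symmetric])
        hence "t powr (2 * r) * (t / q) powr (1 - 2 * r)
          = (t powr (2 * r) * t powr (1 - 2 * r)) * q powr (2 * r - 1)"
          using t q by (simp add: powr_divide)
        also have "\<dots> = t * q powr (2 * r - 1)" by (simp only: powr_self[OF t])
        finally show ?thesis by simp
      qed
      also have "t * (K\<^sup>2 * (q powr (2 * r - 1) / (1 - 2 * r))) \<le> t * \<epsilon>"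
        using t by (intro mult_left_mono less_imp_le[OF q(1)]) simp
      hence "ennreal (t * (K\<^sup>2 * (q powr (2 * r - 1) / (1 - 2 * r)))) \<le> ennreal (\<epsilon> * t)"
        by (intro ennreal_leI) (simp only: mult.commute)
      finally show ?thesis .
    qed
    thus ?thesis using q by blast
  qed
  have inc: "(\<integral>\<^sup>+x. ennreal ((norm (indicator {0<..t} x *\<^sub>R f t x - indicator {0<..s} x *\<^sub>R f s x))\<^sup>2) \<partial>lborel)
      \<le> ennreal (K' * (t - s))" if s: "0 < s" and st: "s \<le> t" and ts: "t \<le> 2 * s" for s t
  proof (cases "s = t")
    case False
    define D where "D = ln (t / s) * K"
    have D0: "0 \<le> D" using s st K by (simp add: D_def)
    have "(\<integral>\<^sup>+x. ennreal ((norm (indicator {0<..t} x *\<^sub>R f t x - indicator {0<..s} x *\<^sub>R f s x))\<^sup>2) \<partial>lborel)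
        \<le> (\<integral>\<^sup>+x. ennreal (D\<^sup>2) * ennreal ((exp (r * ln (t / x)))\<^sup>2 * indicator {0<..t} x)
            + ennreal (4 * K\<^sup>2) * indicator {s<..t} x \<partial>lborel)"
    proof (rule nn_integral_mono)
      fix x
      consider "x \<le> 0 \<or> t < x" | "0 < x" "x \<le> s" | "s < x" "x \<le> t" by linarith
      thus "ennreal ((norm (indicator {0<..t} x *\<^sub>R f t x - indicator {0<..s} x *\<^sub>R f s x))\<^sup>2)
          \<le> ennreal (D\<^sup>2) * ennreal ((exp (r * ln (t / x)))\<^sup>2 * indicator {0<..t} x)
            + ennreal (4 * K\<^sup>2) * indicator {s<..t} x"
      proof cases
        case 1
        thus ?thesis using s st by (auto simp: indicator_def)
      next
        case 2
        have "ln (s / x) < ln (t / x)"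
          using 2 s st False by (subst ln_less_cancel_iff) (auto simp: divide_strict_right_mono)
        hence "norm (f t x - f s x) \<le> (ln (t / x) - ln (s / x)) * (K * exp (r * ln (t / x)))"
          unfolding f_def using 2 by (intro lipschitz) auto
        also have "ln (t / x) - ln (s / x) = ln (t / s)"
          using 2 s st by (simp add: ln_div)
        finally have "norm (f t x - f s x) \<le> D * exp (r * ln (t / x))" by (simp add: D_def mult_ac)
        hence "(norm (f t x - f s x))\<^sup>2 \<le> (D * exp (r * ln (t / x)))\<^sup>2" by (intro power_mono) auto
        hence "ennreal ((norm (f t x - f s x))\<^sup>2) \<le> ennreal (D\<^sup>2 * (exp (r * ln (t / x)))\<^sup>2)"
          by (intro ennreal_leI) (simp add: power_mult_distrib)
        thus ?thesis using 2 st by (simp add: ennreal_mult')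
      next
        case 3
        have "r * ln (t / x) \<le> 1 * ln 2"
          using 3 s st ts r by (intro mult_mono) (auto simp: divide_le_eq)
        hence "exp (r * ln (t / x)) \<le> exp (ln 2)" by (subst exp_le_cancel_iff) simp
        hence "norm (f t x) \<le> K * 2"
          using f_bound[of x t] 3 s K by (auto intro: order_trans[OF _ mult_left_mono])
        hence "(norm (f t x))\<^sup>2 \<le> (K * 2)\<^sup>2" by (intro power_mono) auto
        hence "ennreal ((norm (f t x))\<^sup>2) \<le> ennreal (4 * K\<^sup>2)"
          by (intro ennreal_leI) (simp add: power_mult_distrib)
        thus ?thesis using 3 s by (auto intro: add_increasing)
      qed
    qed
    also have "\<dots> = ennreal (D\<^sup>2) * (\<integral>\<^sup>+x. ennreal ((exp (r * ln (t / x)))\<^sup>2 * indicator {0<..t} x) \<partial>lborel)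
        + ennreal (4 * K\<^sup>2) * (\<integral>\<^sup>+x. indicator {s<..t} x \<partial>lborel)"
      by (subst nn_integral_add) (auto simp: nn_integral_cmult)
    also have "\<dots> = ennreal (D\<^sup>2) * ennreal (t / (1 - 2 * r)) + ennreal (4 * K\<^sup>2) * ennreal (t - s)"
      using s st r by (subst nn_integral_power_kernel) (auto simp: powr_self)
    also have "\<dots> = ennreal (D\<^sup>2 * (t / (1 - 2 * r)) + 4 * K\<^sup>2 * (t - s))"
    proof -
      have "0 \<le> D\<^sup>2 * (t / (1 - 2 * r))" "0 \<le> 4 * K\<^sup>2 * (t - s)" using s st r by auto
      from ennreal_plus[OF this] show ?thesis
        using s st by (subst (1 2) ennreal_mult'[symmetric]) auto
    qed
    also have "\<dots> \<le> ennreal (K' * (t - s))"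
    proof (rule ennreal_leI)
      have "ln (t / s) \<le> t / s - 1" using s st by (intro ln_le_minus_one) auto
      also have "\<dots> = (t - s) / s" using s by (simp add: field_simps)
      finally have "D \<le> (t - s) / s * K" unfolding D_def using K by (intro mult_right_mono) auto
      hence "D\<^sup>2 \<le> ((t - s) / s * K)\<^sup>2" using D0 by (intro power_mono)
      also have "\<dots> = (t - s) * ((t - s) / s * K\<^sup>2) / s" by (simp add: power2_eq_square)
      finally have "D\<^sup>2 * t \<le> ((t - s) * ((t - s) / s * K\<^sup>2) / s) * t" using s st
        by (intro mult_right_mono) auto
      also have "\<dots> = (t - s) * K\<^sup>2 * ((t - s) / s * (t / s))" by simp
      also have "\<dots> \<le> (t - s) * K\<^sup>2 * (1 * 2)"
        using s st ts by (intro mult_left_mono mult_mono) (auto simp: divide_le_eq)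
      finally have "D\<^sup>2 * t \<le> 2 * K\<^sup>2 * (t - s)" by (simp add: mult_ac)
      hence "D\<^sup>2 * t / (1 - 2 * r) \<le> 2 * K\<^sup>2 * (t - s) / (1 - 2 * r)" using r by (intro divide_right_mono) auto
      thus "D\<^sup>2 * (t / (1 - 2 * r)) + 4 * K\<^sup>2 * (t - s) \<le> K' * (t - s)"
        by (simp add: K'_def distrib_right)
    qed
    finally show ?thesis .
  qed simp
  have "0 < K'" using K r by (auto simp: K'_def intro!: add_nonneg_pos)
  from wiener_lil[OF B gauss cont _ full early inc c(2) this] V show ?thesis unfolding f_def by blast
qed

lemma (in prob_space) has_wiener_integral_scaleR:
  fixes B :: "real \<Rightarrow> 'a \<Rightarrow> 'b::euclidean_space"
  assumes B: "standard_brownian_motion M B" and J: "has_wiener_integral M B t f J"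
  shows "has_wiener_integral M B t (\<lambda>s. r *\<^sub>R f s) (\<lambda>\<omega>. r * J \<omega>)"
proof -
  obtain m p c where part: "\<forall>n. 0 \<le> p n 0 \<and> (\<forall>i<m n. p n i < p n (Suc i)) \<and> p n (m n) \<le> t"
    and lim: "(\<lambda>n. \<integral>\<^sup>+s\<in>{0<..t}. ennreal ((norm (f s - step_function (m n) (p n) (c n) s))\<^sup>2) \<partial>lborel) \<longlonglongrightarrow> 0"
      "(\<lambda>n. \<integral>\<^sup>+\<omega>. ennreal ((J \<omega> - step_integral B (m n) (p n) (c n) \<omega>)\<^sup>2) \<partial>M) \<longlonglongrightarrow> 0"
    using J unfolding has_wiener_integral_def by blast
  have f[measurable]: "(\<lambda>s. indicator {0<..t} s *\<^sub>R f s) \<in> borel_measurable lborel"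
    and [measurable]: "J \<in> borel_measurable M"
    using J by (auto simp: has_wiener_integral_def set_borel_measurable_def)
  have [measurable]: "step_function (m n) (p n) (c n) \<in> borel_measurable lborel" for n
    unfolding step_function_eq_interval_sum by simp
  have [measurable]: "step_integral B (m n) (p n) (c n) \<in> borel_measurable M" for n
  proof -
    have "0 \<le> p n i" "p n i \<le> p n (Suc i)" if "i < m n" for i
      using partition_bounds(1)[of "m n" "p n" i] part[rule_format, of n] that by force+
    thus ?thesis unfolding step_integral_eq_increment_sum
      by (intro increment_sum_isometry(1)[OF B]) auto
  qed
  have step: "step_function (m n) (p n) (\<lambda>i. r *\<^sub>R c n i) s = r *\<^sub>R step_function (m n) (p n) (c n) s" for n s
    unfolding step_function_def scaleR_sum_right
    by (intro sum.cong refl) (simp only: scaleR_scaleR mult.commute)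
  have int: "step_integral B (m n) (p n) (\<lambda>i. r *\<^sub>R c n i) \<omega> = r * step_integral B (m n) (p n) (c n) \<omega>" for n \<omega>
    by (simp add: step_integral_def sum_distrib_left)
  have sq: "(norm (r *\<^sub>R x - r *\<^sub>R y))\<^sup>2 = r\<^sup>2 * (norm (x - y))\<^sup>2" for x y :: "'c::real_normed_vector"
    by (simp add: scaleR_diff_right[symmetric] power_mult_distrib)
  have "(\<integral>\<^sup>+s\<in>{0<..t}. ennreal ((norm (r *\<^sub>R f s - step_function (m n) (p n) (\<lambda>i. r *\<^sub>R c n i) s))\<^sup>2) \<partial>lborel)
      = ennreal (r\<^sup>2) * (\<integral>\<^sup>+s\<in>{0<..t}. ennreal ((norm (f s - step_function (m n) (p n) (c n) s))\<^sup>2) \<partial>lborel)" for n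
  proof -
    have eq: "ennreal ((norm (f s - step_function (m n) (p n) (c n) s))\<^sup>2) * indicator {0<..t} s
        = ennreal ((norm (indicator {0<..t} s *\<^sub>R f s - step_function (m n) (p n) (c n) s))\<^sup>2) * indicator {0<..t} s" for s
      by (simp add: indicator_def)
    have meas: "(\<lambda>s. ennreal ((norm (f s - step_function (m n) (p n) (c n) s))\<^sup>2) * indicator {0<..t} s) \<in> borel_measurable lborel"
      unfolding eq by measurable
    show ?thesis
      unfolding step sq by (subst nn_integral_cmult[OF meas, symmetric]) (simp add: ennreal_mult' mult.assoc)
  qed
  hence "(\<lambda>n. \<integral>\<^sup>+s\<in>{0<..t}. ennreal ((norm (r *\<^sub>R f s - step_function (m n) (p n) (\<lambda>i. r *\<^sub>R c n i) s))\<^sup>2) \<partial>lborel) \<longlonglongrightarrow> 0"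
    using ennreal_tendsto_cmult[OF _ lim(1), of "ennreal (r\<^sup>2)"] by simp
  moreover have "(\<integral>\<^sup>+\<omega>. ennreal ((r * J \<omega> - step_integral B (m n) (p n) (\<lambda>i. r *\<^sub>R c n i) \<omega>)\<^sup>2) \<partial>M)
      = ennreal (r\<^sup>2) * (\<integral>\<^sup>+\<omega>. ennreal ((J \<omega> - step_integral B (m n) (p n) (c n) \<omega>)\<^sup>2) \<partial>M)" for n
    unfolding int right_diff_distrib[symmetric] power_mult_distrib
    by (subst nn_integral_cmult[symmetric]) (simp_all add: ennreal_mult')
  hence "(\<lambda>n. \<integral>\<^sup>+\<omega>. ennreal ((r * J \<omega> - step_integral B (m n) (p n) (\<lambda>i. r *\<^sub>R c n i) \<omega>)\<^sup>2) \<partial>M) \<longlonglongrightarrow> 0"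
    using ennreal_tendsto_cmult[OF _ lim(2), of "ennreal (r\<^sup>2)"] by simp
  moreover have "set_borel_measurable lborel {0<..t} (\<lambda>s. r *\<^sub>R f s)"
  proof -
    have "(\<lambda>s. r *\<^sub>R (indicator {0<..t} s *\<^sub>R f s)) \<in> borel_measurable lborel" by measurable
    thus ?thesis by (simp add: set_borel_measurable_def mult.commute)
  qed
  moreover have "(\<lambda>\<omega>. r * J \<omega>) \<in> borel_measurable M" by measurable
  ultimately show ?thesis
    unfolding has_wiener_integral_def using part
    by (intro conjI exI[of _ m] exI[of _ p] exI[of _ "\<lambda>n i. r *\<^sub>R c n i"]) auto
qed

lemma has_wiener_integral_cong_AE:
  assumes J: "has_wiener_integral M B t f J" and J': "J' \<in> borel_measurable M" "AE \<omega> in M. J' \<omega> = J \<omega>"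
  shows "has_wiener_integral M B t f J'"
proof -
  have "(\<integral>\<^sup>+\<omega>. ennreal ((J' \<omega> - X \<omega>)\<^sup>2) \<partial>M) = (\<integral>\<^sup>+\<omega>. ennreal ((J \<omega> - X \<omega>)\<^sup>2) \<partial>M)" for X
    using J'(2) by (intro nn_integral_cong_AE) (auto elim!: eventually_mono)
  with J J'(1) show ?thesis by (simp add: has_wiener_integral_def)
qed

text \<open>
  The class of processes in \<open>self_similar_lil\<close> is closed under \<open>V \<mapsto> - V\<close>, with
  the kernel \<open>- h\<close>.
\<close>

lemma (in prob_space) self_similar_lil_signs:
  fixes B :: "real \<Rightarrow> 'a \<Rightarrow> 'b::euclidean_space" and h h' :: "real \<Rightarrow> 'b"
  assumes B: "standard_brownian_motion M B"
    and gauss: "centered_gaussian_process M {0..} V"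
    and cont: "AE \<omega> in M. continuous_on {0..} (\<lambda>t. V t \<omega>)"
    and V: "\<And>t. 0 < t \<Longrightarrow> has_wiener_integral M B t (\<lambda>s. h (ln (t / s))) (V t)"
    and deriv: "\<And>y. 0 \<le> y \<Longrightarrow> (h has_vector_derivative h' y) (at y)"
    and h: "\<And>y. 0 \<le> y \<Longrightarrow> norm (h y) \<le> K * exp (r * y)"
    and h': "\<And>y. 0 \<le> y \<Longrightarrow> norm (h' y) \<le> K * exp (r * y)"
    and K: "0 < K" and r: "0 \<le> r" "r < 1/2"
    and c: "((\<lambda>u. (norm (h (- ln u)))\<^sup>2) has_integral c) {0..1}" "0 < c"
    and \<sigma>: "\<sigma> \<in> {1, -1}"
  shows "AE \<omega> in M. Limsup at_top (\<lambda>t. ereal (\<sigma> * (V t \<omega> / sqrt (2 * t * ln (ln t))))) = ereal (sqrt c)"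
proof -
  have [simp]: "\<bar>\<sigma>\<bar> = 1" using \<sigma> by auto
  have gauss': "centered_gaussian_process M {0..} (\<lambda>t \<omega>. \<sigma> * V t \<omega>)"
    unfolding centered_gaussian_process_def
  proof (intro allI impI)
    fix J :: "real set" and a :: "real \<Rightarrow> real" assume "finite J \<and> J \<subseteq> {0..}"
    from gauss[unfolded centered_gaussian_process_def, rule_format, OF this, of "\<lambda>t. a t * \<sigma>"]
    have "centered_gaussian_rv M (\<lambda>\<omega>. \<Sum>t\<in>J. (a t * \<sigma>) * V t \<omega>)" .
    thus "centered_gaussian_rv M (\<lambda>\<omega>. \<Sum>t\<in>J. a t * (\<sigma> * V t \<omega>))" by (simp only: mult.assoc)
  qed
  have cont': "AE \<omega> in M. continuous_on {0..} (\<lambda>t. \<sigma> * V t \<omega>)"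
    using cont by eventually_elim (intro continuous_intros)
  have "AE \<omega> in M. Limsup at_top (\<lambda>t. ereal (\<sigma> * V t \<omega> / sqrt (2 * t * ln (ln t)))) = ereal (sqrt c)"
  proof (rule self_similar_lil[OF B gauss' cont', where h="\<lambda>y. \<sigma> *\<^sub>R h y" and h'="\<lambda>y. \<sigma> *\<^sub>R h' y"])
    show "has_wiener_integral M B t (\<lambda>s. \<sigma> *\<^sub>R h (ln (t / s))) (\<lambda>\<omega>. \<sigma> * V t \<omega>)" if "0 < t" for t
      by (rule has_wiener_integral_scaleR[OF B V[OF that]])
    show "((\<lambda>y. \<sigma> *\<^sub>R h y) has_vector_derivative \<sigma> *\<^sub>R h' y) (at y)" if "0 \<le> y" for y
      using has_vector_derivative_scaleR[OF DERIV_const deriv[OF that], of \<sigma>] by simp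
  qed (use h h' K r c in simp_all)
  thus ?thesis by simp
qed

lemma has_wiener_integral_cong:
  assumes "\<And>s. s \<in> {0<..t} \<Longrightarrow> f s = g s"
  shows "has_wiener_integral M B t f J \<longleftrightarrow> has_wiener_integral M B t g J"
proof -
  have 1: "indicator {0<..t} s *\<^sub>R f s = indicator {0<..t} s *\<^sub>R g s" for s
    using assms[of s] by (cases "s \<in> {0<..t}") simp_all
  have 2: "ennreal ((norm (f s - x))\<^sup>2) * indicator {0<..t} s
    = ennreal ((norm (g s - x))\<^sup>2) * indicator {0<..t} s" for s x
    using assms[of s] by (cases "s \<in> {0<..t}") simp_all
  show ?thesis unfolding has_wiener_integral_def set_borel_measurable_def 1 2 ..
qed

section \<open>The matrix kernel\<close>

text \<open>
  The functions \<open>cosh (m y)\<close> and \<open>sinh (m y) / m\<close> with \<open>m\<^sup>2 = \<mu>\<close>, read as \<open>cos\<close> and \<open>sin\<close> for \<open>\<mu> < 0\<close> and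
  as \<open>1\<close> and \<open>y\<close> for \<open>\<mu> = 0\<close>.  They are of order \<open>exp (\<surd>\<mu> y)\<close> for \<open>\<mu> > 0\<close>, and this is
  where \<open>\<mu> < 1/4\<close> gives a rate \<open>r < 1/2\<close>; in the other cases they are bounded or grow linearly.
\<close>

lemma exponential_pair:
  fixes \<mu> :: real
  assumes \<mu>: "\<mu> < 1/4"
  obtains C S :: "real \<Rightarrow> real" and r K :: real where
    "\<And>y. (\<lambda>k. if even k then y ^ k * \<mu> ^ (k div 2) / fact k else 0) sums C y"
    "\<And>y. (\<lambda>k. if even k then 0 else y ^ k * \<mu> ^ (k div 2) / fact k) sums S y"
    "\<And>y. (C has_real_derivative \<mu> * S y) (at y)" "\<And>y. (S has_real_derivative C y) (at y)"
    "C 0 = 1" "S 0 = 0"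
    "0 \<le> r" "r < 1/2" "0 < K"
    "\<And>y. 0 \<le> y \<Longrightarrow> \<bar>C y\<bar> \<le> K * exp (r * y)" "\<And>y. 0 \<le> y \<Longrightarrow> \<bar>S y\<bar> \<le> K * exp (r * y)"
proof (cases \<mu> "0::real" rule: linorder_cases)
  case greater
  define m where "m = sqrt \<mu>"
  have m: "0 < m" "m * m = \<mu>" using greater by (auto simp: m_def)
  have "m < sqrt ((1/2)\<^sup>2)" unfolding m_def using \<mu> by (intro real_sqrt_less_mono) (simp add: power2_eq_square)
  hence m2: "m < 1/2" by simp
  have pow: "m ^ (2 * j) = \<mu> ^ j" "m ^ (j * 2) = \<mu> ^ j" for j
    using m power_mult[of m 2 j] by (simp_all add: power2_eq_square mult.commute[of j])
  show ?thesis
  proof (rule that[of "\<lambda>y. cosh (m * y)" "\<lambda>y. sinh (m * y) / m" m "1 + 1 / m"])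
    fix y :: real
    have "(\<lambda>k. if even k then (m * y) ^ k /\<^sub>R fact k else 0) sums cosh (m * y)"
      by (rule cosh_converges)
    also have "(\<lambda>k. if even k then (m * y) ^ k /\<^sub>R fact k else 0)
      = (\<lambda>k. if even k then y ^ k * \<mu> ^ (k div 2) / fact k else 0)"
      by (auto elim!: evenE simp: fun_eq_iff power_mult_distrib pow divide_inverse mult_ac)
    finally show "(\<lambda>k. if even k then y ^ k * \<mu> ^ (k div 2) / fact k else 0) sums cosh (m * y)" .
    have "(\<lambda>k. (if even k then 0 else (m * y) ^ k /\<^sub>R fact k) / m) sums (sinh (m * y) / m)"
      by (intro sums_divide sinh_converges)
    also have "(\<lambda>k. (if even k then 0 else (m * y) ^ k /\<^sub>R fact k) / m)
      = (\<lambda>k. if even k then 0 else y ^ k * \<mu> ^ (k div 2) / fact k)"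
      using m by (auto elim!: oddE simp: fun_eq_iff power_mult_distrib power_add pow divide_inverse mult_ac simp del: fact_Suc)
    finally show "(\<lambda>k. if even k then 0 else y ^ k * \<mu> ^ (k div 2) / fact k) sums (sinh (m * y) / m)" .
    show "((\<lambda>y. cosh (m * y)) has_real_derivative \<mu> * (sinh (m * y) / m)) (at y)"
      using m by (auto intro!: derivative_eq_intros simp: m(2)[symmetric])
    show "((\<lambda>y. sinh (m * y) / m) has_real_derivative cosh (m * y)) (at y)"
      using m by (auto intro!: derivative_eq_intros)
    assume y: "0 \<le> y"
    have "exp (- (m * y)) \<le> exp (m * y)" using y m by simp
    moreover have "- exp (- (m * y)) \<le> exp (m * y)" by (rule order_trans[of _ 0]) auto
    ultimately have abs_le: "\<bar>cosh (m * y)\<bar> \<le> exp (m * y)" "\<bar>sinh (m * y)\<bar> \<le> exp (m * y)"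
      by (auto simp: cosh_field_def sinh_field_def abs_le_iff add_nonneg_nonneg)
    have "\<bar>sinh (m * y) / m\<bar> \<le> 1 / m * exp (m * y)"
      using abs_le(2) m by (simp add: abs_divide divide_right_mono)
    moreover have "0 < 1 / m * exp (m * y)" "0 < exp (m * y)" using m by auto
    ultimately show "\<bar>cosh (m * y)\<bar> \<le> (1 + 1 / m) * exp (m * y)" "\<bar>sinh (m * y) / m\<bar>
      \<le> (1 + 1 / m) * exp (m * y)"
      unfolding distrib_right using abs_le(1) by linarith+
  qed (use m m2 in \<open>auto intro: add_pos_pos\<close>)
next
  case less
  define m where "m = sqrt (- \<mu>)"
  have m: "0 < m" "m * m = - \<mu>" using less by (auto simp: m_def)
  have pow: "m ^ (2 * j) * (-1) ^ j = \<mu> ^ j" for j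
    using m by (simp add: power_mult power2_eq_square power_mult_distrib[symmetric])
  show ?thesis
  proof (rule that[of "\<lambda>y. cos (m * y)" "\<lambda>y. sin (m * y) / m" 0 "1 + 1 / m"])
    fix y :: real
    have "(\<lambda>k. cos_coeff k *\<^sub>R (m * y) ^ k) sums cos (m * y)"
      by (rule cos_converges)
    also have "(\<lambda>k. cos_coeff k *\<^sub>R (m * y) ^ k) = (\<lambda>k. if even k then y ^ k * \<mu> ^ (k div 2) / fact k else 0)"
      by (auto elim!: evenE simp: fun_eq_iff cos_coeff_def power_mult_distrib pow[symmetric])
    finally show "(\<lambda>k. if even k then y ^ k * \<mu> ^ (k div 2) / fact k else 0) sums cos (m * y)" .
    have "(\<lambda>k. (sin_coeff k *\<^sub>R (m * y) ^ k) / m) sums (sin (m * y) / m)"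
      by (intro sums_divide sin_converges)
    also have "(\<lambda>k. (sin_coeff k *\<^sub>R (m * y) ^ k) / m)
      = (\<lambda>k. if even k then 0 else y ^ k * \<mu> ^ (k div 2) / fact k)"
      using m by (auto elim!: oddE simp: fun_eq_iff sin_coeff_def power_mult_distrib power_add pow[symmetric] simp del: fact_Suc)
    finally show "(\<lambda>k. if even k then 0 else y ^ k * \<mu> ^ (k div 2) / fact k) sums (sin (m * y) / m)" .
    have "\<mu> * (sin (m * y) / m) = - (m * m) * (sin (m * y) / m)" using m(2) by simp
    also have "\<dots> = - sin (m * y) * m" using m(1) by simp
    finally show "((\<lambda>y. cos (m * y)) has_real_derivative \<mu> * (sin (m * y) / m)) (at y)"
      by (auto intro!: derivative_eq_intros)
    show "((\<lambda>y. sin (m * y) / m) has_real_derivative cos (m * y)) (at y)"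
      using m(1) by (auto intro!: derivative_eq_intros)
    have "\<bar>sin (m * y)\<bar> / m \<le> 1 / m" using m by (intro divide_right_mono) auto
    moreover have "0 < 1 / m" using m by simp
    ultimately have "\<bar>cos (m * y)\<bar> \<le> 1 + 1 / m" "\<bar>sin (m * y)\<bar> / m \<le> 1 + 1 / m"
      using abs_cos_le_one[of "m * y"] by linarith+
    thus "\<bar>cos (m * y)\<bar> \<le> (1 + 1 / m) * exp (0 * y)" "\<bar>sin (m * y) / m\<bar> \<le> (1 + 1 / m) * exp (0 * y)"
      using m(1) by (simp_all add: abs_divide)
  qed (use m in \<open>auto intro: add_pos_pos\<close>)
next
  case equal
  show ?thesis
  proof (rule that[of "\<lambda>y. 1" "\<lambda>y. y" "1/4" 4])
    fix y :: real
    have "(\<lambda>k. if even k then y ^ k * \<mu> ^ (k div 2) / fact k else 0) = (\<lambda>k. if k = 0 then 1 else 0)"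
      using equal by (auto simp: fun_eq_iff power_0_left elim!: evenE)
    thus "(\<lambda>k. if even k then y ^ k * \<mu> ^ (k div 2) / fact k else 0) sums 1"
      using sums_single[of 0 "\<lambda>_. 1::real"] by simp
    have "(\<lambda>k. if even k then 0 else y ^ k * \<mu> ^ (k div 2) / fact k) = (\<lambda>k. if k = 1 then y else 0)"
      using equal by (auto simp: fun_eq_iff power_0_left elim!: oddE)
    thus "(\<lambda>k. if even k then 0 else y ^ k * \<mu> ^ (k div 2) / fact k) sums y"
      using sums_single[of 1 "\<lambda>_. y"] by simp
    assume y: "0 \<le> y"
    have "1 + 1/4 * y \<le> exp (1/4 * y)" by (rule exp_ge_add_one_self)
    thus "\<bar>1\<bar> \<le> 4 * exp (1/4 * y)" "\<bar>y\<bar> \<le> 4 * exp (1/4 * y)" using y by linarith+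
  qed (use equal in auto)
qed

text \<open>
  As \<open>A\<^sup>2 = \<mu> I\<close>, the even powers of \<open>A\<close> are multiples of \<open>I\<close> and the odd ones multiples of \<open>A\<close>.
\<close>

lemma matrix_exp_A_matrix:
  assumes C: "(\<lambda>k. if even k then y ^ k * (\<alpha>\<^sub>1 * \<alpha>\<^sub>2) ^ (k div 2) / fact k else 0) sums C"
    and S: "(\<lambda>k. if even k then 0 else y ^ k * (\<alpha>\<^sub>1 * \<alpha>\<^sub>2) ^ (k div 2) / fact k) sums S"
  shows "matrix_exp (y *\<^sub>R A_matrix \<alpha>\<^sub>1 \<alpha>\<^sub>2) = C *\<^sub>R mat 1 + S *\<^sub>R A_matrix \<alpha>\<^sub>1 \<alpha>\<^sub>2"
proof -
  define A where "A = A_matrix \<alpha>\<^sub>1 \<alpha>\<^sub>2"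
  define \<mu> where "\<mu> = \<alpha>\<^sub>1 * \<alpha>\<^sub>2"
  have A1: "(y *\<^sub>R A) ** (x *\<^sub>R mat 1) = (x * y) *\<^sub>R A" for x
    by (simp add: vec_eq_iff forall_2 matrix_matrix_mult_def sum_2 mat_def A_def A_matrix_def)
  have A2: "(y *\<^sub>R A) ** (x *\<^sub>R A) = (x * y * \<mu>) *\<^sub>R mat 1" for x
    by (simp add: vec_eq_iff forall_2 matrix_matrix_mult_def sum_2 mat_def A_def A_matrix_def \<mu>_def)
  have powers: "((**) (y *\<^sub>R A) ^^ k) (mat 1)
      = (if even k then (y ^ k * \<mu> ^ (k div 2)) *\<^sub>R mat 1 else (y ^ k * \<mu> ^ (k div 2)) *\<^sub>R A)" for k
  proof (induction k)
    case (Suc k)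
    show ?case
    proof (cases "even k")
      case True
      thus ?thesis by (simp add: Suc.IH A1 mult_ac)
    next
      case False
      hence "Suc k div 2 = Suc (k div 2)" by simp
      with False show ?thesis by (simp add: Suc.IH A2 mult_ac)
    qed
  qed simp
  have "(\<lambda>k. (if even k then y ^ k * \<mu> ^ (k div 2) / fact k else 0) *\<^sub>R mat 1
      + (if even k then 0 else y ^ k * \<mu> ^ (k div 2) / fact k) *\<^sub>R A) sums (C *\<^sub>R mat 1 + S *\<^sub>R A)"
    using C S unfolding \<mu>_def by (intro sums_add sums_scaleR_left)
  also have "(\<lambda>k. (if even k then y ^ k * \<mu> ^ (k div 2) / fact k else 0) *\<^sub>R mat 1
      + (if even k then 0 else y ^ k * \<mu> ^ (k div 2) / fact k) *\<^sub>R A)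
      = (\<lambda>k. (1 / fact k) *\<^sub>R ((**) (y *\<^sub>R A) ^^ k) (mat 1))"
    unfolding powers by (auto simp: fun_eq_iff)
  finally show ?thesis unfolding matrix_exp_def A_def by (rule sums_unique[symmetric])
qed

lemma e_vector_kernel:
  "e_vector v* (C *\<^sub>R mat 1 + S *\<^sub>R A_matrix \<alpha>\<^sub>1 \<alpha>\<^sub>2) = C *\<^sub>R e_vector + S *\<^sub>R vector [- \<alpha>\<^sub>2, \<alpha>\<^sub>1]"
  by (simp add: vec_eq_iff forall_2 vector_matrix_mult_def sum_2 mat_def A_matrix_def e_vector_def)

lemma norm_kernel_square:
  "(norm (C *\<^sub>R e_vector + S *\<^sub>R vector [- \<alpha>\<^sub>2, \<alpha>\<^sub>1] :: real^2))\<^sup>2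
    = 2 * C\<^sup>2 - 2 * (\<alpha>\<^sub>1 + \<alpha>\<^sub>2) * (C * S) + (\<alpha>\<^sub>1\<^sup>2 + \<alpha>\<^sub>2\<^sup>2) * S\<^sup>2"
  unfolding power2_norm_eq_inner
  by (simp add: inner_vec_def sum_2 e_vector_def power2_eq_square algebra_simps)

text \<open>
  With \<open>s = \<alpha>\<^sub>1 + \<alpha>\<^sub>2\<close> and \<open>d = \<alpha>\<^sub>1 - \<alpha>\<^sub>2\<close>, the inequality \<open>d\<^sup>2 \<le> s - 1\<close> would
  give \<open>4 \<alpha>\<^sub>1 \<alpha>\<^sub>2 = s\<^sup>2 - d\<^sup>2 \<ge> s\<^sup>2 - s + 1 \<ge> 1\<close>.
\<close>

lemma limit_variance_positive:
  fixes \<alpha>\<^sub>1 \<alpha>\<^sub>2 :: real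
  assumes "\<alpha>\<^sub>1 * \<alpha>\<^sub>2 < 1/4"
  shows "0 < 2 * (1 - \<alpha>\<^sub>1 - \<alpha>\<^sub>2 + (\<alpha>\<^sub>1 - \<alpha>\<^sub>2)\<^sup>2) / (1 - 4 * \<alpha>\<^sub>1 * \<alpha>\<^sub>2)"
proof -
  define s d where "s = \<alpha>\<^sub>1 + \<alpha>\<^sub>2" and "d = \<alpha>\<^sub>1 - \<alpha>\<^sub>2"
  have \<mu>: "s\<^sup>2 - d\<^sup>2 < 1" using assms by (simp add: s_def d_def power2_eq_square algebra_simps)
  have "0 < 1 - s + d\<^sup>2"
  proof (rule ccontr)
    assume "\<not> ?thesis"
    hence le: "d\<^sup>2 \<le> s - 1" by simp
    hence "1 \<le> s" using zero_le_power2[of d] by linarith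
    hence "0 \<le> s * (s - 1)" by simp
    hence "s \<le> s\<^sup>2" by (simp add: power2_eq_square algebra_simps)
    with le \<mu> show False by linarith
  qed
  thus ?thesis using assms by (simp add: s_def d_def algebra_simps)
qed

text \<open>
  In the variable \<open>y = - ln u\<close> the product rule gives \<open>(u Q (- ln u))' = Q y - Q' y\<close>, so
  the antiderivative is \<open>u Q (- ln u)\<close> where \<open>Q = a C\<^sup>2 + b C S + d S\<^sup>2\<close> and \<open>Q - Q'\<close> is the integrand.
  Comparing coefficients gives three linear equations for \<open>a, b, d\<close>, and \<open>Q 0 = a\<close> is the integral.
  The boundary term at \<open>u = 0\<close> vanishes because \<open>Q y\<close> is of order \<open>exp (2 r y) = u powr (- 2 r)\<close>.
\<close>

lemma kernel_energy:
  fixes \<alpha>\<^sub>1 \<alpha>\<^sub>2 :: real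
  assumes \<mu>: "\<alpha>\<^sub>1 * \<alpha>\<^sub>2 < 1/4"
    and C': "\<And>y. (C has_real_derivative \<alpha>\<^sub>1 * \<alpha>\<^sub>2 * S y) (at y)"
      and S': "\<And>y. (S has_real_derivative C y) (at y)"
    and init: "C 0 = 1" "S 0 = 0"
    and r: "0 \<le> r" "r < 1/2" and K: "0 < K"
    and C: "\<And>y. 0 \<le> y \<Longrightarrow> \<bar>C y\<bar> \<le> K * exp (r * y)" and S: "\<And>y. 0 \<le> y \<Longrightarrow> \<bar>S y\<bar> \<le> K * exp (r * y)"
  shows "((\<lambda>u. 2 * (C (- ln u))\<^sup>2 - 2 * (\<alpha>\<^sub>1 + \<alpha>\<^sub>2) * (C (- ln u) * S (- ln u)) + (\<alpha>\<^sub>1\<^sup>2 + \<alpha>\<^sub>2\<^sup>2) * (S (- ln u))\<^sup>2)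
    has_integral 2 * (1 - \<alpha>\<^sub>1 - \<alpha>\<^sub>2 + (\<alpha>\<^sub>1 - \<alpha>\<^sub>2)\<^sup>2) / (1 - 4 * \<alpha>\<^sub>1 * \<alpha>\<^sub>2)) {0..1}"
proof -
  define \<mu> s p where "\<mu> = \<alpha>\<^sub>1 * \<alpha>\<^sub>2" and "s = \<alpha>\<^sub>1 + \<alpha>\<^sub>2" and "p = \<alpha>\<^sub>1\<^sup>2 + \<alpha>\<^sub>2\<^sup>2"
  define a where "a = 2 * (1 - \<alpha>\<^sub>1 - \<alpha>\<^sub>2 + (\<alpha>\<^sub>1 - \<alpha>\<^sub>2)\<^sup>2) / (1 - 4 * \<alpha>\<^sub>1 * \<alpha>\<^sub>2)"
  define b where "b = a - 2"
  define d where "d = p + \<mu> * b"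
  have "a * (1 - 4 * \<mu>) = 2 * (1 - \<alpha>\<^sub>1 - \<alpha>\<^sub>2 + (\<alpha>\<^sub>1 - \<alpha>\<^sub>2)\<^sup>2)"
    using \<mu> by (simp add: a_def \<mu>_def mult.assoc)
  also have "\<dots> = 2 + 2 * p - 4 * \<mu> - 2 * s"
    by (simp add: \<mu>_def p_def s_def power2_eq_square algebra_simps)
  finally have a: "a * (1 - 4 * \<mu>) = 2 + 2 * p - 4 * \<mu> - 2 * s" .
  have eqs: "a - b = 2" "b - 2 * \<mu> * a - 2 * d = - 2 * s" "d - b * \<mu> = p"
    using a by (simp_all add: d_def b_def algebra_simps)
  define Q where "Q y = a * (C y)\<^sup>2 + b * (C y * S y) + d * (S y)\<^sup>2" for y
  define G where "G u = u * Q (- ln u)" for u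
  have Q': "(Q has_real_derivative (a * (2 * C y * (\<mu> * S y)) + b * (\<mu> * S y * S y + C y * C y) + d * (2 * S y * C y))) (at y)" for y
    unfolding Q_def \<mu>_def
    by (auto intro!: derivative_eq_intros C' S' simp: algebra_simps)
  have G': "(G has_real_derivative 2 * (C (- ln u))\<^sup>2 - 2 * s * (C (- ln u) * S (- ln u)) + p * (S (- ln u))\<^sup>2) (at u)"
    if u: "0 < u" for u
  proof -
    define y where "y = - ln u"
    define D where "D = a * (2 * C y * (\<mu> * S y)) + b * (\<mu> * S y * S y + C y * C y) + d * (2 * S y * C y)"
    have ln': "((\<lambda>u. - ln u) has_real_derivative - (1 / u)) (at u)"
      using u by (auto intro!: derivative_eq_intros)
    have "((\<lambda>u. Q (- ln u)) has_real_derivative D * - (1 / u)) (at u)"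
      using DERIV_chain2[OF Q'[of "- ln u"] ln'] unfolding D_def y_def .
    hence "(G has_real_derivative u * (D * - (1 / u)) + 1 * Q y) (at u)"
      unfolding G_def[abs_def] y_def by (intro DERIV_mult' DERIV_ident)
    also have "u * (D * - (1 / u)) + 1 * Q y = Q y - D" using u by simp
    also have "\<dots> = (a - b) * (C y)\<^sup>2 + (b - 2 * \<mu> * a - 2 * d) * (C y * S y) + (d - b * \<mu>) * (S y)\<^sup>2"
      by (simp add: Q_def D_def power2_eq_square algebra_simps)
    finally show ?thesis unfolding eqs y_def by simp
  qed
  have "continuous_on {0..1} G"
    unfolding continuous_on_eq_continuous_within
  proof
    fix u :: real assume u: "u \<in> {0..1}"
    show "continuous (at u within {0..1}) G"
    proof (cases "u = 0")
      case False
      thus ?thesis using G'[of u] u DERIV_isCont continuous_at_imp_continuous_at_within by fastforce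
    next
      case True
      define L where "L = (\<bar>a\<bar> + \<bar>b\<bar> + \<bar>d\<bar>) * K\<^sup>2"
      have "(G \<longlongrightarrow> 0) (at 0 within {0..1})"
      proof (rule Lim_null_comparison)
        show "\<forall>\<^sub>F u in at 0 within {0..1}. norm (G u) \<le> L * u powr (1 - 2 * r)"
          unfolding eventually_at_filter
        proof (intro always_eventually allI impI)
          fix u :: real assume "u \<noteq> 0" "u \<in> {0..1}"
          hence u: "0 < u" "u \<le> 1" by auto
          define y where "y = - ln u"
          have y: "0 \<le> y" using u by (simp add: y_def)
          define E where "E = K * exp (r * y)"
          have E: "0 \<le> E" using K by (simp add: E_def)
          have prod_le: "\<bar>x * z\<bar> \<le> E * E" if "\<bar>x\<bar> \<le> E" "\<bar>z\<bar> \<le> E" for x z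
            using that E unfolding abs_mult by (intro mult_mono) auto
          note CS = C[OF y, folded E_def] S[OF y, folded E_def]
          have "\<bar>Q y\<bar> \<le> \<bar>a\<bar> * \<bar>C y * C y\<bar> + \<bar>b\<bar> * \<bar>C y * S y\<bar> + \<bar>d\<bar> * \<bar>S y * S y\<bar>"
            unfolding Q_def power2_eq_square abs_mult[symmetric] by linarith
          also have "\<dots> \<le> \<bar>a\<bar> * (E * E) + \<bar>b\<bar> * (E * E) + \<bar>d\<bar> * (E * E)"
            by (intro add_mono mult_left_mono prod_le CS) auto
          also have "\<dots> = L * exp (2 * r * y)"
            by (simp add: L_def E_def power2_eq_square algebra_simps exp_add[symmetric])
          also have "exp (2 * r * y) = u powr (- 2 * r)"
            using u by (simp add: powr_def y_def)
          finally have "u * \<bar>Q y\<bar> \<le> u * (L * u powr (- 2 * r))"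
            using u by (intro mult_left_mono) auto
          also have "\<dots> = L * (u * u powr (- 2 * r))" by (simp only: mult.left_commute)
          also have "u * u powr (- 2 * r) = u powr (1 - 2 * r)" using u by (simp add: powr_mult_base)
          finally show "norm (G u) \<le> L * u powr (1 - 2 * r)"
            using u by (simp add: G_def y_def abs_mult)
        qed
        have "((\<lambda>u::real. u powr (1 - 2 * r)) \<longlongrightarrow> 0) (at 0 within {0..1})"
          using r by (intro tendsto_zero_powrI tendsto_ident_at tendsto_const) (auto simp: eventually_at_filter)
        thus "((\<lambda>u. L * u powr (1 - 2 * r)) \<longlongrightarrow> 0) (at 0 within {0..1})"
          by (rule tendsto_mult_right_zero)
      qed
      thus ?thesis using True by (simp add: continuous_within G_def)
    qed
  qed
  hence "((\<lambda>u. 2 * (C (- ln u))\<^sup>2 - 2 * s * (C (- ln u) * S (- ln u)) + p * (S (- ln u))\<^sup>2) has_integral G 1 - G 0) {0..1}"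
    using G' by (intro fundamental_theorem_of_calculus_interior)
      (auto simp: has_real_derivative_iff_has_vector_derivative[symmetric])
  moreover have "G 1 - G 0 = a" using init by (simp add: G_def Q_def)
  ultimately show ?thesis by (simp only: a_def s_def p_def)
qed

theorem proposition5p5:
  fixes M :: "'a measure" and \<alpha>\<^sub>1 \<alpha>\<^sub>2 :: real and V :: "real \<Rightarrow> 'a \<Rightarrow> real"
  assumes "prob_space M"
    and "\<alpha>\<^sub>1 \<in> {-1..1}" and "\<alpha>\<^sub>2 \<in> {-1..1}"
    and "\<alpha>\<^sub>1 * \<alpha>\<^sub>2 < 1/4 \<or> (\<alpha>\<^sub>1 = \<alpha>\<^sub>2 \<and> 1/2 \<le> \<alpha>\<^sub>1 \<and> \<alpha>\<^sub>1 < 1)"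
    and "limit_process M \<alpha>\<^sub>1 \<alpha>\<^sub>2 V"
  shows "\<forall>\<sigma>\<in>{1, -1 :: real}. AE \<omega> in M.
    Limsup at_top (\<lambda>t :: real. ereal (\<sigma> * (V t \<omega> / sqrt (2 * t * ln (ln t))))) =
      ereal (if \<alpha>\<^sub>1 * \<alpha>\<^sub>2 < 1/4
             then sqrt (2 * (1 - \<alpha>\<^sub>1 - \<alpha>\<^sub>2 + (\<alpha>\<^sub>1 - \<alpha>\<^sub>2)\<^sup>2) / (1 - 4 * \<alpha>\<^sub>1 * \<alpha>\<^sub>2))
             else sqrt (2 / (1 + 2 * \<alpha>\<^sub>1)))"
proof
  fix \<sigma> :: real assume \<sigma>: "\<sigma> \<in> {1, -1}"
  interpret prob_space M by fact
  have gauss: "centered_gaussian_process M {0..} V"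
    and cont: "AE \<omega> in M. continuous_on {0..} (\<lambda>t. V t \<omega>)"
    using assms(5) by (simp_all add: limit_process_def)
  show "AE \<omega> in M.
    Limsup at_top (\<lambda>t :: real. ereal (\<sigma> * (V t \<omega> / sqrt (2 * t * ln (ln t))))) =
      ereal (if \<alpha>\<^sub>1 * \<alpha>\<^sub>2 < 1/4
             then sqrt (2 * (1 - \<alpha>\<^sub>1 - \<alpha>\<^sub>2 + (\<alpha>\<^sub>1 - \<alpha>\<^sub>2)\<^sup>2) / (1 - 4 * \<alpha>\<^sub>1 * \<alpha>\<^sub>2))
             else sqrt (2 / (1 + 2 * \<alpha>\<^sub>1)))"
  proof (cases "\<alpha>\<^sub>1 * \<alpha>\<^sub>2 < 1/4")
    case True
    have "\<exists>B :: real \<Rightarrow> 'a \<Rightarrow> real^2. standard_brownian_motion M B \<and>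
        (\<forall>t>0. has_wiener_integral M B t (\<lambda>s. e_vector v* matrix_powr (t / s) (A_matrix \<alpha>\<^sub>1 \<alpha>\<^sub>2)) (V t))"
      using assms(5) True unfolding limit_process_def by blast
    then obtain B :: "real \<Rightarrow> 'a \<Rightarrow> real^2" where B: "standard_brownian_motion M B"
      and V: "\<forall>t>0. has_wiener_integral M B t (\<lambda>s. e_vector v* matrix_powr (t / s) (A_matrix \<alpha>\<^sub>1 \<alpha>\<^sub>2)) (V t)"
        by (elim exE conjE)
    show ?thesis
    proof (rule exponential_pair[OF True])
      fix C S :: "real \<Rightarrow> real" and r K
      assume series: "\<And>y. (\<lambda>k. if even k then y ^ k * (\<alpha>\<^sub>1 * \<alpha>\<^sub>2) ^ (k div 2) / fact k else 0) sums C y"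
        "\<And>y. (\<lambda>k. if even k then 0 else y ^ k * (\<alpha>\<^sub>1 * \<alpha>\<^sub>2) ^ (k div 2) / fact k) sums S y"
      and deriv: "\<And>y. (C has_real_derivative \<alpha>\<^sub>1 * \<alpha>\<^sub>2 * S y) (at y)" "\<And>y. (S has_real_derivative C y) (at y)"
      and init: "C 0 = 1" "S 0 = 0" and r: "0 \<le> r" "r < 1/2" and K: "0 < K"
      and bounds: "\<And>y. 0 \<le> y \<Longrightarrow> \<bar>C y\<bar> \<le> K * exp (r * y)" "\<And>y. 0 \<le> y \<Longrightarrow> \<bar>S y\<bar> \<le> K * exp (r * y)"
      define g :: "real^2" where "g = vector [- \<alpha>\<^sub>2, \<alpha>\<^sub>1]"
      define h h' where "h y = C y *\<^sub>R e_vector + S y *\<^sub>R g"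
        and "h' y = (\<alpha>\<^sub>1 * \<alpha>\<^sub>2 * S y) *\<^sub>R e_vector + C y *\<^sub>R g" for y
      define K' where "K' = K * ((1 + \<bar>\<alpha>\<^sub>1 * \<alpha>\<^sub>2\<bar>) * norm e_vector + norm g + 1)"
      have kernel: "e_vector v* matrix_powr (t / s) (A_matrix \<alpha>\<^sub>1 \<alpha>\<^sub>2) = h (ln (t / s))" for t s
        unfolding matrix_powr_def matrix_exp_A_matrix[OF series] e_vector_kernel h_def g_def ..
      have comb: "norm (x *\<^sub>R e_vector + z *\<^sub>R g) \<le> K' * exp (r * y)"
        if "\<bar>x\<bar> \<le> (1 + \<bar>\<alpha>\<^sub>1 * \<alpha>\<^sub>2\<bar>) * (K * exp (r * y))" "\<bar>z\<bar> \<le> K * exp (r * y)" for x y z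
      proof -
        have "norm (x *\<^sub>R e_vector + z *\<^sub>R g) \<le> \<bar>x\<bar> * norm e_vector + \<bar>z\<bar> * norm g"
          by (rule norm_triangle_le) simp
        also have "\<dots> \<le> ((1 + \<bar>\<alpha>\<^sub>1 * \<alpha>\<^sub>2\<bar>) * (K * exp (r * y))) * norm e_vector + (K * exp (r * y)) * norm g"
          using that by (intro add_mono mult_right_mono) auto
        also have "\<dots> \<le> K' * exp (r * y)"
        proof -
          have "0 \<le> K * exp (r * y)" using K by simp
          thus ?thesis by (simp add: K'_def algebra_simps)
        qed
        finally show ?thesis .
      qed
      have "AE \<omega> in M. Limsup at_top (\<lambda>t. ereal (\<sigma> * (V t \<omega> / sqrt (2 * t * ln (ln t)))))
          = ereal (sqrt (2 * (1 - \<alpha>\<^sub>1 - \<alpha>\<^sub>2 + (\<alpha>\<^sub>1 - \<alpha>\<^sub>2)\<^sup>2) / (1 - 4 * \<alpha>\<^sub>1 * \<alpha>\<^sub>2)))"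
      proof (rule self_similar_lil_signs[OF B gauss cont, where h=h and h'=h' and K=K' and r=r])
        show "has_wiener_integral M B t (\<lambda>s. h (ln (t / s))) (V t)" if "0 < t" for t
          using V that unfolding kernel by blast
        show "(h has_vector_derivative h' y) (at y)" for y
          unfolding h_def[abs_def] h'_def
          using has_vector_derivative_add[OF has_vector_derivative_scaleR[OF deriv(1) has_vector_derivative_const]
              has_vector_derivative_scaleR[OF deriv(2) has_vector_derivative_const]] by simp
        show "norm (h y) \<le> K' * exp (r * y)" if "0 \<le> y" for y
          unfolding h_def
        proof (rule comb)
          have "0 \<le> \<bar>\<alpha>\<^sub>1 * \<alpha>\<^sub>2\<bar> * (K * exp (r * y))" using K by simp
          thus "\<bar>C y\<bar> \<le> (1 + \<bar>\<alpha>\<^sub>1 * \<alpha>\<^sub>2\<bar>) * (K * exp (r * y))"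
            using bounds(1)[OF that] unfolding distrib_right by linarith
        qed (use bounds that in auto)
        show "norm (h' y) \<le> K' * exp (r * y)" if "0 \<le> y" for y
          unfolding h'_def
        proof (rule comb)
          have "\<bar>\<alpha>\<^sub>1 * \<alpha>\<^sub>2 * S y\<bar> \<le> \<bar>\<alpha>\<^sub>1 * \<alpha>\<^sub>2\<bar> * (K * exp (r * y))"
            unfolding abs_mult[of "\<alpha>\<^sub>1 * \<alpha>\<^sub>2"] by (intro mult_left_mono bounds that) auto
          moreover have "0 \<le> K * exp (r * y)" using K by simp
          ultimately show "\<bar>\<alpha>\<^sub>1 * \<alpha>\<^sub>2 * S y\<bar> \<le> (1 + \<bar>\<alpha>\<^sub>1 * \<alpha>\<^sub>2\<bar>) * (K * exp (r * y))"
            unfolding distrib_right by linarith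
        qed (use bounds that in auto)
        have "0 < (1 + \<bar>\<alpha>\<^sub>1 * \<alpha>\<^sub>2\<bar>) * norm e_vector + norm g + 1"
          by (intro add_nonneg_pos add_nonneg_nonneg) auto
        thus "0 < K'" using K by (simp add: K'_def)
        show "((\<lambda>u. (norm (h (- ln u)))\<^sup>2) has_integral
            2 * (1 - \<alpha>\<^sub>1 - \<alpha>\<^sub>2 + (\<alpha>\<^sub>1 - \<alpha>\<^sub>2)\<^sup>2) / (1 - 4 * \<alpha>\<^sub>1 * \<alpha>\<^sub>2)) {0..1}"
          unfolding h_def g_def norm_kernel_square
          by (rule kernel_energy[OF True deriv init r K bounds])
        show "0 < 2 * (1 - \<alpha>\<^sub>1 - \<alpha>\<^sub>2 + (\<alpha>\<^sub>1 - \<alpha>\<^sub>2)\<^sup>2) / (1 - 4 * \<alpha>\<^sub>1 * \<alpha>\<^sub>2)"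
          by (rule limit_variance_positive[OF True])
      qed (use r \<sigma> in auto)
      thus ?thesis using True by simp
    qed
  next
    case False
    with assms(4) have \<alpha>: "\<alpha>\<^sub>1 = \<alpha>\<^sub>2" "1/2 \<le> \<alpha>\<^sub>1" "\<alpha>\<^sub>1 < 1" by auto
    have "\<exists>W :: real \<Rightarrow> 'a \<Rightarrow> real. standard_brownian_motion M W \<and>
        (\<forall>t>0. \<exists>J. has_wiener_integral M W t (\<lambda>s. (t / s) powr (- \<alpha>\<^sub>1)) J \<and> (AE \<omega> in M. V t \<omega> = sqrt 2 * J \<omega>))"
      using assms(5) \<alpha> unfolding limit_process_def by blast
    then obtain W :: "real \<Rightarrow> 'a \<Rightarrow> real" where W: "standard_brownian_motion M W"
      and J: "\<forall>t>0. \<exists>J. has_wiener_integral M W t (\<lambda>s. (t / s) powr (- \<alpha>\<^sub>1)) J \<and> (AE \<omega> in M. V t \<omega> = sqrt 2 * J \<omega>)"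
      by (elim exE conjE)
    define h h' where "h y = sqrt 2 * exp (- \<alpha>\<^sub>1 * y)" and "h' y = sqrt 2 * (exp (- \<alpha>\<^sub>1 * y) * - \<alpha>\<^sub>1)" for y
    have sqrt2: "sqrt 2 \<le> 2" by (rule real_le_lsqrt) auto
    have "AE \<omega> in M. Limsup at_top (\<lambda>t. ereal (\<sigma> * (V t \<omega> / sqrt (2 * t * ln (ln t)))))
        = ereal (sqrt (2 / (1 + 2 * \<alpha>\<^sub>1)))"
    proof (rule self_similar_lil_signs[OF W gauss cont, where h=h and h'=h' and K=2 and r=0])
      show "has_wiener_integral M W t (\<lambda>s. h (ln (t / s))) (V t)" if t: "0 < t" for t
      proof -
        obtain J where J: "has_wiener_integral M W t (\<lambda>s. (t / s) powr (- \<alpha>\<^sub>1)) J" "AE \<omega> in M. V t \<omega>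
          = sqrt 2 * J \<omega>"
          using J t by blast
        have "V t \<in> borel_measurable M"
          using gauss[unfolded centered_gaussian_process_def, rule_format, of "{t}" "\<lambda>_. 1"] t
          by (simp add: centered_gaussian_rv_def)
        from has_wiener_integral_cong_AE[OF has_wiener_integral_scaleR[OF W J(1)] this J(2)]
        have "has_wiener_integral M W t (\<lambda>s. sqrt 2 *\<^sub>R (t / s) powr (- \<alpha>\<^sub>1)) (V t)" .
        thus ?thesis
          by (rule has_wiener_integral_cong[THEN iffD1, rotated]) (use t in \<open>auto simp: h_def powr_def\<close>)
      qed
      show "(h has_vector_derivative h' y) (at y)" for y
        unfolding has_real_derivative_iff_has_vector_derivative[symmetric] h_def[abs_def] h'_def
        by (auto intro!: derivative_eq_intros)
      fix y :: real assume y: "0 \<le> y"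
      have e: "exp (- \<alpha>\<^sub>1 * y) \<le> 1" using y \<alpha> by simp
      have "sqrt 2 * exp (- \<alpha>\<^sub>1 * y) \<le> 2 * 1" by (intro mult_mono sqrt2 e) auto
      thus "norm (h y) \<le> 2 * exp (0 * y)" by (simp add: h_def abs_mult)
      have "sqrt 2 * (exp (- \<alpha>\<^sub>1 * y) * \<alpha>\<^sub>1) \<le> 2 * (1 * 1)" using \<alpha> by (intro mult_mono sqrt2 e) auto
      thus "norm (h' y) \<le> 2 * exp (0 * y)" using \<alpha> by (simp add: h'_def abs_mult)
    next
      have "((\<lambda>u. 2 * u powr (2 * \<alpha>\<^sub>1)) has_integral 2 * (1 powr (2 * \<alpha>\<^sub>1 + 1) / (2 * \<alpha>\<^sub>1 + 1))) {0..1}"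
        using \<alpha> by (intro has_integral_mult_right has_integral_powr_from_0) auto
      \<comment> \<open>The two integrands differ at \<open>u = 0\<close>, where \<open>ln 0 = 0\<close> but \<open>0 powr (2 * \<alpha>\<^sub>1) = 0\<close>.\<close>
      hence "((\<lambda>u. (norm (h (- ln u)))\<^sup>2) has_integral 2 * (1 powr (2 * \<alpha>\<^sub>1 + 1) / (2 * \<alpha>\<^sub>1 + 1))) {0..1}"
      proof (rule has_integral_spike_finite[where S="{0}", rotated 2])
        fix u :: real assume "u \<in> {0..1} - {0}"
        thus "(norm (h (- ln u)))\<^sup>2 = 2 * u powr (2 * \<alpha>\<^sub>1)"
          by (simp add: h_def power_mult_distrib powr_def exp_double[symmetric] mult_ac)
      qed simp
      thus "((\<lambda>u. (norm (h (- ln u)))\<^sup>2) has_integral 2 / (1 + 2 * \<alpha>\<^sub>1)) {0..1}"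
        by (simp add: add.commute)
      show "0 < 2 / (1 + 2 * \<alpha>\<^sub>1)" using \<alpha> by simp
    qed (use \<sigma> in auto)
    thus ?thesis using False by simp
  qed
qed

end
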